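(* For each finite $n\ge 1$, the decision problem $\textsc{Check-Id}(\mathsf{baxt}_n,{}^{\sharp})$ belongs to the complexity class $\mathsf{P}$; that is, for each fixed $n$ there is a polynomial-time algorithm which, given an arbitrary word identity $\mathbf{u}\approx\mathbf{v}$, decides whether $(\mathsf{baxt}_n,{}^{\sharp})$ satisfies $\mathbf{u}\approx\mathbf{v}$.
   Context: Baxter monoid: for $n\ge 1$ let $\mathcal{A}_n=\{1<2<\cdots<n\}$ and let $\mathcal{A}_n^{\star}$ be the free monoid on $\mathcal{A}_n$. Then $\mathsf{baxt}_n=\mathcal{A}_n^{\star}/\!\equiv$, where $\equiv$ is the congruence generated by all pairs $(c\mathbf{u}ad\mathbf{v}b,\ c\mathbf{u}da\mathbf{v}b)$ with $a\le b<c\le d$ and $(b\mathbf{u}da\mathbf{v}c,\ b\mathbf{u}ad\mathbf{v}c)$ with $a<b\le c<d$, where $a,b,c,d\in\mathcal{A}_n$, $\mathbf{u},\mathbf{v}\in\mathcal{A}_n^{\star}$. Schützenberger's involution $^{\sharp}$ on $\mathsf{baxt}_n$ is induced by $i^{\sharp}=n+1-i$ and $(w_1\cdots w_k)^{\sharp}=w_k^{\sharp}\cdots w_1^{\sharp}$. $\mathcal{X}$ is a countably infinite alphabet and $\mathcal{X}^*=\{x^*:x\in\mathcal{X}\}$ a disjoint copy. A word identity is an expression $\mathbf{u}\approx\mathbf{v}$ with $\mathbf{u},\mathbf{v}\in(\mathcal{X}\cup\mathcal{X}^* )^+$; $(M,{}^* )$ satisfies it if for every map $\varphi:\mathcal{X}\to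 M$, extended by $\varphi(x^* )=\varphi(x)^*$ and multiplicatively to words, $\varphi(\mathbf{u})=\varphi(\mathbf{v})$. The problem $\textsc{Check-Id}(M,{}^* )$ has as instance an arbitrary word identity $\mathbf{u}\approx\mathbf{v}$; the answer is YES if $(M,{}^* )$ satisfies it and NO otherwise. Polynomial time is measured in the input size, i.e. in the lengths of $\mathbf{u}$ and $\mathbf{v}$. *)

theory Defs
  imports "HOL-Algebra.Group" "HOL-Computational_Algebra.Polynomial"
begin

section \<open>The Baxter monoid with Schuetzenberger's involution\<close>

text \<open>The letters of the ordered alphabet of rank \<open>n\<close> are the natural numbers \<open>1, \<dots>, n\<close>;
  its free monoid is \<open>lists {1..n}\<close> under concatenation.\<close>

inductive_set baxt_cong :: "nat \<Rightarrow> (nat list \<times> nat list) set" for n :: nat where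
  gen1: "\<lbrakk>a \<le> b; b < c; c \<le> d; {a, b, c, d} \<subseteq> {1..n}; u \<in> lists {1..n}; v \<in> lists {1..n}\<rbrakk>
    \<Longrightarrow> ([c] @ u @ [a, d] @ v @ [b], [c] @ u @ [d, a] @ v @ [b]) \<in> baxt_cong n"
| gen2: "\<lbrakk>a < b; b \<le> c; c < d; {a, b, c, d} \<subseteq> {1..n}; u \<in> lists {1..n}; v \<in> lists {1..n}\<rbrakk>
    \<Longrightarrow> ([b] @ u @ [d, a] @ v @ [c], [b] @ u @ [a, d] @ v @ [c]) \<in> baxt_cong n"
| cong_refl: "w \<in> lists {1..n} \<Longrightarrow> (w, w) \<in> baxt_cong n"
| cong_sym: "(x, y) \<in> baxt_cong n \<Longrightarrow> (y, x) \<in> baxt_cong n"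
| cong_trans: "\<lbrakk>(x, y) \<in> baxt_cong n; (y, z) \<in> baxt_cong n\<rbrakk> \<Longrightarrow> (x, z) \<in> baxt_cong n"
| cong_append: "\<lbrakk>(x, y) \<in> baxt_cong n; (x', y') \<in> baxt_cong n\<rbrakk> \<Longrightarrow> (x @ x', y @ y') \<in> baxt_cong n"

definition baxt :: "nat \<Rightarrow> nat list set monoid" where
  "baxt n =
    \<lparr>carrier = lists {1..n} // baxt_cong n,
     monoid.mult = (\<lambda>A B. \<Union>x\<in>A. \<Union>y\<in>B. baxt_cong n `` {x @ y}),
     monoid.one = baxt_cong n `` {[]}\<rparr>"

definition word_sharp :: "nat \<Rightarrow> nat list \<Rightarrow> nat list" where
  "word_sharp n w = rev (map (\<lambda>i. n + 1 - i) w)"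

definition baxt_sharp :: "nat \<Rightarrow> nat list set \<Rightarrow> nat list set" where
  "baxt_sharp n A = (\<Union>w\<in>A. baxt_cong n `` {word_sharp n w})"

text \<open>The operations on classes are well defined.\<close>

lemma baxt_cong_lists: "(x, y) \<in> baxt_cong n \<Longrightarrow> x \<in> lists {1..n} \<and> y \<in> lists {1..n}"
  by (induction rule: baxt_cong.induct) auto

lemma equiv_baxt_cong: "equiv (lists {1..n}) (baxt_cong n)"
proof (rule equivI)
  show "baxt_cong n \<subseteq> lists {1..n} \<times> lists {1..n}"
    by (auto dest: baxt_cong_lists simp del: in_lists_conv_set)
  show "refl_on (lists {1..n}) (baxt_cong n)"
    unfolding refl_on_def using baxt_cong_lists baxt_cong.cong_refl by blast
  show "sym (baxt_cong n)"
    using baxt_cong.cong_sym by (meson symI)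
  show "trans (baxt_cong n)"
    using baxt_cong.cong_trans by (meson transI)
qed

lemma mult_baxt_class:
  assumes "x \<in> lists {1..n}" "y \<in> lists {1..n}"
  shows "baxt_cong n `` {x} \<otimes>\<^bsub>baxt n\<^esub> baxt_cong n `` {y} = baxt_cong n `` {x @ y}"
proof -
  let ?X = "baxt_cong n `` {x}" and ?Y = "baxt_cong n `` {y}" and ?Z = "baxt_cong n `` {x @ y}"
  have "baxt_cong n `` {x' @ y'} = ?Z" if "x' \<in> ?X" "y' \<in> ?Y" for x' y'
    using that equiv_class_eq[OF equiv_baxt_cong] baxt_cong.cong_append by (metis Image_singleton_iff)
  then have "(\<Union>x'\<in>?X. \<Union>y'\<in>?Y. baxt_cong n `` {x' @ y'}) = (\<Union>x'\<in>?X. \<Union>y'\<in>?Y. ?Z)"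
    by (intro SUP_cong HOL.refl)
  moreover have "x \<in> ?X" "y \<in> ?Y"
    using assms baxt_cong.cong_refl by auto
  ultimately show ?thesis
    unfolding baxt_def by auto
qed

lemma word_sharp_append: "word_sharp n (x @ y) = word_sharp n y @ word_sharp n x"
  by (simp add: word_sharp_def)

lemma word_sharp_lists: "w \<in> lists {1..n} \<Longrightarrow> word_sharp n w \<in> lists {1..n}"
  by (fastforce simp: word_sharp_def)

lemma baxt_cong_word_sharp:
  "(x, y) \<in> baxt_cong n \<Longrightarrow> (word_sharp n x, word_sharp n y) \<in> baxt_cong n"
proof (induction rule: baxt_cong.induct)
  case (gen1 a b c d u v)
  have "([n + 1 - b] @ word_sharp n v @ [n + 1 - d, n + 1 - a] @ word_sharp n u @ [n + 1 - c],
      [n + 1 - b] @ word_sharp n v @ [n + 1 - a, n + 1 - d] @ word_sharp n u @ [n + 1 - c])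
      \<in> baxt_cong n"
    by (rule baxt_cong.gen1) (use gen1 word_sharp_lists in auto)
  then show ?case by (simp add: word_sharp_def)
next
  case (gen2 a b c d u v)
  have "([n + 1 - c] @ word_sharp n v @ [n + 1 - a, n + 1 - d] @ word_sharp n u @ [n + 1 - b],
      [n + 1 - c] @ word_sharp n v @ [n + 1 - d, n + 1 - a] @ word_sharp n u @ [n + 1 - b])
      \<in> baxt_cong n"
    by (rule baxt_cong.gen2) (use gen2 word_sharp_lists in auto)
  then show ?case by (simp add: word_sharp_def)
next
  case (cong_refl w)
  then show ?case by (intro baxt_cong.cong_refl word_sharp_lists)
next
  case (cong_append x y x' y')
  then show ?case by (simp add: word_sharp_append baxt_cong.cong_append)
qed (blast intro: baxt_cong.cong_sym baxt_cong.cong_trans)+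

lemma baxt_sharp_class:
  assumes "w \<in> lists {1..n}"
  shows "baxt_sharp n (baxt_cong n `` {w}) = baxt_cong n `` {word_sharp n w}"
proof -
  let ?X = "baxt_cong n `` {w}" and ?Z = "baxt_cong n `` {word_sharp n w}"
  have "baxt_cong n `` {word_sharp n w'} = ?Z" if "w' \<in> ?X" for w'
    using that equiv_class_eq[OF equiv_baxt_cong] baxt_cong_word_sharp by (metis Image_singleton_iff)
  then have "(\<Union>w'\<in>?X. baxt_cong n `` {word_sharp n w'}) = (\<Union>w'\<in>?X. ?Z)"
    by (intro SUP_cong HOL.refl)
  moreover have "w \<in> ?X"
    using assms baxt_cong.cong_refl by auto
  ultimately show ?thesis
    unfolding baxt_sharp_def by auto
qed

section \<open>Word identities\<close>

text \<open>Words over the union of an alphabet and its starred copy; below the alphabet is \<open>nat\<close>.\<close>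

datatype 'x letter = Plain 'x | Starred 'x

fun eval_letter :: "('a \<Rightarrow> 'a) \<Rightarrow> ('x \<Rightarrow> 'a) \<Rightarrow> 'x letter \<Rightarrow> 'a" where
  "eval_letter star \<phi> (Plain x) = \<phi> x"
| "eval_letter star \<phi> (Starred x) = star (\<phi> x)"

definition eval_word ::
    "('a, 'm) monoid_scheme \<Rightarrow> ('a \<Rightarrow> 'a) \<Rightarrow> ('x \<Rightarrow> 'a) \<Rightarrow> 'x letter list \<Rightarrow> 'a" where
  "eval_word M star \<phi> w = foldr (\<lambda>l m. eval_letter star \<phi> l \<otimes>\<^bsub>M\<^esub> m) w \<one>\<^bsub>M\<^esub>"

definition satisfies_identity ::
    "('a, 'm) monoid_scheme \<Rightarrow> ('a \<Rightarrow> 'a) \<Rightarrow> 'x letter list \<Rightarrow> 'x letter list \<Rightarrow> bool" where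
  "satisfies_identity M star u v \<longleftrightarrow>
    (\<forall>\<phi>. range \<phi> \<subseteq> carrier M \<longrightarrow> eval_word M star \<phi> u = eval_word M star \<phi> v)"

section \<open>Deterministic multi-tape Turing machines and the class P\<close>

datatype 'a tape_symbol = Blank | Input 'a | Aux nat

datatype move = MoveLeft | MoveRight | Stay

text \<open>The control states are natural numbers.  A transition maps the state and the symbols
  scanned by the heads to the next state and, for each tape, the symbol to write and the head
  movement.  Only finitely many states and tape symbols are allowed, see \<open>wf_tm\<close>; the values of
  \<open>delta\<close> on other arguments are irrelevant.\<close>

record 'a tm =
  num_tapes :: nat
  states :: "nat set"
  symbols :: "'a tape_symbol set"
  start :: nat
  accept :: nat
  reject :: nat
  delta :: "nat \<Rightarrow> 'a tape_symbol list \<Rightarrow> nat \<times> ('a tape_symbol \<times> move) list"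

definition wf_tm :: "'a tm \<Rightarrow> bool" where
  "wf_tm M \<longleftrightarrow>
    1 \<le> num_tapes M \<and> finite (states M) \<and> finite (symbols M) \<and>
    insert Blank (range Input) \<subseteq> symbols M \<and>
    {start M, accept M, reject M} \<subseteq> states M \<and> accept M \<noteq> reject M \<and>
    (\<forall>q \<in> states M - {accept M, reject M}. \<forall>ss \<in> lists (symbols M). length ss = num_tapes M \<longrightarrow>
      (case delta M q ss of (q', as) \<Rightarrow>
        q' \<in> states M \<and> length as = num_tapes M \<and> fst ` set as \<subseteq> symbols M))"

text \<open>A tape is infinite in both directions; it is given by its head position and contents.\<close>

type_synonym 'a tape = "int \<times> (int \<Rightarrow> 'a tape_symbol)"

type_synonym 'a config = "nat \<times> 'a tape list"

fun read_tape :: "'a tape \<Rightarrow> 'a tape_symbol" where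
  "read_tape (h, f) = f h"

fun move_head :: "move \<Rightarrow> int \<Rightarrow> int" where
  "move_head MoveLeft h = h - 1"
| "move_head MoveRight h = h + 1"
| "move_head Stay h = h"

fun act_tape :: "'a tape_symbol \<times> move \<Rightarrow> 'a tape \<Rightarrow> 'a tape" where
  "act_tape (s, m) (h, f) = (move_head m h, f(h := s))"

fun tm_step :: "'a tm \<Rightarrow> 'a config \<Rightarrow> 'a config" where
  "tm_step M (q, ts) =
    (if q \<in> {accept M, reject M} then (q, ts)
     else case delta M q (map read_tape ts) of (q', as) \<Rightarrow> (q', map2 act_tape as ts))"

definition input_tape :: "'a list \<Rightarrow> 'a tape" where
  "input_tape w = (0, \<lambda>i. if 0 \<le> i \<and> i < int (length w) then Input (w ! nat i) else Blank)"

definition tm_init :: "'a tm \<Rightarrow> 'a list \<Rightarrow> 'a config" where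
  "tm_init M w = (start M, input_tape w # replicate (num_tapes M - 1) (input_tape []))"

text \<open>Accepting and rejecting configurations are fixed by \<open>tm_step\<close>, so the state after exactly
  \<open>t\<close> steps tells whether the machine has halted within \<open>t\<close> steps, and with which answer.\<close>

definition state_after :: "'a tm \<Rightarrow> 'a list \<Rightarrow> nat \<Rightarrow> nat" where
  "state_after M w t = fst ((tm_step M ^^ t) (tm_init M w))"

definition decides_in_time :: "'a tm \<Rightarrow> 'a list set \<Rightarrow> (nat \<Rightarrow> nat) \<Rightarrow> bool" where
  "decides_in_time M L T \<longleftrightarrow>
    (\<forall>w. state_after M w (T (length w)) = (if w \<in> L then accept M else reject M))"

definition complexity_P :: "'a::finite list set set" where
  "complexity_P = {L. \<exists>M (p :: nat poly). wf_tm M \<and> decides_in_time M L (poly p)}"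

section \<open>The identity checking problem\<close>

datatype code_symbol = Bit bool | Asterisk | Separator | Approx

instance code_symbol :: finite
proof
  have "(UNIV :: code_symbol set) \<subseteq> range Bit \<union> {Asterisk, Separator, Approx}"
    using code_symbol.exhaust by blast
  then show "finite (UNIV :: code_symbol set)"
    by (rule finite_subset) simp
qed

text \<open>Binary notation without leading zeros, least significant bit first; zero is the empty string.\<close>

fun binary :: "nat \<Rightarrow> bool list" where
  "binary i = (if i = 0 then [] else odd i # binary (i div 2))"

declare binary.simps [simp del]

fun encode_letter :: "nat letter \<Rightarrow> code_symbol list" where
  "encode_letter (Plain i) = map Bit (binary i) @ [Separator]"
| "encode_letter (Starred i) = map Bit (binary i) @ [Asterisk, Separator]"

definition encode_word :: "nat letter list \<Rightarrow> code_symbol list" where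
  "encode_word w = concat (map encode_letter w)"

definition encode_identity :: "nat letter list \<Rightarrow> nat letter list \<Rightarrow> code_symbol list" where
  "encode_identity u v = encode_word u @ [Approx] @ encode_word v"

definition Check_Id :: "('a, 'm) monoid_scheme \<Rightarrow> ('a \<Rightarrow> 'a) \<Rightarrow> code_symbol list set" where
  "Check_Id M star =
    {encode_identity u v | u v. u \<noteq> [] \<and> v \<noteq> [] \<and> satisfies_identity M star u v}"

text \<open>The encoding is lossless, and its length is polynomially related to the lengths of the two
  words as long as the names of the variables are chosen economically, e.g. among the first
  \<open>length u + length v\<close> ones.\<close>

lemma binary_inj: "binary i = binary j \<Longrightarrow> i = j"
proof (induction i arbitrary: j rule: binary.induct)
  case (1 i)
  show ?case
  proof (cases "i = 0 \<or> j = 0")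
    case True
    then show ?thesis using "1.prems" by (auto simp: binary.simps split: if_splits)
  next
    case False
    then have "odd i = odd j" and *: "binary (i div 2) = binary (j div 2)"
      using "1.prems" by (auto simp: binary.simps[of i] binary.simps[of j])
    moreover have "i div 2 = j div 2"
      using "1.IH" False * by blast
    ultimately show ?thesis
      by (metis odd_iff_mod_2_eq_one even_iff_mod_2_eq_zero div_mult_mod_eq)
  qed
qed

lemma length_binary: "length (binary i) \<le> i"
proof (induction i rule: binary.induct)
  case (1 i)
  then show ?case by (cases "i = 0") (simp_all add: binary.simps[of i] binary.simps[of 0])
qed

lemma encode_letter_append_inj:
  assumes "encode_letter k @ r = encode_letter l @ s"
  shows "k = l \<and> r = s"
proof -
  have *: "i = j \<and> r' = s'"
    if "map Bit (binary i) @ r' = map Bit (binary j) @ s'"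
      "r' \<noteq> []" "s' \<noteq> []" "hd r' \<notin> range Bit" "hd s' \<notin> range Bit"
    for i j r' s'
  proof -
    have tw: "takeWhile (\<lambda>c. c \<in> range Bit) (map Bit bs @ t) = map Bit bs"
      if "t \<noteq> []" "hd t \<notin> range Bit" for bs t
      using that by (induction bs) (cases t, auto)+
    have "map Bit (binary i) = map Bit (binary j)"
      using tw[OF that(2,4), of "binary i"] tw[OF that(3,5), of "binary j"] that(1) by simp
    moreover from this have "binary i = binary j"
      by (simp add: inj_map_eq_map inj_def)
    ultimately show ?thesis using that(1) binary_inj by simp
  qed
  show ?thesis
    using assms by (cases k; cases l) (force dest!: *)+
qed

lemma encode_letter_neq_Approx: "encode_letter l @ r \<noteq> Approx # s"
  by (cases l) (auto simp: append_eq_Cons_conv map_eq_Cons_conv)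

lemma encode_word_append_inj:
  "encode_word u @ Approx # r = encode_word u' @ Approx # s \<Longrightarrow> u = u' \<and> r = s"
proof (induction u arbitrary: u')
  case Nil
  then show ?case
    by (cases u') (auto simp: encode_word_def dest: notE[OF encode_letter_neq_Approx, OF sym])
next
  case (Cons l u)
  show ?case
  proof (cases u')
    case Nil
    then show ?thesis
      using Cons.prems by (simp add: encode_word_def encode_letter_neq_Approx)
  next
    case u': (Cons l' w)
    have "encode_letter l @ encode_word u @ Approx # r = encode_letter l' @ encode_word w @ Approx # s"
      using Cons.prems by (simp add: u' encode_word_def)
    then show ?thesis
      using encode_letter_append_inj Cons.IH u' by blast
  qed
qed

lemma encode_identity_inj: "encode_identity u v = encode_identity u' v' \<longleftrightarrow> u = u' \<and> v = v'"
proof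
  assume "encode_identity u v = encode_identity u' v'"
  then have u: "u = u'" and v: "encode_word v = encode_word v'"
    by (auto simp: encode_identity_def dest: encode_word_append_inj)
  from v have "encode_word v @ Approx # [] = encode_word v' @ Approx # []"
    by simp
  then show "u = u' \<and> v = v'"
    using u encode_word_append_inj by blast
qed simp

lemma length_encode_word_ge: "length w \<le> length (encode_word w)"
proof (induction w)
  case (Cons l w)
  then show ?case by (cases l) (auto simp: encode_word_def)
qed simp

lemma length_encode_word_le:
  assumes "set w \<subseteq> Plain ` {..<N} \<union> Starred ` {..<N}"
  shows "length (encode_word w) \<le> length w * (N + 2)"
  using assms
proof (induction w)
  case (Cons l w)
  have "length (encode_letter l) \<le> N + 2"
  proof -
    obtain i where "i < N" "l = Plain i \<or> l = Starred i"
      using Cons.prems by auto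
    then show ?thesis
      using length_binary[of i] by auto
  qed
  then show ?case using Cons by (auto simp: encode_word_def)
qed (simp add: encode_word_def)

lemma length_encode_identity:
  "length u + length v \<le> length (encode_identity u v)"
  "\<lbrakk>set u \<subseteq> Plain ` {..<N} \<union> Starred ` {..<N}; set v \<subseteq> Plain ` {..<N} \<union> Starred ` {..<N}\<rbrakk>
    \<Longrightarrow> length (encode_identity u v) \<le> (length u + length v) * (N + 2) + 1"
  using length_encode_word_ge[of u] length_encode_word_ge[of v]
    length_encode_word_le[of u N] length_encode_word_le[of v N]
  by (auto simp: encode_identity_def algebra_simps)

end

theory Submission
  imports Defs
begin

text \<open>
  Two words over \<open>{1..n}\<close> are Baxter congruent iff they have the same content and agree, for all
  \<open>a < c\<close>, in the number of letters \<open>a\<close> before the first letter in \<open>{a<..c}\<close> and in the number of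
  letters \<open>c\<close> after the last letter in \<open>{a..<c}\<close>.  Such a count over the value of a word under a
  substitution is a sum of contributions of the single letter positions in the images of the
  variables.  If two counts differ, they still differ after deleting all positions except the two
  that end the counting in the two words and one further position.  Hence an identity that fails
  already fails under a substitution of total length at most three, and the absence of such a
  substitution is expressible over the encoded identity in first-order logic with the Haertig
  (equicardinality) quantifier.  A multi-tape machine whose heads serve as bounded counters evaluates
  such a formula in polynomial time.
\<close>

section \<open>Programs for Turing machines\<close>

text \<open>Restricting a substitution affects all occurrences of a variable at once, so the letters
  of a value are grouped by the position of an image from which they come, and each group is kept or
  deleted as a whole. As long as the places where counting stops in the two words survive, every
  kept group contributes the same number as before. Counts are then additive over the kept groups,
  and a difference of totals yields one group with different contributions.

  Since \<open>n\<close> is fixed, the letters of such a small substitution and the pairs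
  \<open>a\<close>, \<open>c\<close> are expanded into a finite conjunction; only the choice of the
  variables that receive these letters is left to quantifiers. Equicardinality is used for two
  purposes: to compare the counts in the two sides of the identity, and to match the bits of two
  variable names, which are binary strings of unbounded length. No arithmetic is required beyond
  equality of counters, and these stay below a constant times the input length.\<close>

datatype 'a prog =
  Act "'a tape_symbol list \<Rightarrow> ('a tape_symbol \<times> move) list"
| Seq "'a prog" "'a prog"
| Cond "'a tape_symbol list \<Rightarrow> bool" "'a prog" "'a prog"
| While "'a tape_symbol list \<Rightarrow> bool" "'a prog"

text \<open>Time is charged as the machine below spends it: one step for each action, each unfolding
  of \<open>Seq\<close> and each test of \<open>Cond\<close> or \<open>While\<close>.\<close>

inductive exec :: "'a prog \<Rightarrow> 'a tape list \<Rightarrow> nat \<Rightarrow> 'a tape list \<Rightarrow> bool" where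
  exec_Act: "exec (Act g) ts 1 (map2 act_tape (g (map read_tape ts)) ts)"
| exec_Seq: "exec p ts t1 ts1 \<Longrightarrow> exec q ts1 t2 ts2 \<Longrightarrow> exec (Seq p q) ts (Suc (t1 + t2)) ts2"
| exec_Cond: "exec (if b (map read_tape ts) then p else q) ts t ts' \<Longrightarrow> exec (Cond b p q) ts (Suc t) ts'"
| exec_While_True: "b (map read_tape ts) \<Longrightarrow> exec p ts t1 ts1 \<Longrightarrow> exec (While b p) ts1 t2 ts2
    \<Longrightarrow> exec (While b p) ts (Suc (t1 + t2)) ts2"
| exec_While_False: "\<not> b (map read_tape ts) \<Longrightarrow> exec (While b p) ts 1 ts"

text \<open>The machine for a program has as control states the stacks of programs still to be
  executed; every reduction of the top of the stack takes one step.\<close>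

fun next_stack :: "'a prog list \<Rightarrow> 'a tape_symbol list \<Rightarrow> 'a prog list" where
  "next_stack [] ss = []"
| "next_stack (Act g # k) ss = k"
| "next_stack (Seq p q # k) ss = p # q # k"
| "next_stack (Cond b p q # k) ss = (if b ss then p else q) # k"
| "next_stack (While b p # k) ss = (if b ss then p # While b p # k else k)"

definition idle :: "'a tape_symbol list \<Rightarrow> ('a tape_symbol \<times> move) list" where
  "idle ss = map (\<lambda>s. (s, Stay)) ss"

fun stack_act :: "'a prog list \<Rightarrow> 'a tape_symbol list \<Rightarrow> ('a tape_symbol \<times> move) list" where
  "stack_act (Act g # k) ss = g ss"
| "stack_act k ss = idle ss"

text \<open>Control states must come from a finite set, whereas stacks of programs are unbounded in
  general. Below a subprogram of \<open>p\<close> only the rest that surrounds it in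
  \<open>p\<close> can be pending, so one stack per node of the syntax tree suffices; the empty
  stack is added separately.\<close>

fun stacks :: "'a prog \<Rightarrow> 'a prog list set" where
  "stacks (Act g) = {[Act g]}"
| "stacks (Seq p q) = insert [Seq p q] ((\<lambda>k. k @ [q]) ` stacks p \<union> stacks q)"
| "stacks (Cond b p q) = insert [Cond b p q] (stacks p \<union> stacks q)"
| "stacks (While b p) = insert [While b p] ((\<lambda>k. k @ [While b p]) ` stacks p)"

fun wf_prog :: "nat \<Rightarrow> 'a tape_symbol set \<Rightarrow> 'a prog \<Rightarrow> bool" where
  "wf_prog K S (Act g) \<longleftrightarrow>
    (\<forall>ss \<in> lists S. length ss = K \<longrightarrow> length (g ss) = K \<and> fst ` set (g ss) \<subseteq> S)"
| "wf_prog K S (Seq p q) \<longleftrightarrow> wf_prog K S p \<and> wf_prog K S q"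
| "wf_prog K S (Cond b p q) \<longleftrightarrow> wf_prog K S p \<and> wf_prog K S q"
| "wf_prog K S (While b p) \<longleftrightarrow> wf_prog K S p"

lemma finite_stacks: "finite (stacks p)"
  by (induction p) auto

lemma singleton_in_stacks: "[p] \<in> stacks p"
  by (cases p) auto

lemma stacks_nonempty: "k \<in> stacks p \<Longrightarrow> k \<noteq> []"
  by (induction p arbitrary: k) auto

lemma next_stack_append: "k \<noteq> [] \<Longrightarrow> next_stack (k @ l) ss = next_stack k ss @ l"
  by (cases "(k, ss)" rule: next_stack.cases) auto

lemma next_stack_closed: "k \<in> stacks p \<Longrightarrow> next_stack k ss \<in> insert [] (stacks p)"
proof (induction p arbitrary: k)
  case (Seq p q)
  then consider "k = [Seq p q]" | k' where "k = k' @ [q]" "k' \<in> stacks p" | "k \<in> stacks q"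
    by auto
  then show ?case
  proof cases
    case 1
    have "[p] @ [q] \<in> (\<lambda>k. k @ [q]) ` stacks p"
      by (rule imageI) (rule singleton_in_stacks)
    with 1 show ?thesis by simp
  next
    case 2
    with Seq.IH(1)[of k'] show ?thesis
      by (auto simp: next_stack_append stacks_nonempty singleton_in_stacks)
  next
    case 3
    with Seq.IH(2) show ?thesis by auto
  qed
next
  case (Cond b p q)
  then consider "k = [Cond b p q]" | "k \<in> stacks p" | "k \<in> stacks q"
    by auto
  then show ?case
    by cases (use Cond.IH singleton_in_stacks[of p] singleton_in_stacks[of q] in auto)
next
  case (While b p)
  then consider "k = [While b p]" | k' where "k = k' @ [While b p]" "k' \<in> stacks p"
    by auto
  then show ?case
  proof cases
    case 1
    have "[p] @ [While b p] \<in> (\<lambda>k. k @ [While b p]) ` stacks p"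
      by (rule imageI) (rule singleton_in_stacks)
    with 1 show ?thesis by simp
  next
    case 2
    with While.IH[of k'] show ?thesis
      by (auto simp: next_stack_append stacks_nonempty)
  qed
qed auto

lemma stack_act_wf:
  assumes "wf_prog K S p" "k \<in> stacks p" "ss \<in> lists S" "length ss = K"
  shows "length (stack_act k ss) = K \<and> fst ` set (stack_act k ss) \<subseteq> S"
proof -
  have idle: "length (idle ss) = K \<and> fst ` set (idle ss) \<subseteq> S"
    using assms by (auto simp: idle_def)
  have app: "stack_act (k @ l) ss = stack_act k ss" if "k \<noteq> []" for k l
    using that by (cases "(k, ss)" rule: stack_act.cases) auto
  show ?thesis using assms(1,2)
  proof (induction p arbitrary: k)
    case (Act g)
    then show ?case using assms(3,4) by auto
  next
    case (Seq p q)
    then consider "k = [Seq p q]" | k' where "k = k' @ [q]" "k' \<in> stacks p" | "k \<in> stacks q"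
      by auto
    then show ?case
      by cases (use Seq idle app[OF stacks_nonempty] in simp_all)
  next
    case (Cond b p q)
    then consider "k = [Cond b p q]" | "k \<in> stacks p" | "k \<in> stacks q"
      by auto
    then show ?case
      by cases (use Cond idle in simp_all)
  next
    case (While b p)
    then consider "k = [While b p]" | k' where "k = k' @ [While b p]" "k' \<in> stacks p"
      by auto
    then show ?case
      by cases (use While idle app[OF stacks_nonempty] in simp_all)
  qed
qed

lemma act_idle: "map2 act_tape (idle (map read_tape ts)) ts = ts"
  by (induction ts) (auto simp: idle_def)

definition stack_step :: "'a prog list \<times> 'a tape list \<Rightarrow> 'a prog list \<times> 'a tape list" where
  "stack_step = (\<lambda>(k, ts). (next_stack k (map read_tape ts),
     map2 act_tape (stack_act k (map read_tape ts)) ts))"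

text \<open>The pending rest \<open>k\<close> is kept arbitrary because \<open>Seq\<close> and
  \<open>While\<close> run their first part on top of what follows.\<close>

lemma stack_exec: "exec p ts t ts' \<Longrightarrow> (stack_step ^^ t) (p # k, ts) = (k, ts')"
proof (induction arbitrary: k rule: exec.induct)
  case (exec_Act g ts)
  then show ?case by (simp add: stack_step_def)
next
  case (exec_Seq p ts t1 ts1 q t2 ts2)
  have "(stack_step ^^ Suc (t1 + t2)) (Seq p q # k, ts) = (stack_step ^^ (t2 + t1)) (p # q # k, ts)"
    by (simp only: funpow_Suc_right o_apply) (simp add: stack_step_def act_idle add.commute)
  then show ?case by (simp only: funpow_add o_apply exec_Seq.IH)
next
  case (exec_Cond b ts p q t ts')
  have "(stack_step ^^ Suc t) (Cond b p q # k, ts)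
      = (stack_step ^^ t) ((if b (map read_tape ts) then p else q) # k, ts)"
    by (simp only: funpow_Suc_right o_apply) (simp add: stack_step_def act_idle)
  then show ?case by (simp only: exec_Cond.IH)
next
  case (exec_While_True b ts p t1 ts1 t2 ts2)
  have "(stack_step ^^ Suc (t1 + t2)) (While b p # k, ts)
      = (stack_step ^^ (t2 + t1)) (p # While b p # k, ts)"
    using exec_While_True.hyps(1)
    by (simp only: funpow_Suc_right o_apply) (simp add: stack_step_def act_idle add.commute)
  then show ?case by (simp only: funpow_add o_apply exec_While_True.IH)
next
  case (exec_While_False b ts p)
  then show ?case by (simp add: stack_step_def act_idle)
qed

text \<open>The predicate \<open>acc\<close> reads the answer off the symbols under the heads at the
  end. The strict time bound leaves room for the extra step from the empty stack to the accepting or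
  rejecting state.\<close>

lemma prog_tm_simulates:
  fixes p :: "'a prog"
  assumes "1 \<le> K" "finite S" "insert Blank (range Input) \<subseteq> S" "wf_prog K S p"
  obtains M :: "'a tm" where "wf_tm M" "num_tapes M = K"
    "\<And>w t T ts. exec p (input_tape w # replicate (K - 1) (input_tape [])) t ts \<Longrightarrow> t < T \<Longrightarrow>
       state_after M w T = (if acc (map read_tape ts) then accept M else reject M)"
proof -
  let ?K = "insert [] (stacks p)"
  have "finite ?K" by (simp add: finite_stacks)
  then obtain f :: "'a prog list \<Rightarrow> nat" where f: "inj_on f ?K"
    using finite_imp_inj_to_nat_seg by metis
  \<comment> \<open>The shift by two keeps the states 0 and 1 free for acceptance and
    rejection.\<close>
  define code where "code k = Suc (Suc (f k))" for k
  have code: "inv_into ?K code (code k) = k" if "k \<in> ?K" for k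
    using f that by (intro inv_into_f_f) (auto simp: code_def inj_on_def)
  define \<delta> where "\<delta> q ss = (let k = inv_into ?K code q in
    (if k = [] then (if acc ss then 0 else 1) else code (next_stack k ss), stack_act k ss))" for q ss
  define M :: "'a tm" where "M = \<lparr>num_tapes = K, states = {0, 1} \<union> code ` ?K, symbols = S,
    start = code [p], accept = 0, reject = 1, delta = \<delta>\<rparr>"
  have M: "num_tapes M = K" "states M = {0, 1} \<union> code ` ?K" "symbols M = S"
    "start M = code [p]" "accept M = 0" "reject M = 1" "delta M = \<delta>"
    by (simp_all add: M_def)
  have wf: "wf_tm M"
  proof -
    have step: "case \<delta> q ss of (q', as) \<Rightarrow> q' \<in> {0, 1} \<union> code ` ?K \<and> length as = K \<and> fst ` set as \<subseteq> S"
      if q: "q \<in> code ` ?K" and ss: "ss \<in> lists S" "length ss = K" for q ss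
    proof -
      from q obtain k where k: "k \<in> ?K" "q = code k" by blast
      show ?thesis
      proof (cases "k = []")
        case True
        have "stack_act [] ss = idle ss" by simp
        then show ?thesis
          using ss code[OF k(1)] True k by (auto simp: \<delta>_def idle_def Let_def)
      next
        case False
        then have k': "k \<in> stacks p" using k by simp
        have "code (next_stack k ss) \<in> {0, 1} \<union> code ` ?K"
          using next_stack_closed[OF k'] by (intro UnI2 imageI)
        moreover have "\<delta> q ss = (code (next_stack k ss), stack_act k ss)"
          using code[OF k(1)] False k(2) by (simp add: \<delta>_def Let_def)
        ultimately show ?thesis
          using stack_act_wf[OF assms(4) k' ss] by (simp only: prod.case)
      qed
    qed
    show ?thesis
      unfolding wf_tm_def M
    proof (intro conjI ballI impI)
      fix q ss
      assume q: "q \<in> {0, 1} \<union> code ` ?K - {0, 1}" and ss: "ss \<in> lists S" "length ss = K"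
      from q have "q \<in> code ` ?K" by blast
      then show "case \<delta> q ss of (q', as) \<Rightarrow>
          q' \<in> {0, 1} \<union> code ` ?K \<and> length as = K \<and> fst ` set as \<subseteq> S"
        using ss by (rule step)
    next
      show "{code [p], 0, 1} \<subseteq> {0, 1} \<union> code ` ?K"
        using singleton_in_stacks by blast
    qed (use assms finite_imageI[OF finite_stacks] in simp_all)
  qed
  have step: "tm_step M (code k, ts) = (code k', ts')"
    if "k \<in> ?K" "k \<noteq> []" "stack_step (k, ts) = (k', ts')" for k k' ts ts'
    using that code[OF that(1)] by (auto simp: M stack_step_def \<delta>_def Let_def) (simp_all add: code_def)
  have run: "(tm_step M ^^ t) (code k, ts) = (code k', ts') \<and> k' \<in> ?K"
    if "k \<in> ?K" "(stack_step ^^ t) (k, ts) = (k', ts')" "\<forall>i<t. fst ((stack_step ^^ i) (k, ts)) \<noteq> []"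
    for k t k' ts ts'
    using that
  proof (induction t arbitrary: k' ts')
    case (Suc t)
    obtain k1 ts1 where 1: "(stack_step ^^ t) (k, ts) = (k1, ts1)" by fastforce
    have "k1 \<noteq> []" using Suc.prems(3)[rule_format, of t] 1 by simp
    moreover have IH: "(tm_step M ^^ t) (code k, ts) = (code k1, ts1) \<and> k1 \<in> ?K"
      using Suc.IH[OF Suc.prems(1) 1] Suc.prems(3) by auto
    moreover have "stack_step (k1, ts1) = (k', ts')" using Suc.prems(2) 1 by simp
    ultimately show ?case
      using step[of k1 ts1 k' ts'] next_stack_closed[of k1 p "map read_tape ts1"]
      by (auto simp: stack_step_def simp del: tm_step.simps)
  qed auto
  have halt: "(tm_step M ^^ i) (q, ts) = (q, ts)" if "q \<in> {0, 1}" for i q ts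
    using that by (induction i) (auto simp: M)
  have "state_after M w T = (if acc (map read_tape ts) then accept M else reject M)"
    if ex: "exec p (input_tape w # replicate (K - 1) (input_tape [])) t ts" and "t < T" for w t T ts
  proof -
    let ?ts0 = "input_tape w # replicate (K - 1) (input_tape [])"
    have fin: "(stack_step ^^ t) ([p], ?ts0) = ([], ts)" using stack_exec[OF ex] .
    \<comment> \<open>The machine mimics the stack only until it is empty for the first time, so the
      least such time \<open>m\<close> replaces \<open>t\<close>. From then on the stack idles,
      hence the tapes at both times agree.\<close>
    define P where "P i \<longleftrightarrow> fst ((stack_step ^^ i) ([p], ?ts0)) = []" for i
    define m where "m = (LEAST i. P i)"
    have "P t" using fin by (simp add: P_def)
    then have "P m" "m \<le> t"
      unfolding m_def by (rule LeastI, rule Least_le)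
    have least: "\<forall>i<m. \<not> P i"
      unfolding m_def using not_less_Least by blast
    obtain ts1 where m: "(stack_step ^^ m) ([p], ?ts0) = ([], ts1)"
      using \<open>P m\<close> unfolding P_def by (metis eq_fst_iff)
    have stay: "(stack_step ^^ i) ([], ts1) = ([], ts1)" for i
    proof (induction i)
      case (Suc i)
      then show ?case by (simp add: stack_step_def act_idle)
    qed simp
    have "(stack_step ^^ t) ([p], ?ts0) = ([], ts1)"
    proof -
      have "t = (t - m) + m" using \<open>m \<le> t\<close> by simp
      then have "(stack_step ^^ t) ([p], ?ts0) = (stack_step ^^ (t - m)) ((stack_step ^^ m) ([p], ?ts0))"
        by (metis comp_apply funpow_add)
      then show ?thesis by (simp only: m stay)
    qed
    then have "ts1 = ts" using fin by simp
    have init: "tm_init M w = (code [p], ?ts0)" by (simp add: tm_init_def M)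
    have "(tm_step M ^^ m) (code [p], ?ts0) = (code [], ts)"
      using run[of "[p]" m ?ts0 "[]" ts] m \<open>ts1 = ts\<close> least singleton_in_stacks
      by (auto simp: P_def)
    moreover obtain ts' where
      "tm_step M (code [], ts) = (if acc (map read_tape ts) then 0 else 1, ts')"
      using code[of "[]"] by (auto simp: M \<delta>_def Let_def code_def)
    ultimately have "(tm_step M ^^ Suc m) (code [p], ?ts0) = (if acc (map read_tape ts) then 0 else 1, ts')"
      by simp
    moreover have "T = (T - Suc m) + Suc m" using \<open>m \<le> t\<close> \<open>t < T\<close> by simp
    then have "(tm_step M ^^ T) (code [p], ?ts0)
        = (tm_step M ^^ (T - Suc m)) ((tm_step M ^^ Suc m) (code [p], ?ts0))"
      by (metis comp_apply funpow_add)
    ultimately have "(tm_step M ^^ T) (code [p], ?ts0) = (if acc (map read_tape ts) then 0 else 1, ts')"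
      using halt[of "if acc (map read_tape ts) then 0 else 1"] by (metis insertCI)
    then show ?thesis
      by (simp add: state_after_def init M)
  qed
  with wf M(1) show ?thesis by (intro that)
qed

section \<open>Execution within a time bound\<close>

definition runs :: "'a prog \<Rightarrow> 'a tape list \<Rightarrow> nat \<Rightarrow> 'a tape list \<Rightarrow> bool" where
  "runs p ts T ts' \<longleftrightarrow> (\<exists>t\<le>T. exec p ts t ts')"

lemma runs_mono: "runs p ts T ts' \<Longrightarrow> T \<le> T' \<Longrightarrow> runs p ts T' ts'"
  unfolding runs_def using order_trans by blast

lemma runs_Act: "ts' = map2 act_tape (g (map read_tape ts)) ts \<Longrightarrow> runs (Act g) ts 1 ts'"
  unfolding runs_def using exec_Act by blast

lemma runs_Seq:
  "runs p ts T1 ts1 \<Longrightarrow> runs q ts1 T2 ts2 \<Longrightarrow> runs (Seq p q) ts (Suc (T1 + T2)) ts2"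
proof -
  assume "runs p ts T1 ts1" "runs q ts1 T2 ts2"
  then obtain t1 t2 where "t1 \<le> T1" "exec p ts t1 ts1" "t2 \<le> T2" "exec q ts1 t2 ts2"
    unfolding runs_def by blast
  then show ?thesis
    unfolding runs_def by (intro exI[of _ "Suc (t1 + t2)"] conjI exec_Seq) simp_all
qed

lemma runs_Cond:
  "runs (if b (map read_tape ts) then p else q) ts T ts' \<Longrightarrow> runs (Cond b p q) ts (Suc T) ts'"
  unfolding runs_def using exec_Cond Suc_le_mono by blast

lemma runs_Cond_True:
  "b (map read_tape ts) \<Longrightarrow> runs p ts T ts' \<Longrightarrow> runs (Cond b p q) ts (Suc T) ts'"
  by (simp add: runs_Cond)

lemma runs_Cond_False:
  "\<not> b (map read_tape ts) \<Longrightarrow> runs q ts T ts' \<Longrightarrow> runs (Cond b p q) ts (Suc T) ts'"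
  by (simp add: runs_Cond)

text \<open>A loop is verified by naming its whole trace \<open>S\<close>: each of the
  \<open>m\<close> rounds costs one test and at most \<open>T\<close> steps, and the failing test
  costs one more step.\<close>

lemma runs_While:
  assumes "\<And>j. j < m \<Longrightarrow> b (map read_tape (S j)) \<and> runs p (S j) T (S (Suc j))"
    and "\<not> b (map read_tape (S m))"
  shows "runs (While b p) (S 0) (Suc (m * Suc T)) (S m)"
  using assms
proof (induction m arbitrary: S)
  case 0
  then show ?case
    unfolding runs_def using exec_While_False[of b "S 0" p] by auto
next
  case (Suc m)
  have "runs (While b p) (S (Suc 0)) (Suc (m * Suc T)) (S (Suc m))"
    using Suc.IH[of "\<lambda>j. S (Suc j)"] Suc.prems by simp
  then obtain t2 where t2: "t2 \<le> Suc (m * Suc T)" "exec (While b p) (S (Suc 0)) t2 (S (Suc m))"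
    unfolding runs_def by blast
  obtain t1 where t1: "t1 \<le> T" "exec p (S 0) t1 (S (Suc 0))" and b: "b (map read_tape (S 0))"
    using Suc.prems(1)[of 0] unfolding runs_def by auto
  have "exec (While b p) (S 0) (Suc (t1 + t2)) (S (Suc m))"
    using exec_While_True[of b, OF b t1(2) t2(2)] .
  moreover have "Suc (t1 + t2) \<le> Suc (Suc m * Suc T)" using t1(1) t2(1) by simp
  ultimately show ?case unfolding runs_def by blast
qed

section \<open>Registers\<close>

text \<open>Register \<open>i\<close> is the head of tape \<open>i\<close>; every tape carries a copy of the input, preceded by
  the marker \<open>Aux 0\<close> in cell \<open>-1\<close>, and value \<open>v\<close> is represented by head position \<open>v - 1\<close>.  So the
  value \<open>0\<close> is recognisable and the positive values up to the length of the input point to its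
  symbols.\<close>

definition cells :: "'a list \<Rightarrow> int \<Rightarrow> 'a tape_symbol" where
  "cells w i = (if i = -1 then Aux 0
    else if 0 \<le> i \<and> i < int (length w) then Input (w ! nat i) else Blank)"

definition heads :: "'a list \<Rightarrow> nat \<Rightarrow> (nat \<Rightarrow> nat) \<Rightarrow> 'a tape list" where
  "heads w K s = map (\<lambda>i. (int (s i) - 1, cells w)) [0..<K]"

text \<open>Symbols are written back as read, so the tapes never change and a configuration is
  determined by the register contents. A register in both sets is decremented.\<close>

definition mv :: "nat set \<Rightarrow> nat set \<Rightarrow> 'a prog" where
  "mv I J = Act (\<lambda>ss. map (\<lambda>i. (ss ! i,
     if i \<in> I then MoveLeft else if i \<in> J then MoveRight else Stay)) [0..<length ss])"

definition zero :: "nat \<Rightarrow> 'a tape_symbol list \<Rightarrow> bool" where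
  "zero i ss \<longleftrightarrow> ss ! i = Aux 0"

definition reads :: "nat \<Rightarrow> 'a set \<Rightarrow> 'a tape_symbol list \<Rightarrow> bool" where
  "reads i A ss \<longleftrightarrow> ss ! i \<in> Input ` A"

lemma wf_mv: "wf_prog K S (mv I J)"
proof -
  have "ss ! i \<in> S" if "\<forall>s\<in>set ss. s \<in> S" "i < length ss" for ss i
    using that nth_mem by blast
  then show ?thesis by (auto simp: mv_def)
qed

text \<open>Registers to be decremented must be positive: at 0 the subtraction of naturals would
  stay at 0 while the head leaves the marker to the left.\<close>

lemma runs_mv:
  assumes "\<And>i. i \<in> I \<Longrightarrow> 0 < s i"
    and "s' = (\<lambda>i. if i \<in> I then s i - 1 else if i \<in> J then Suc (s i) else s i)"
    and "1 \<le> T"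
  shows "runs (mv I J) (heads w K s) T (heads w K s')"
  unfolding mv_def
proof (rule runs_mono[OF runs_Act assms(3)], rule nth_equalityI)
  fix i assume "i < length (heads w K s')"
  then have "i < K" by (simp add: heads_def)
  then show "heads w K s' ! i = map2 act_tape
       (map (\<lambda>i. (map read_tape (heads w K s) ! i,
          if i \<in> I then MoveLeft else if i \<in> J then MoveRight else Stay))
        [0..<length (map read_tape (heads w K s))]) (heads w K s) ! i"
    using assms(1)[of i] by (auto simp: heads_def assms(2) of_nat_diff)
qed (simp add: heads_def)

lemma zero_heads: "i < K \<Longrightarrow> zero i (map read_tape (heads w K s)) \<longleftrightarrow> s i = 0"
  by (auto simp: zero_def heads_def cells_def)

lemma reads_heads:
  "i < K \<Longrightarrow> reads i A (map read_tape (heads w K s)) \<longleftrightarrow> s i \<in> {1..length w} \<and> w ! (s i - 1) \<in> A"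
  by (auto simp: reads_def heads_def cells_def nat_diff_distrib)

section \<open>First-order logic with the Haertig quantifier\<close>

text \<open>Variables are natural numbers and range over the positions \<open>1, 2, \<dots>\<close> of the input word.\<close>

datatype 'a fm =
  Sym nat "'a set"
| Less nat nat
| Neg "'a fm"
| Conj "'a fm" "'a fm"
| Hart nat "'a fm list" "'a fm list"

text \<open>\<open>Hart\<close> compares sums of several cardinalities because a letter count over a
  substituted word splits into one count of positions per letter of the substitution.
  \<open>Sym\<close> is false at values outside the word, so an assignment may hold such
  values.\<close>

fun sem :: "'a list \<Rightarrow> (nat \<Rightarrow> nat) \<Rightarrow> 'a fm \<Rightarrow> bool" where
  "sem w e (Sym x A) \<longleftrightarrow> e x \<in> {1..length w} \<and> w ! (e x - 1) \<in> A"
| "sem w e (Less x y) \<longleftrightarrow> e x < e y"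
| "sem w e (Neg f) \<longleftrightarrow> \<not> sem w e f"
| "sem w e (Conj f g) \<longleftrightarrow> sem w e f \<and> sem w e g"
| "sem w e (Hart x fs gs) \<longleftrightarrow>
    (\<Sum>f\<leftarrow>fs. card {v \<in> {1..length w}. sem w (e(x := v)) f}) =
    (\<Sum>f\<leftarrow>gs. card {v \<in> {1..length w}. sem w (e(x := v)) f})"

text \<open>A calling convention: formula variables live in the registers given by
  \<open>\<rho>\<close>. Registers from \<open>k\<close> on are scratch; they are 0 at entry and
  again at exit, except for the truth value in register \<open>k\<close>. Any number of tapes from
  \<open>K0\<close> on is allowed, so that programs with different demands can be combined.\<close>

definition computes :: "(nat \<Rightarrow> nat) \<Rightarrow> nat \<Rightarrow> 'a fm \<Rightarrow> 'a prog \<Rightarrow> nat poly \<Rightarrow> nat \<Rightarrow> bool" where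
  "computes \<rho> k f p T K0 \<longleftrightarrow> (\<forall>K\<ge>K0. \<forall>S. wf_prog K S p) \<and>
    (\<forall>K\<ge>K0. \<forall>w s. (\<forall>i\<ge>k. s i = 0) \<longrightarrow> (\<forall>x. s (\<rho> x) \<le> Suc (length w)) \<longrightarrow>
      runs p (heads w K s) (poly T (length w))
        (heads w K (s(k := of_bool (sem w (s \<circ> \<rho>) f)))))"

lemma computesD:
  assumes "computes \<rho> k f p T K0" "K \<ge> K0" "\<And>i. i \<ge> k \<Longrightarrow> s i = 0"
    "\<And>x. s (\<rho> x) \<le> Suc (length w)"
  shows "runs p (heads w K s) (poly T (length w))
        (heads w K (s(k := of_bool (sem w (s \<circ> \<rho>) f))))"
  using assms unfolding computes_def by blast

lemma computes_Sym:
  fixes A :: "'a set" and \<rho> :: "nat \<Rightarrow> nat"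
  assumes "\<And>x. \<rho> x < k"
  shows "\<exists>(p :: 'a prog) T K0. computes \<rho> k (Sym x A) p T K0"
proof -
  have "computes \<rho> k (Sym x A) (Cond (reads (\<rho> x) A) (mv {} {k}) (mv {} {})) [:2:] (Suc k)"
    unfolding computes_def
  proof (intro conjI allI impI)
    fix K and w :: "'a list" and s :: "nat \<Rightarrow> nat"
    assume K: "Suc k \<le> K" and s: "\<forall>i\<ge>k. s i = 0"
    have "runs (Cond (reads (\<rho> x) A) (mv {} {k}) (mv {} {})) (heads w K s) (Suc 1)
       (heads w K (s(k := of_bool (sem w (s \<circ> \<rho>) (Sym x A)))))"
    proof (rule runs_Cond)
      have "\<rho> x < K" using assms[of x] K by linarith
      then show "runs (if reads (\<rho> x) A (map read_tape (heads w K s)) then mv {} {k} else mv {} {})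
          (heads w K s) 1 (heads w K (s(k := of_bool (sem w (s \<circ> \<rho>) (Sym x A)))))"
        using s by (auto simp: reads_heads intro!: runs_mv)
    qed
    then show "runs (Cond (reads (\<rho> x) A) (mv {} {k}) (mv {} {})) (heads w K s)
        (poly [:2:] (length w)) (heads w K (s(k := of_bool (sem w (s \<circ> \<rho>) (Sym x A)))))"
      by (simp add: numeral_2_eq_2)
  qed (simp add: wf_mv)
  then show ?thesis by blast
qed

text \<open>Both registers are decreased, with a third one counting, until one of them is zero.\<close>

lemma computes_Less:
  fixes \<rho> :: "nat \<Rightarrow> nat"
  assumes "\<And>x. \<rho> x < k"
  shows "\<exists>(p :: 'a prog) T K0. computes \<rho> k (Less x y) p T K0"
proof -
  define a b where "a = \<rho> x" and "b = \<rho> y"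
  have ab: "a < k" "b < k" unfolding a_def b_def using assms by auto
  define down :: "'a prog" where "down = While (\<lambda>ss. \<not> zero a ss \<and> \<not> zero b ss) (mv {a, b} {Suc k})"
  \<comment> \<open>Register \<open>b\<close> is tested first: if both registers have reached 0, the
    values were equal.\<close>
  define test :: "'a prog" where "test = Cond (zero b) (mv {} {}) (Cond (zero a) (mv {} {k}) (mv {} {}))"
  define up :: "'a prog" where "up = While (\<lambda>ss. \<not> zero (Suc k) ss) (mv {Suc k} {a, b})"
  \<comment> \<open>Each loop takes \<open>2 * m + 1\<close> steps, which with the test and the
    sequencing makes \<open>4 * m + 7\<close>, and \<open>m\<close> is at most the length plus
    one.\<close>
  have "computes \<rho> k (Less x y) (Seq down (Seq test up)) [:11, 4:] (Suc (Suc k))"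
    unfolding computes_def
  proof (intro conjI allI impI)
    fix K and w :: "'a list" and s :: "nat \<Rightarrow> nat"
    assume K: "Suc (Suc k) \<le> K" and s: "\<forall>i\<ge>k. s i = 0" and le: "\<forall>x. s (\<rho> x) \<le> Suc (length w)"
    define m where "m = min (s a) (s b)"
    define v :: nat where "v = of_bool (s a < s b)"
    define D where "D j = s(a := s a - j, b := s b - j, Suc k := j)" for j
    define U where "U j = s(k := v, a := s a - (m - j), b := s b - (m - j), Suc k := m - j)" for j
    have m: "m \<le> Suc (length w)" using le unfolding m_def a_def by (meson min.coboundedI1)
    have "runs down (heads w K (D 0)) (Suc (m * Suc 1)) (heads w K (D m))"
      unfolding down_def
    proof (rule runs_While)
      fix j assume j: "j < m"
      have "D j a > 0" "D j b > 0" using j ab by (auto simp: D_def m_def)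
      moreover have "runs (mv {a, b} {Suc k}) (heads w K (D j)) 1 (heads w K (D (Suc j)))"
        by (rule runs_mv) (use j ab in \<open>auto simp: D_def m_def fun_eq_iff\<close>)
      ultimately show "(\<not> zero a (map read_tape (heads w K (D j)))
          \<and> \<not> zero b (map read_tape (heads w K (D j)))) \<and>
        runs (mv {a, b} {Suc k}) (heads w K (D j)) 1 (heads w K (D (Suc j)))"
        using ab K by (simp add: zero_heads)
    next
      have "D m a = 0 \<or> D m b = 0" using ab by (auto simp: D_def m_def)
      then show "\<not> (\<not> zero a (map read_tape (heads w K (D m)))
          \<and> \<not> zero b (map read_tape (heads w K (D m))))"
        using ab K by (simp add: zero_heads)
    qed
    moreover have "D 0 = s" using s by (auto simp: D_def)
    moreover have "runs test (heads w K (D m)) 3 (heads w K (U 0))"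
    proof -
      have D: "D m b = 0 \<longleftrightarrow> \<not> s a < s b" "s a < s b \<Longrightarrow> D m a = 0"
        using ab by (auto simp: D_def m_def)
      show ?thesis
      proof (cases "s a < s b")
        case True
        have "runs (mv {} {k}) (heads w K (D m)) 1 (heads w K (U 0))"
          by (rule runs_mv) (use True ab s in \<open>auto simp: U_def D_def v_def fun_eq_iff\<close>)
        moreover have "\<not> zero b (map read_tape (heads w K (D m)))" "zero a (map read_tape (heads w K (D m)))"
          using True D ab K by (simp_all add: zero_heads)
        ultimately have "runs test (heads w K (D m)) (Suc (Suc 1)) (heads w K (U 0))"
          unfolding test_def by (intro runs_Cond) (simp, intro runs_Cond, simp)
        then show ?thesis by (simp add: numeral_3_eq_3)
      next
        case False
        have "runs (mv {} {}) (heads w K (D m)) 2 (heads w K (U 0))"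
          by (rule runs_mv) (use False ab s in \<open>auto simp: U_def D_def v_def fun_eq_iff\<close>)
        moreover have "zero b (map read_tape (heads w K (D m)))"
          using False D ab K by (simp_all add: zero_heads)
        ultimately have "runs test (heads w K (D m)) (Suc 2) (heads w K (U 0))"
          unfolding test_def by (intro runs_Cond) simp
        then show ?thesis by (simp add: numeral_3_eq_3 numeral_2_eq_2)
      qed
    qed
    moreover have "runs up (heads w K (U 0)) (Suc (m * Suc 1)) (heads w K (U m))"
      unfolding up_def
    proof (rule runs_While)
      fix j assume j: "j < m"
      have "runs (mv {Suc k} {a, b}) (heads w K (U j)) 1 (heads w K (U (Suc j)))"
        by (rule runs_mv) (use j ab in \<open>auto simp: U_def m_def fun_eq_iff\<close>)
      then show "\<not> zero (Suc k) (map read_tape (heads w K (U j))) \<and>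
          runs (mv {Suc k} {a, b}) (heads w K (U j)) 1 (heads w K (U (Suc j)))"
        using j ab K by (simp add: zero_heads U_def)
    qed (use ab K in \<open>simp add: zero_heads U_def\<close>)
    moreover have "U m = s(k := of_bool (sem w (s \<circ> \<rho>) (Less x y)))"
      using s ab by (auto simp: U_def v_def a_def b_def fun_eq_iff)
    ultimately have "runs (Seq down (Seq test up)) (heads w K s)
        (Suc (Suc (m * Suc 1) + Suc (3 + Suc (m * Suc 1))))
        (heads w K (s(k := of_bool (sem w (s \<circ> \<rho>) (Less x y)))))"
      by (metis runs_Seq)
    then show "runs (Seq down (Seq test up)) (heads w K s) (poly [:11, 4:] (length w))
        (heads w K (s(k := of_bool (sem w (s \<circ> \<rho>) (Less x y)))))"
      by (rule runs_mono) (use m in simp)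
  qed (simp add: down_def test_def up_def wf_mv)
  then show ?thesis by blast
qed

lemma computes_Neg:
  fixes f :: "'a fm"
  assumes "computes \<rho> k f p T K0"
  shows "\<exists>(p :: 'a prog) T K0. computes \<rho> k (Neg f) p T K0"
proof -
  define q :: "'a prog" where "q = Cond (zero k) (mv {} {k}) (mv {k} {})"
  have "computes \<rho> k (Neg f) (Seq p q) (T + [:3:]) (max K0 (Suc k))"
    unfolding computes_def
  proof (intro conjI allI impI)
    fix K and w :: "'a list" and s :: "nat \<Rightarrow> nat"
    assume K: "max K0 (Suc k) \<le> K" and s: "\<forall>i\<ge>k. s i = 0" and le: "\<forall>x. s (\<rho> x) \<le> Suc (length w)"
    let ?b = "sem w (s \<circ> \<rho>) f"
    have "runs p (heads w K s) (poly T (length w)) (heads w K (s(k := of_bool ?b)))"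
      by (rule computesD[OF assms]) (use K s le in auto)
    moreover have "runs q (heads w K (s(k := of_bool ?b))) (Suc 1) (heads w K (s(k := of_bool (\<not> ?b))))"
      unfolding q_def
      by (rule runs_Cond) (use K in \<open>auto simp: zero_heads intro!: runs_mv\<close>)
    ultimately have "runs (Seq p q) (heads w K s) (Suc (poly T (length w) + Suc 1))
        (heads w K (s(k := of_bool (\<not> ?b))))"
      by (rule runs_Seq)
    then show "runs (Seq p q) (heads w K s) (poly (T + [:3:]) (length w))
        (heads w K (s(k := of_bool (sem w (s \<circ> \<rho>) (Neg f)))))"
      by (simp add: numeral_3_eq_3)
  qed (use assms in \<open>simp_all add: q_def wf_mv computes_def\<close>)
  then show ?thesis by blast
qed

lemma computes_Conj:
  fixes f g :: "'a fm"
  assumes f: "computes \<rho> k f p T K0" and g: "computes \<rho> k g q T' K0'"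
  shows "\<exists>(p :: 'a prog) T K0. computes \<rho> k (Conj f g) p T K0"
proof -
  \<comment> \<open>After a true first conjunct register \<open>k\<close> is cleared, because
    \<open>q\<close> expects its scratch registers to be 0 and puts its own truth value
    there.\<close>
  define r :: "'a prog" where "r = Cond (zero k) (mv {} {}) (Seq (mv {k} {}) q)"
  have "computes \<rho> k (Conj f g) (Seq p r) (T + T' + [:4:]) (max (max K0 K0') (Suc k))"
    unfolding computes_def
  proof (intro conjI allI impI)
    fix K and w :: "'a list" and s :: "nat \<Rightarrow> nat"
    assume K: "max (max K0 K0') (Suc k) \<le> K" and s: "\<forall>i\<ge>k. s i = 0"
      and le: "\<forall>x. s (\<rho> x) \<le> Suc (length w)"
    let ?b = "sem w (s \<circ> \<rho>) f" and ?c = "sem w (s \<circ> \<rho>) g"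
    let ?s = "s(k := of_bool ?b)" and ?s' = "s(k := of_bool (?b \<and> ?c))"
    have "runs p (heads w K s) (poly T (length w)) (heads w K ?s)"
      by (rule computesD[OF f]) (use K s le in auto)
    moreover have "runs r (heads w K ?s) (Suc (poly T' (length w) + 2)) (heads w K ?s')"
      unfolding r_def
    proof (rule runs_Cond, cases ?b)
      case True
      have "runs (mv {k} {}) (heads w K ?s) 1 (heads w K s)"
        by (rule runs_mv) (use True s in auto)
      moreover have "runs q (heads w K s) (poly T' (length w)) (heads w K (s(k := of_bool ?c)))"
        by (rule computesD[OF g]) (use K s le in auto)
      ultimately have "runs (Seq (mv {k} {}) q) (heads w K ?s) (Suc (1 + poly T' (length w)))
          (heads w K (s(k := of_bool ?c)))"
        by (rule runs_Seq)
      then show "runs (if zero k (map read_tape (heads w K ?s)) then mv {} {} else Seq (mv {k} {}) q)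
          (heads w K ?s) (poly T' (length w) + 2) (heads w K ?s')"
        using True K by (simp add: zero_heads)
    next
      case False
      have "runs (mv {} {}) (heads w K ?s) 1 (heads w K ?s')"
        by (rule runs_mv) (use False in auto)
      then show "runs (if zero k (map read_tape (heads w K ?s)) then mv {} {} else Seq (mv {k} {}) q)
          (heads w K ?s) (poly T' (length w) + 2) (heads w K ?s')"
        using False K by (auto simp: zero_heads elim: runs_mono)
    qed
    ultimately have "runs (Seq p r) (heads w K s)
        (Suc (poly T (length w) + Suc (poly T' (length w) + 2))) (heads w K ?s')"
      by (rule runs_Seq)
    then show "runs (Seq p r) (heads w K s) (poly (T + T' + [:4:]) (length w))
        (heads w K (s(k := of_bool (sem w (s \<circ> \<rho>) (Conj f g)))))"
      using runs_mono by (simp add: numeral_eq_Suc)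
  qed (use assms in \<open>simp_all add: r_def wf_mv computes_def\<close>)
  then show ?thesis by blast
qed

text \<open>One round of a counting loop: the accumulator \<open>c\<close> grows by the number of
  formulas that are true under the current assignment. It is later chosen below \<open>k\<close> and
  outside the range of \<open>\<rho>\<close>, so that the evaluation of a formula neither overwrites
  nor sees it.\<close>

definition counts ::
    "(nat \<Rightarrow> nat) \<Rightarrow> nat \<Rightarrow> nat \<Rightarrow> 'a fm list \<Rightarrow> 'a prog \<Rightarrow> nat poly \<Rightarrow> nat \<Rightarrow> bool" where
  "counts \<rho> k c fs p T K0 \<longleftrightarrow> (\<forall>K\<ge>K0. \<forall>S. wf_prog K S p) \<and>
    (\<forall>K\<ge>K0. \<forall>w s. (\<forall>i\<ge>k. s i = 0) \<longrightarrow> (\<forall>x. s (\<rho> x) \<le> Suc (length w)) \<longrightarrow>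
      runs p (heads w K s) (poly T (length w))
        (heads w K (s(c := s c + (\<Sum>f\<leftarrow>fs. of_bool (sem w (s \<circ> \<rho>) f))))))"

lemma countsD:
  assumes "counts \<rho> k c fs p T K0" "K \<ge> K0" "\<forall>i\<ge>k. s i = 0" "\<forall>x. s (\<rho> x) \<le> Suc (length w)"
  shows "runs p (heads w K s) (poly T (length w))
        (heads w K (s(c := s c + (\<Sum>f\<leftarrow>fs. of_bool (sem w (s \<circ> \<rho>) f)))))"
  using assms unfolding counts_def by blast

lemma count_formulas:
  fixes fs :: "'a fm list"
  assumes "\<And>f. f \<in> set fs \<Longrightarrow> \<exists>p T K0. computes \<rho> k f p T K0"
    and "c < k" "c \<notin> range \<rho>"
  shows "\<exists>(p :: 'a prog) T K0. counts \<rho> k c fs p T K0"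
  using assms(1)
proof (induction fs)
  case Nil
  have "runs (mv {} {}) (heads w K s) (poly [:1:] (length w))
      (heads w K (s(c := s c + (\<Sum>f\<leftarrow>[]. of_bool (sem w (s \<circ> \<rho>) f)))))" for w :: "'a list" and K s
    using runs_mv[of "{}" s s "{}" 1 w K] by simp
  then have "counts \<rho> k c ([] :: 'a fm list) (mv {} {}) [:1:] 0"
    unfolding counts_def using wf_mv by blast
  then show ?case by blast
next
  case (Cons f fs)
  obtain p T K0 where p: "computes \<rho> k f p T K0" using Cons.prems by force
  obtain q T' K0' where q: "counts \<rho> k c fs q T' K0'" using Cons by force
  define r :: "'a prog" where "r = Seq p (Seq (Cond (zero k) (mv {} {}) (mv {k} {c})) q)"
  have "runs r (heads w K s) (poly (T + T' + [:4:]) (length w))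
        (heads w K (s(c := s c + (\<Sum>f\<leftarrow>f # fs. of_bool (sem w (s \<circ> \<rho>) f)))))"
    if K: "max (max K0 K0') (Suc k) \<le> K" and s: "\<forall>i\<ge>k. s i = 0"
      and le: "\<forall>x. s (\<rho> x) \<le> Suc (length w)" for K w and s :: "nat \<Rightarrow> nat"
  proof -
    let ?b = "sem w (s \<circ> \<rho>) f"
    define s' where "s' = s(c := s c + of_bool ?b)"
    have eq: "s' \<circ> \<rho> = s \<circ> \<rho>" using assms(3) by (fastforce simp: s'_def fun_eq_iff)
    then have le': "s' (\<rho> x) = s (\<rho> x)" for x by (metis comp_apply)
    have s'0: "\<forall>i\<ge>k. s' i = 0" using s assms(2) by (auto simp: s'_def)
    have "runs p (heads w K s) (poly T (length w)) (heads w K (s(k := of_bool ?b)))"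
      by (rule computesD[OF p]) (use K s le in auto)
    moreover have "runs (Cond (zero k) (mv {} {}) (mv {k} {c})) (heads w K (s(k := of_bool ?b)))
        (Suc 1) (heads w K s')"
      by (rule runs_Cond)
        (use K s assms(2) in \<open>auto simp: zero_heads s'_def fun_eq_iff intro!: runs_mv\<close>)
    moreover have "runs q (heads w K s') (poly T' (length w))
        (heads w K (s'(c := s' c + (\<Sum>f\<leftarrow>fs. of_bool (sem w (s' \<circ> \<rho>) f)))))"
      by (rule countsD[OF q]) (use K s'0 le' le in auto)
    ultimately have "runs r (heads w K s) (Suc (poly T (length w) + Suc (Suc 1 + poly T' (length w))))
        (heads w K (s'(c := s' c + (\<Sum>f\<leftarrow>fs. of_bool (sem w (s' \<circ> \<rho>) f)))))"
      unfolding r_def by (blast intro: runs_Seq)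
    moreover have "s'(c := s' c + (\<Sum>f\<leftarrow>fs. of_bool (sem w (s' \<circ> \<rho>) f)))
        = s(c := s c + (\<Sum>f\<leftarrow>f # fs. of_bool (sem w (s \<circ> \<rho>) f)))"
      unfolding eq by (simp add: s'_def)
    ultimately show ?thesis by (simp add: numeral_eq_Suc)
  qed
  moreover have "\<forall>K\<ge>max (max K0 K0') (Suc k). \<forall>S. wf_prog K S r"
    using p q by (simp add: r_def wf_mv computes_def counts_def)
  ultimately have "counts \<rho> k c (f # fs) r (T + T' + [:4:]) (max (max K0 K0') (Suc k))"
    unfolding counts_def by blast
  then show ?case by blast
qed

lemma card_interval_Suc: "card {v \<in> {1..Suc j}. P v} = card {v \<in> {1..j}. P v} + of_bool (P (Suc j))"
proof -
  have "{v \<in> {1..Suc j}. P v} = {v \<in> {1..j}. P v} \<union> (if P (Suc j) then {Suc j} else {})"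
    by (auto simp: le_Suc_eq)
  then show ?thesis by simp
qed

text \<open>Registers \<open>k\<close> and \<open>k + 1\<close> accumulate the two sums,
  \<open>k + 2\<close> is the bound variable, and subformulas work from \<open>k + 3\<close> on. The
  sums are compared by decrementing both until one of them is 0.\<close>

lemma computes_Hart:
  fixes fs gs :: "'a fm list"
  assumes \<rho>: "\<And>x. \<rho> x < k"
    and IH: "\<And>f. f \<in> set (fs @ gs) \<Longrightarrow> \<exists>p T K0. computes (\<rho>(x := k + 2)) (k + 3) f p T K0"
  shows "\<exists>(p :: 'a prog) T K0. computes \<rho> k (Hart x fs gs) p T K0"
proof -
  let ?\<rho> = "\<rho>(x := k + 2)"
  have nr: "k \<notin> range ?\<rho>" "k + 1 \<notin> range ?\<rho>"
  proof -
    have "?\<rho> y \<noteq> k \<and> ?\<rho> y \<noteq> k + 1" for y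
      using \<rho>[of y] by simp
    then show "k \<notin> range ?\<rho>" "k + 1 \<notin> range ?\<rho>" by (metis rangeE)+
  qed
  obtain p T1 K1 where p: "counts ?\<rho> (k + 3) k fs p T1 K1"
    using count_formulas[of fs ?\<rho> "k + 3" k, OF IH _ nr(1)] by auto
  obtain q T2 K2 where q: "counts ?\<rho> (k + 3) (k + 1) gs q T2 K2"
    using count_formulas[of gs ?\<rho> "k + 3" "k + 1", OF IH _ nr(2)] by auto
  define body where "body = Seq p (Seq q (mv {} {k + 2}))"
  define count :: "'a prog" where "count = While (reads (k + 2) UNIV) body"
  define rewind :: "'a prog" where "rewind = While (\<lambda>ss. \<not> zero (k + 2) ss) (mv {k + 2} {})"
  define cancel :: "'a prog"
    where "cancel = While (\<lambda>ss. \<not> zero k ss \<and> \<not> zero (k + 1) ss) (mv {k, k + 1} {})"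
  define clear :: "nat \<Rightarrow> 'a prog" where "clear i = While (\<lambda>ss. \<not> zero i ss) (mv {i} {})" for i
  define test :: "'a prog" where
    "test = Cond (zero k) (Cond (zero (k + 1)) (mv {} {k}) (clear (k + 1))) (clear k)"
  define prog where
    "prog = Seq (mv {} {k + 2}) (Seq count (Seq rewind (Seq cancel test)))"
  define m n where "m = length fs" and "n = length gs"
  let ?X = "[:0, 1:] :: nat poly"
  define T where "T = ?X * (T1 + T2 + [:4:]) + [:2:] * ?X + [:m:] * ?X * [:4:] + [:n:] * ?X * [:2:] + [:20:]"
  have "computes \<rho> k (Hart x fs gs) prog T (max (max K1 K2) (k + 3))"
    unfolding computes_def
  proof (intro conjI allI impI)
    fix K and w :: "'a list" and s :: "nat \<Rightarrow> nat"
    assume K: "max (max K1 K2) (k + 3) \<le> K" and s: "\<forall>i\<ge>k. s i = 0"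
      and le: "\<forall>x. s (\<rho> x) \<le> Suc (length w)"
    define N where "N = length w"
    define F G where
      "F j = (\<Sum>f\<leftarrow>fs. card {v \<in> {1..j}. sem w ((s \<circ> \<rho>)(x := v)) f})" and
      "G j = (\<Sum>f\<leftarrow>gs. card {v \<in> {1..j}. sem w ((s \<circ> \<rho>)(x := v)) f})" for j
    \<comment> \<open>A sum never exceeds the number of formulas times the length, so counting it
      down again takes polynomial time.\<close>
    have F_le: "F j \<le> m * j" and G_le: "G j \<le> n * j" for j
    proof -
      have *: "card {v \<in> {1..j}. P v} \<le> j" for P
      proof -
        have "card {v \<in> {1..j}. P v} \<le> card {1..j}" by (rule card_mono) auto
        then show ?thesis by simp
      qed
      have "(\<Sum>f\<leftarrow>hs. card {v \<in> {1..j}. Q v f}) \<le> length hs * j" for hs :: "'a fm list" and Q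
      proof (induction hs)
        case (Cons f hs)
        then show ?case using *[of "\<lambda>v. Q v f"] by simp
      qed simp
      then show "F j \<le> m * j" "G j \<le> n * j" by (auto simp: F_def G_def m_def n_def)
    qed
    \<comment> \<open>\<open>C j\<close> is the state after \<open>j\<close> positions, with the
      variable already on position \<open>j + 1\<close>; so \<open>C N\<close> has it just behind
      the input. \<open>B\<close> rewinds the variable and \<open>D\<close> cancels the sums against
      each other.\<close>
    define C where "C j = s(k := F j, k + 1 := G j, k + 2 := Suc j)" for j
    define B where "B j = s(k := F N, k + 1 := G N, k + 2 := Suc N - j)" for j
    define D where "D j = s(k := F N - j, k + 1 := G N - j)" for j
    let ?d = "min (F N) (G N)"
    have C\<rho>: "C j \<circ> ?\<rho> = (s \<circ> \<rho>)(x := Suc j)" for j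
    proof
      fix y
      show "(C j \<circ> ?\<rho>) y = ((s \<circ> \<rho>)(x := Suc j)) y"
        using \<rho>[of y] by (simp add: C_def)
    qed
    have C0: "C 0 = s(k + 2 := 1)" using s by (auto simp: C_def F_def G_def)
    have r1: "runs (mv {} {k + 2}) (heads w K s) 1 (heads w K (C 0))"
      by (rule runs_mv) (use s in \<open>auto simp: C0\<close>)
    have r2: "runs count (heads w K (C 0)) (Suc (N * Suc (poly T1 N + poly T2 N + 3)))
        (heads w K (C N))"
      unfolding count_def
    proof (rule runs_While)
      fix j assume j: "j < N"
      define s1 where "s1 = (C j)(k := F (Suc j))"
      define s2 where "s2 = s1(k + 1 := G (Suc j))"
      have leC: "\<forall>y. C j (?\<rho> y) \<le> Suc (length w)"
      proof
        fix y
        have "C j (?\<rho> y) = ((s \<circ> \<rho>)(x := Suc j)) y" using fun_cong[OF C\<rho>[of j], of y] by simp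
        then show "C j (?\<rho> y) \<le> Suc (length w)" using le j by (simp add: N_def)
      qed
      have s1\<rho>: "s1 \<circ> ?\<rho> = C j \<circ> ?\<rho>" using nr(1) by (auto simp: s1_def fun_eq_iff)
      have FS: "F (Suc j) = F j + (\<Sum>f\<leftarrow>fs. of_bool (sem w (C j \<circ> ?\<rho>) f))"
        unfolding F_def C\<rho> by (simp only: card_interval_Suc sum_list_addf)
      have GS: "G (Suc j) = G j + (\<Sum>f\<leftarrow>gs. of_bool (sem w (C j \<circ> ?\<rho>) f))"
        unfolding G_def C\<rho> by (simp only: card_interval_Suc sum_list_addf)
      have "runs p (heads w K (C j)) (poly T1 (length w))
        (heads w K ((C j)(k := C j k + (\<Sum>f\<leftarrow>fs. of_bool (sem w (C j \<circ> ?\<rho>) f)))))"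
        by (rule countsD[OF p]) (use K s leC in \<open>auto simp: C_def\<close>)
      then have 1: "runs p (heads w K (C j)) (poly T1 N) (heads w K s1)"
        by (simp add: s1_def FS N_def C_def)
      have "runs q (heads w K s1) (poly T2 (length w))
        (heads w K (s1(k + 1 := s1 (k + 1) + (\<Sum>f\<leftarrow>gs. of_bool (sem w (s1 \<circ> ?\<rho>) f)))))"
        by (rule countsD[OF q]) (use K s leC s1\<rho> in \<open>auto simp: s1_def C_def fun_eq_iff\<close>)
      then have 2: "runs q (heads w K s1) (poly T2 N) (heads w K s2)"
        unfolding s1\<rho> by (simp add: s2_def GS N_def) (simp add: s1_def C_def)
      have 3: "runs (mv {} {k + 2}) (heads w K s2) 1 (heads w K (C (Suc j)))"
        by (rule runs_mv) (auto simp: s2_def s1_def C_def fun_eq_iff)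
      have "runs body (heads w K (C j)) (Suc (poly T1 N + Suc (poly T2 N + 1))) (heads w K (C (Suc j)))"
        unfolding body_def by (intro runs_Seq[OF 1] runs_Seq[OF 2] 3)
      then have "runs body (heads w K (C j)) (poly T1 N + poly T2 N + 3) (heads w K (C (Suc j)))"
        by (simp add: numeral_3_eq_3)
      then show "reads (k + 2) UNIV (map read_tape (heads w K (C j))) \<and>
          runs body (heads w K (C j)) (poly T1 N + poly T2 N + 3) (heads w K (C (Suc j)))"
        using K j by (simp add: reads_heads C_def N_def)
    qed (use K in \<open>simp add: reads_heads C_def N_def\<close>)
    have CB: "C N = B 0" by (simp add: C_def B_def)
    have r3: "runs rewind (heads w K (B 0)) (Suc (Suc N * Suc 1)) (heads w K (B (Suc N)))"
      unfolding rewind_def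
    proof (rule runs_While)
      fix j assume j: "j < Suc N"
      have "runs (mv {k + 2} {}) (heads w K (B j)) 1 (heads w K (B (Suc j)))"
        by (rule runs_mv) (use j in \<open>auto simp: B_def\<close>)
      then show "\<not> zero (k + 2) (map read_tape (heads w K (B j))) \<and>
          runs (mv {k + 2} {}) (heads w K (B j)) 1 (heads w K (B (Suc j)))"
        using K j by (simp add: zero_heads B_def)
    qed (use K in \<open>simp add: zero_heads B_def\<close>)
    have BD: "B (Suc N) = D 0" using s by (auto simp: B_def D_def fun_eq_iff)
    have r4: "runs cancel (heads w K (D 0)) (Suc (?d * Suc 1)) (heads w K (D ?d))"
      unfolding cancel_def
    proof (rule runs_While)
      fix j assume j: "j < ?d"
      have "runs (mv {k, k + 1} {}) (heads w K (D j)) 1 (heads w K (D (Suc j)))"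
        by (rule runs_mv) (use j in \<open>auto simp: D_def\<close>)
      then show "(\<not> zero k (map read_tape (heads w K (D j))) \<and>
            \<not> zero (k + 1) (map read_tape (heads w K (D j)))) \<and>
          runs (mv {k, k + 1} {}) (heads w K (D j)) 1 (heads w K (D (Suc j)))"
        using K j by (simp add: zero_heads D_def)
    qed (use K in \<open>auto simp: zero_heads D_def\<close>)
    have r5: "runs test (heads w K (D ?d)) (Suc (Suc (Suc ((F N + G N) * Suc 1))))
        (heads w K (s(k := of_bool (F N = G N))))"
    proof -
      have clear: "runs (clear i) (heads w K s1) (Suc (s1 i * Suc 1)) (heads w K (s1(i := 0)))"
        if "i < K" for i s1
      proof -
        define E where "E j = s1(i := s1 i - j)" for j
        have "runs (clear i) (heads w K (E 0)) (Suc (s1 i * Suc 1)) (heads w K (E (s1 i)))"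
          unfolding clear_def
        proof (rule runs_While)
          fix j assume j: "j < s1 i"
          have "runs (mv {i} {}) (heads w K (E j)) 1 (heads w K (E (Suc j)))"
            by (rule runs_mv) (use j in \<open>auto simp: E_def\<close>)
          then show "\<not> zero i (map read_tape (heads w K (E j))) \<and>
              runs (mv {i} {}) (heads w K (E j)) 1 (heads w K (E (Suc j)))"
            using that j by (simp add: zero_heads E_def)
        qed (use that in \<open>simp add: zero_heads E_def\<close>)
        then show ?thesis by (simp add: E_def)
      qed
      let ?t = "heads w K (s(k := of_bool (F N = G N)))"
      \<comment> \<open>At \<open>D ?d\<close> at least one sum has been reduced to 0, and both have
        exactly if they were equal. A remainder has to be cleared to restore the scratch
        registers.\<close>
      consider "F N = G N" | "F N < G N" | "G N < F N" by linarith
      then show ?thesis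
      proof cases
        case 1
        have "runs (mv {} {k}) (heads w K (D ?d)) (Suc ((F N + G N) * Suc 1)) ?t"
          by (rule runs_mv) (use 1 s in \<open>auto simp: D_def\<close>)
        moreover have "zero k (map read_tape (heads w K (D ?d)))" "zero (k + 1) (map read_tape (heads w K (D ?d)))"
          using 1 K by (simp_all add: zero_heads D_def)
        ultimately show ?thesis
          unfolding test_def by (intro runs_Cond_True)
      next
        case 2
        have "runs (clear (k + 1)) (heads w K (D ?d)) (Suc ((F N + G N) * Suc 1))
            (heads w K ((D ?d)(k + 1 := 0)))"
          by (rule runs_mono[OF clear]) (use K in \<open>simp_all add: D_def\<close>)
        moreover have "(D ?d)(k + 1 := 0) = s(k := of_bool (F N = G N))"
          using 2 s by (auto simp: D_def)
        ultimately have "runs (clear (k + 1)) (heads w K (D ?d)) (Suc ((F N + G N) * Suc 1)) ?t"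
          by simp
        moreover have "zero k (map read_tape (heads w K (D ?d)))" "\<not> zero (k + 1) (map read_tape (heads w K (D ?d)))"
          using 2 K by (simp_all add: zero_heads D_def)
        ultimately show ?thesis
          unfolding test_def by (intro runs_Cond_True runs_Cond_False[of "zero (k + 1)"])
      next
        case 3
        have "runs (clear k) (heads w K (D ?d)) (Suc (Suc ((F N + G N) * Suc 1)))
            (heads w K ((D ?d)(k := 0)))"
          by (rule runs_mono[OF clear]) (use K in \<open>simp_all add: D_def\<close>)
        moreover have "(D ?d)(k := 0) = s(k := of_bool (F N = G N))"
          using 3 s by (auto simp: D_def)
        ultimately have "runs (clear k) (heads w K (D ?d)) (Suc (Suc ((F N + G N) * Suc 1))) ?t"
          by simp
        moreover have "\<not> zero k (map read_tape (heads w K (D ?d)))"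
          using 3 K by (simp_all add: zero_heads D_def)
        ultimately show ?thesis
          unfolding test_def by (rule runs_Cond_False[rotated])
      qed
    qed
    have run: "runs prog (heads w K s)
        (Suc (1 + Suc (Suc (N * Suc (poly T1 N + poly T2 N + 3)) + Suc (Suc (Suc N * Suc 1)
          + Suc (Suc (?d * Suc 1) + (Suc (Suc (Suc ((F N + G N) * Suc 1)))))))))
        (heads w K (s(k := of_bool (F N = G N))))"
      unfolding prog_def
      by (rule runs_Seq[OF r1 runs_Seq[OF r2[unfolded CB] runs_Seq[OF r3[unfolded BD] runs_Seq[OF r4 r5]]]])
    have "F N \<le> m * N" "G N \<le> n * N" by (rule F_le G_le)+
    then have time: "Suc (1 + Suc (Suc (N * Suc (poly T1 N + poly T2 N + 3)) + Suc (Suc (Suc N * Suc 1)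
          + Suc (Suc (?d * Suc 1) + (Suc (Suc (Suc ((F N + G N) * Suc 1)))))))) \<le> poly T N"
      by (simp add: T_def algebra_simps)
    have sem: "F N = G N \<longleftrightarrow> sem w (s \<circ> \<rho>) (Hart x fs gs)"
      by (simp add: F_def G_def N_def)
    show "runs prog (heads w K s) (poly T (length w))
        (heads w K (s(k := of_bool (sem w (s \<circ> \<rho>) (Hart x fs gs)))))"
      using runs_mono[OF run[unfolded sem] time] unfolding N_def .
  next
    fix K S assume "max (max K1 K2) (k + 3) \<le> K"
    then show "wf_prog K S prog"
      using p q
      by (simp add: counts_def prog_def count_def body_def rewind_def cancel_def test_def clear_def wf_mv)
  qed
  then show ?thesis by blast
qed

text \<open>Both \<open>\<rho>\<close> and \<open>k\<close> vary in the induction, since every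
  quantifier redirects its variable to a fresh register and moves the scratch area up by
  three.\<close>

lemma computes_formula:
  fixes f :: "'a fm"
  assumes "\<And>x. \<rho> x < k"
  shows "\<exists>(p :: 'a prog) T K0. computes \<rho> k f p T K0"
  using assms
proof (induction f arbitrary: \<rho> k)
  case (Hart x fs gs)
  have "\<exists>p T K0. computes (\<rho>(x := k + 2)) (k + 3) f p T K0" if "f \<in> set (fs @ gs)" for f
  proof -
    have "(\<rho>(x := k + 2)) y < k + 3" for y using Hart.prems[of y] by auto
    then show ?thesis using that Hart.IH by (auto simp del: fun_upd_apply)
  qed
  then show ?case using Hart.prems computes_Hart by metis
qed (metis computes_Sym computes_Less computes_Neg computes_Conj)+

section \<open>Definable languages are in P\<close>

definition uniform :: "('a tape_symbol \<Rightarrow> 'a tape_symbol \<Rightarrow> 'a tape_symbol) \<Rightarrow> move \<Rightarrow> 'a prog" where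
  "uniform g m = Act (\<lambda>ss. map (\<lambda>s. (g (hd ss) s, m)) ss)"

lemma runs_uniform:
  "runs (uniform g m) ((h, f) # replicate k (h, f')) 1
    ((move_head m h, f(h := g (f h) (f h))) # replicate k (move_head m h, f'(h := g (f h) (f' h))))"
  unfolding uniform_def by (rule runs_Act) (simp add: zip_replicate)

text \<open>Initially only the first tape is filled. All heads step left and write the marker, sweep
  right while copying from the first tape, and return to the marker, where every register has value
  0.\<close>

definition copy_input :: "'a prog" where
  "copy_input = Seq (uniform (\<lambda>_ s. s) MoveLeft) (Seq (uniform (\<lambda>_ _. Aux 0) MoveRight)
    (Seq (While (\<lambda>ss. hd ss \<in> range Input) (uniform (\<lambda>s _. s) MoveRight))
    (Seq (uniform (\<lambda>_ s. s) MoveLeft) (While (\<lambda>ss. hd ss \<noteq> Aux 0) (uniform (\<lambda>_ s. s) MoveLeft)))))"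

lemma wf_copy_input:
  assumes "Aux 0 \<in> S" "1 \<le> K"
  shows "wf_prog K S copy_input"
proof -
  have "hd ss \<in> S" if "\<forall>s\<in>set ss. s \<in> S" "length ss = K" for ss
    using that assms(2) by (cases ss) auto
  then show ?thesis
    using assms(1) by (auto simp: copy_input_def uniform_def)
qed

lemma runs_copy_input:
  fixes w :: "'a list"
  assumes "1 \<le> K"
  shows "runs copy_input (input_tape w # replicate (K - 1) (input_tape []))
    (4 * length w + 12) (heads w K (\<lambda>_. 0))"
proof -
  define k N where "k = K - 1" and "N = length w"
  define g where "g j = (\<lambda>i :: int. if i = -1 then Aux 0
    else if 0 \<le> i \<and> i < int j then Input (w ! nat i) else Blank)" for j
  define f0 where "f0 = (\<lambda>i :: int. if 0 \<le> i \<and> i < int N then Input (w ! nat i) else Blank)"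
  define C where "C j = (int j, cells w) # replicate k (int j, g j)" for j
  define R where "R j = (int N - 1 - int j, cells w) # replicate k (int N - 1 - int j, cells w)" for j
  have g0: "(\<lambda>_. Blank)(-1 := Aux 0) = g 0" by (auto simp: g_def fun_eq_iff)
  have f0: "f0(-1 := Aux 0) = cells w" by (auto simp: f0_def cells_def N_def fun_eq_iff)
  have gN: "g N = cells w" by (auto simp: g_def cells_def N_def fun_eq_iff)
  have 1: "runs (uniform (\<lambda>_ s. s) MoveLeft) (input_tape w # replicate k (input_tape [])) 1
      ((-1, f0) # replicate k (-1, \<lambda>_. Blank))"
  proof -
    have "input_tape w = (0, f0)" "(input_tape [] :: 'a tape) = (0, \<lambda>_. Blank)"
      by (auto simp: input_tape_def f0_def N_def)
    moreover have "f0(0 := f0 0) = f0" "(\<lambda>_ :: int. Blank :: 'a tape_symbol)(0 := Blank) = (\<lambda>_. Blank)"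
      by auto
    ultimately show ?thesis
      using runs_uniform[of "\<lambda>_ s. s" MoveLeft 0 f0 k "\<lambda>_. Blank"] by simp
  qed
  have 2: "runs (uniform (\<lambda>_ _. Aux 0) MoveRight) ((-1, f0) # replicate k (-1, \<lambda>_. Blank)) 1 (C 0)"
    using runs_uniform[of "\<lambda>_ _. Aux 0" MoveRight "-1" f0 k "\<lambda>_. Blank"]
    by (simp add: C_def g0 f0)
  have 3: "runs (While (\<lambda>ss. hd ss \<in> range Input) (uniform (\<lambda>s _. s) MoveRight)) (C 0)
      (Suc (N * Suc 1)) (C N)"
  proof (rule runs_While)
    fix j assume j: "j < N"
    have c: "cells w (int j) = Input (w ! j)" using j by (simp add: cells_def N_def)
    have "(g j)(int j := Input (w ! j)) = g (Suc j)" by (auto simp: g_def fun_eq_iff)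
    moreover have "(cells w)(int j := Input (w ! j)) = cells w" using c by (metis fun_upd_triv)
    ultimately have "runs (uniform (\<lambda>s _. s) MoveRight) (C j) 1 (C (Suc j))"
      using runs_uniform[of "\<lambda>s _. s" MoveRight "int j" "cells w" k "g j"]
      by (simp add: C_def c add.commute)
    then show "hd (map read_tape (C j)) \<in> range Input \<and>
        runs (uniform (\<lambda>s _. s) MoveRight) (C j) 1 (C (Suc j))"
      by (simp add: C_def c)
  qed (auto simp: C_def cells_def N_def)
  have 4: "runs (uniform (\<lambda>_ s. s) MoveLeft) (C N) 1 (R 0)"
    using runs_uniform[of "\<lambda>_ s. s" MoveLeft "int N" "cells w" k "cells w"]
    by (simp add: C_def R_def gN)
  have 5: "runs (While (\<lambda>ss. hd ss \<noteq> Aux 0) (uniform (\<lambda>_ s. s) MoveLeft)) (R 0)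
      (Suc (N * Suc 1)) (R N)"
  proof (rule runs_While)
    fix j assume j: "j < N"
    have c: "cells w (int N - 1 - int j) \<noteq> Aux 0" using j by (simp add: cells_def N_def)
    have "runs (uniform (\<lambda>_ s. s) MoveLeft) (R j) 1 (R (Suc j))"
      using runs_uniform[of "\<lambda>_ s. s" MoveLeft "int N - 1 - int j" "cells w" k "cells w"]
      by (simp add: R_def algebra_simps)
    then show "hd (map read_tape (R j)) \<noteq> Aux 0 \<and>
        runs (uniform (\<lambda>_ s. s) MoveLeft) (R j) 1 (R (Suc j))"
      using c by (simp add: R_def)
  qed (simp add: R_def cells_def)
  have RN: "R N = heads w K (\<lambda>_. 0)"
  proof -
    have "heads w K (\<lambda>_. 0) = replicate K (-1, cells w)"
      by (simp add: heads_def map_replicate_const)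
    also have "\<dots> = R N" using assms by (cases K) (simp_all add: R_def k_def)
    finally show ?thesis by simp
  qed
  have "runs copy_input (input_tape w # replicate k (input_tape []))
      (Suc (1 + Suc (1 + Suc (Suc (N * Suc 1) + Suc (1 + Suc (N * Suc 1)))))) (heads w K (\<lambda>_. 0))"
    unfolding copy_input_def RN[symmetric]
    by (rule runs_Seq[OF 1 runs_Seq[OF 2 runs_Seq[OF 3 runs_Seq[OF 4 5]]]])
  then show ?thesis
    unfolding k_def by (rule runs_mono) (simp add: N_def)
qed

theorem definable_in_P:
  fixes f :: "'a::finite fm"
  shows "{w. sem w (\<lambda>_. 0) f} \<in> complexity_P"
proof -
  \<comment> \<open>Every variable starts at register 0, which keeps the value 0; a quantifier
    redirects its own variable. The verdict appears in register 1.\<close>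
  obtain p T K0 where p: "computes (\<lambda>_. 0) 1 f (p :: 'a prog) T K0"
    using computes_formula[of "\<lambda>_. 0" 1 f] by auto
  define K where "K = max K0 2"
  define S :: "'a tape_symbol set" where "S = {Blank, Aux 0} \<union> range Input"
  have S: "finite S" "insert Blank (range Input) \<subseteq> S" by (auto simp: S_def)
  have "wf_prog K S (Seq copy_input p)"
    using p wf_copy_input[of S K] by (simp add: computes_def K_def S_def)
  moreover have "1 \<le> K" by (simp add: K_def)
  ultimately obtain M :: "'a tm" where M: "wf_tm M" "num_tapes M = K"
    "\<And>w t T ts. exec (Seq copy_input p) (input_tape w # replicate (K - 1) (input_tape [])) t ts \<Longrightarrow>
       t < T \<Longrightarrow> state_after M w T = (if (\<not> zero 1 (map read_tape ts)) then accept M else reject M)"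
    using prog_tm_simulates[of K S "Seq copy_input p" "\<lambda>ss. \<not> zero 1 ss"] S by blast
  \<comment> \<open>Copying and evaluation take at most \<open>4 * length w + 13\<close> steps
    besides those of \<open>T\<close>; the constant 14 makes the bound strict.\<close>
  have "decides_in_time M {w. sem w (\<lambda>_. 0) f} (poly (T + [:14, 4:]))"
    unfolding decides_in_time_def
  proof
    fix w :: "'a list"
    let ?s = "(\<lambda>_. 0)(1 := of_bool (sem w (\<lambda>_. 0) f)) :: nat \<Rightarrow> nat"
    have "runs copy_input (input_tape w # replicate (K - 1) (input_tape []))
      (4 * length w + 12) (heads w K (\<lambda>_. 0))"
      using \<open>1 \<le> K\<close> by (rule runs_copy_input)
    moreover have "runs p (heads w K (\<lambda>_. 0)) (poly T (length w)) (heads w K ?s)"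
      using computesD[OF p, of K "\<lambda>_. 0" w] by (simp add: K_def comp_def)
    ultimately have "runs (Seq copy_input p) (input_tape w # replicate (K - 1) (input_tape []))
      (Suc (4 * length w + 12 + poly T (length w))) (heads w K ?s)"
      by (rule runs_Seq)
    then obtain t where t: "t \<le> Suc (4 * length w + 12 + poly T (length w))"
      "exec (Seq copy_input p) (input_tape w # replicate (K - 1) (input_tape [])) t (heads w K ?s)"
      unfolding runs_def by blast
    have "zero 1 (map read_tape (heads w K ?s)) \<longleftrightarrow> \<not> sem w (\<lambda>_. 0) f"
      using zero_heads[of 1 K w ?s] by (simp add: K_def)
    then show "state_after M w (poly (T + [:14, 4:]) (length w)) =
        (if w \<in> {w. sem w (\<lambda>_. 0) f} then accept M else reject M)"
      using M(3)[OF t(2), of "poly (T + [:14, 4:]) (length w)"] t(1) by simp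
  qed
  with M(1) show ?thesis unfolding complexity_P_def by blast
qed

section \<open>Invariants of the Baxter congruence\<close>

text \<open>Sets instead of letters are allowed because counting is later pulled back along maps
  (\<open>cnt_map\<close>), where a letter or an interval becomes an arbitrary preimage. Counting
  from the right is \<open>cnt\<close> on the reversed word.\<close>

definition cnt :: "'b set \<Rightarrow> 'b set \<Rightarrow> 'b list \<Rightarrow> nat" where
  "cnt A B w = length (filter (\<lambda>x. x \<in> A) (takeWhile (\<lambda>x. x \<notin> B) w))"

lemma cnt_Nil [simp]: "cnt A B [] = 0"
  by (simp add: cnt_def)

lemma cnt_Cons: "cnt A B (c # w) = (if c \<in> B then 0 else of_bool (c \<in> A) + cnt A B w)"
  by (simp add: cnt_def)

lemma cnt_append:
  "cnt A B (x @ y) = cnt A B x + (if set x \<inter> B = {} then cnt A B y else 0)"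
  by (induction x) (auto simp: cnt_Cons)

lemma cnt_avoid: "set x \<inter> B = {} \<Longrightarrow> cnt {a} B x = count_list x a"
  by (induction x) (auto simp: cnt_Cons)

lemma cnt_empty: "cnt {a} {} x = count_list x a"
  by (simp add: cnt_avoid)

lemma cnt_le: "cnt {a} B x \<le> count_list x a"
  by (induction x) (auto simp: cnt_Cons)

lemma cnt_map: "cnt A B (map f w) = cnt (f -` A) (f -` B) w"
  by (induction w) (auto simp: cnt_Cons)

text \<open>The order of two neighbours matters only if counting has not stopped before them and
  exactly one of them stops it while the other is counted.\<close>

lemma cnt_swap:
  assumes "set s \<inter> B \<noteq> {} \<or> (a \<in> B \<longrightarrow> d \<in> B \<or> d \<notin> A) \<and> (d \<in> B \<longrightarrow> a \<in> B \<or> a \<notin> A)"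
  shows "cnt A B (s @ [a, d] @ t) = cnt A B (s @ [d, a] @ t)"
  using assms by (auto simp: cnt_append cnt_Cons)

text \<open>For \<open>c \<le> a\<close> both conditions just compare contents.\<close>

definition same_invariants :: "nat \<Rightarrow> nat list \<Rightarrow> nat list \<Rightarrow> bool" where
  "same_invariants n x y \<longleftrightarrow> (\<forall>a\<in>{1..n}. \<forall>c\<in>{1..n}.
    cnt {a} {a<..c} x = cnt {a} {a<..c} y \<and> cnt {c} {a..<c} (rev x) = cnt {c} {a..<c} (rev y))"

lemma same_invariants_count:
  assumes "same_invariants n x y" "x \<in> lists {1..n}" "y \<in> lists {1..n}"
  shows "count_list x a = count_list y a"
proof (cases "a \<in> {1..n}")
  case True
  then have "cnt {a} {a<..a} x = cnt {a} {a<..a} y"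
    using assms(1) unfolding same_invariants_def by blast
  then show ?thesis by (simp add: cnt_empty)
next
  case False
  then have "a \<notin> set x" "a \<notin> set y" using assms(2,3) by auto
  then show ?thesis by (simp add: count_list_0_iff)
qed

lemma same_invariants_set:
  assumes "same_invariants n x y" "x \<in> lists {1..n}" "y \<in> lists {1..n}"
  shows "set x = set y"
  using same_invariants_count[OF assms] by (metis count_list_0_iff subsetI subset_antisym)

text \<open>Counting \<open>p\<close> against \<open>{p<..q}\<close> depends on the order of the two
  letters only for \<open>p = a\<close> and \<open>d \<le> q\<close>, and then \<open>z\<close> has
  already stopped it. From the right the critical case is \<open>q = d\<close> and
  \<open>p \<le> a\<close>, where \<open>y\<close> has stopped it.\<close>

lemma same_invariants_swap:
  assumes "a < d" "z \<in> set s" "z \<in> {a<..d}" "y \<in> set t" "y \<in> {a..<d}"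
  shows "same_invariants n (s @ [a, d] @ t) (s @ [d, a] @ t)"
  unfolding same_invariants_def
proof (intro ballI conjI)
  fix p q :: nat
  show "cnt {p} {p<..q} (s @ [a, d] @ t) = cnt {p} {p<..q} (s @ [d, a] @ t)"
    by (rule cnt_swap) (use assms in auto)
  have "cnt {q} {p..<q} (rev t @ [d, a] @ rev s) = cnt {q} {p..<q} (rev t @ [a, d] @ rev s)"
    by (rule cnt_swap) (use assms in auto)
  then show "cnt {q} {p..<q} (rev (s @ [a, d] @ t)) = cnt {q} {p..<q} (rev (s @ [d, a] @ t))"
    by simp
qed

lemma baxt_cong_same_invariants: "(x, y) \<in> baxt_cong n \<Longrightarrow> same_invariants n x y"
proof (induction rule: baxt_cong.induct)
  case (gen1 a b c d u v)
  have "same_invariants n (([c] @ u) @ [a, d] @ (v @ [b])) (([c] @ u) @ [d, a] @ (v @ [b]))"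
    by (rule same_invariants_swap[of a d c _ b]) (use gen1 in auto)
  then show ?case by simp
next
  case (gen2 a b c d u v)
  have "same_invariants n (([b] @ u) @ [a, d] @ (v @ [c])) (([b] @ u) @ [d, a] @ (v @ [c]))"
    by (rule same_invariants_swap[of a d b _ c]) (use gen2 in auto)
  then show ?case by (simp add: same_invariants_def)
next
  case (cong_append x y x' y')
  \<comment> \<open>With equal contents, counting stops inside the first factor of both products or
    of neither; the same holds for the last factors.\<close>
  have "set x = set y" "set x' = set y'"
    using cong_append same_invariants_set baxt_cong_lists by metis+
  then show ?case
    using cong_append.IH by (simp add: same_invariants_def cnt_append)
qed (simp_all add: same_invariants_def)

text \<open>The two kinds of generators are the cases \<open>y < z\<close> and
  \<open>z \<le> y\<close> of a single rule, whose conditions on the witnesses are those of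
  \<open>same_invariants_swap\<close>.\<close>

lemma baxt_cong_swap:
  assumes "a < d" "z \<in> set s" "z \<in> {a<..d}" "y \<in> set t" "y \<in> {a..<d}"
    and "s @ [a, d] @ t \<in> lists {1..n}"
  shows "(s @ [a, d] @ t, s @ [d, a] @ t) \<in> baxt_cong n"
proof -
  obtain s1 s2 where s: "s = s1 @ z # s2" using assms(2) split_list by metis
  obtain t1 t2 where t: "t = t1 @ y # t2" using assms(4) split_list by metis
  have "([z] @ s2 @ [a, d] @ t1 @ [y], [z] @ s2 @ [d, a] @ t1 @ [y]) \<in> baxt_cong n"
  proof (cases "y < z")
    case True
    show ?thesis by (rule baxt_cong.gen1) (use True assms s t in auto)
  next
    case False
    show ?thesis
      by (rule baxt_cong.cong_sym, rule baxt_cong.gen2) (use False assms s t in auto)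
  qed
  moreover have "s1 \<in> lists {1..n}" "t2 \<in> lists {1..n}" using assms(6) s t by auto
  ultimately have "(s1 @ ([z] @ s2 @ [a, d] @ t1 @ [y]) @ t2, s1 @ ([z] @ s2 @ [d, a] @ t1 @ [y]) @ t2)
      \<in> baxt_cong n"
    using baxt_cong.cong_append baxt_cong.cong_refl by blast
  then show ?thesis by (simp add: s t)
qed

text \<open>The letter \<open>x\<close> overtakes the letters of \<open>p\<close> from right to
  left. When it meets \<open>y\<close>, the left context is \<open>s @ p1\<close> and the right
  context still contains \<open>q\<close>, so the witnesses for \<open>baxt_cong_swap\<close> are
  present.\<close>

lemma baxt_cong_move:
  assumes "\<And>p1 y p2. p = p1 @ y # p2 \<Longrightarrow> y \<noteq> x \<and>
      (\<exists>z\<in>set (s @ p1). min x y < z \<and> z \<le> max x y) \<and> (\<exists>z\<in>set q. min x y \<le> z \<and> z < max x y)"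
    and "s @ p @ x # q \<in> lists {1..n}"
  shows "(s @ p @ x # q, s @ x # p @ q) \<in> baxt_cong n"
  using assms
proof (induction p arbitrary: q rule: rev_induct)
  case Nil
  then show ?case using baxt_cong.cong_refl by simp
next
  case (snoc y p)
  have y: "y \<noteq> x" "\<exists>z\<in>set (s @ p). min x y < z \<and> z \<le> max x y" "\<exists>z\<in>set q. min x y \<le> z \<and> z < max x y"
    using snoc.prems(1)[of p y "[]"] by auto
  have "((s @ p) @ [y, x] @ q, (s @ p) @ [x, y] @ q) \<in> baxt_cong n"
  proof (cases "y < x")
    case True
    then obtain z z' where "z \<in> set (s @ p)" "z \<in> {y<..x}" "z' \<in> set q" "z' \<in> {y..<x}"
      using y by (auto simp: min_def max_def)
    from baxt_cong_swap[OF True this] show ?thesis using snoc.prems(2) by simp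
  next
    case False
    then have "x < y" using y by simp
    then obtain z z' where "z \<in> set (s @ p)" "z \<in> {x<..y}" "z' \<in> set q" "z' \<in> {x..<y}"
      using y by (auto simp: min_def max_def)
    from baxt_cong_swap[OF \<open>x < y\<close> this] show ?thesis
      using snoc.prems(2) baxt_cong.cong_sym by simp
  qed
  moreover have "(s @ p @ x # y # q, s @ x # p @ y # q) \<in> baxt_cong n"
  proof (rule snoc.IH)
    fix p1 y' p2 assume "p = p1 @ y' # p2"
    then show "y' \<noteq> x \<and> (\<exists>z\<in>set (s @ p1). min x y' < z \<and> z \<le> max x y') \<and>
        (\<exists>z\<in>set (y # q). min x y' \<le> z \<and> z < max x y')"
      using snoc.prems(1)[of p1 y' "p2 @ [y]"] by auto
  qed (use snoc.prems(2) in auto)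
  ultimately show ?case using baxt_cong.cong_trans by simp
qed

text \<open>The common prefix \<open>s\<close> is kept in the induction because the invariants of \<open>s @ u\<close> do not
  determine those of \<open>u\<close>.\<close>

lemma same_invariants_prefix_baxt_cong:
  assumes "same_invariants n (s @ u) (s @ v)" "s @ u \<in> lists {1..n}" "s @ v \<in> lists {1..n}"
  shows "(s @ u, s @ v) \<in> baxt_cong n"
  using assms
proof (induction v arbitrary: s u)
  case Nil
  then have "count_list u a = 0" for a
    using same_invariants_count[OF Nil.prems, of a] by simp
  then have "u = []" by (metis count_list_0_iff list.set_intros(1) neq_Nil_conv)
  then show ?case using Nil.prems(3) baxt_cong.cong_refl by blast
next
  case (Cons x v)
  have count: "count_list u a = count_list (x # v) a" for a
    using same_invariants_count[OF Cons.prems, of a] by simp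
  have "x \<in> set u" using count[of x] by (metis count_list_0_iff list.set_intros(1))
  \<comment> \<open>The letter that comes next in the other word is brought to the front of
    \<open>u\<close>, starting from its first occurrence.\<close>
  then obtain p q where u: "u = p @ x # q" and xp: "x \<notin> set p" using split_list_first by metis
  have left: "cnt {a} {a<..c} (s @ u) = cnt {a} {a<..c} (s @ x # v)"
    and right: "cnt {c} {a..<c} (rev (s @ u)) = cnt {c} {a..<c} (rev (s @ x # v))"
    if "a \<in> set u" "c \<in> set u" for a c
  proof -
    have "a \<in> {1..n}" "c \<in> {1..n}" using that Cons.prems(2) by auto
    then show "cnt {a} {a<..c} (s @ u) = cnt {a} {a<..c} (s @ x # v)"
      "cnt {c} {a..<c} (rev (s @ u)) = cnt {c} {a..<c} (rev (s @ x # v))"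
      using Cons.prems(1) unfolding same_invariants_def by blast+
  qed
  have xqv: "count_list q x = count_list v x" using count[of x] xp u by (simp add: count_list_0_iff)
  have "(s @ p @ x # q, s @ x # p @ q) \<in> baxt_cong n"
  proof (rule baxt_cong_move)
    fix p1 y p2 assume p: "p = p1 @ y # p2"
    have yx: "y \<noteq> x" and yu: "y \<in> set u" and xu: "x \<in> set u" using xp p u by auto
    have yv: "y \<in> set v"
      using count[of y] yx yu by (metis count_list_0_iff set_ConsD)
    have xp12: "x \<notin> set p1" "x \<notin> set p2" using xp p by auto
    show "y \<noteq> x \<and> (\<exists>z\<in>set (s @ p1). min x y < z \<and> z \<le> max x y) \<and>
        (\<exists>z\<in>set q. min x y \<le> z \<and> z < max x y)"
    proof (cases "y < x")
      case True
      \<comment> \<open>Otherwise the \<open>y\<close> after \<open>p1\<close> would be counted in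
        \<open>s @ u\<close>, whereas in \<open>s @ x # v\<close> the \<open>x\<close> right after
        \<open>s\<close> stops the counting.\<close>
      have "set (s @ p1) \<inter> {y<..x} \<noteq> {}"
      proof
        assume "set (s @ p1) \<inter> {y<..x} = {}"
        then have e: "set s \<inter> {y<..x} = {}" "set p1 \<inter> {y<..x} = {}" by auto
        then show False
          using left[OF yu xu] True u p by (simp add: cnt_append cnt_Cons cnt_avoid)
      qed
      \<comment> \<open>Otherwise counting from the right sees every \<open>x\<close> of
        \<open>q\<close> and one more. In the other word it is stopped by a \<open>y\<close> inside
        \<open>v\<close>, which has only as many \<open>x\<close> as \<open>q\<close>.\<close>
      moreover have "set q \<inter> {y..<x} \<noteq> {}"
      proof
        assume "set q \<inter> {y..<x} = {}"
        then have "count_list q x + 1 \<le> cnt {x} {y..<x} (rev (s @ u))"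
          using u True by (simp add: cnt_append cnt_Cons cnt_avoid)
        also have "\<dots> = cnt {x} {y..<x} (rev v)"
          using right[OF yu xu] yv True by (auto simp: cnt_append)
        also have "\<dots> \<le> count_list v x" using cnt_le[of x _ "rev v"] by simp
        finally show False using xqv by simp
      qed
      ultimately show ?thesis using True by (auto simp: min_def max_def)
    next
      case False
      then have xy: "x < y" using yx by simp
      \<comment> \<open>Otherwise this \<open>y\<close> stops the counting of \<open>x\<close> in
        \<open>s @ u\<close> before any \<open>x\<close> after \<open>s\<close> is reached, while in
        \<open>s @ x # v\<close> the \<open>x\<close> right after \<open>s\<close> is
        counted.\<close>
      have "set (s @ p1) \<inter> {x<..y} \<noteq> {}"
      proof
        assume "set (s @ p1) \<inter> {x<..y} = {}"
        then have e: "set s \<inter> {x<..y} = {}" "set p1 \<inter> {x<..y} = {}" by auto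
        then show False
          using left[OF xu yu] xy u p xp12 by (simp add: cnt_append cnt_Cons cnt_avoid count_list_0_iff)
      qed
      moreover have "set q \<inter> {x..<y} \<noteq> {}"
      proof
        assume q: "set q \<inter> {x..<y} = {}"
        \<comment> \<open>The set is nonempty: otherwise the counts of \<open>y\<close> from the
          right would cover exactly \<open>q\<close> and \<open>v\<close>, but \<open>v\<close>
          contains more \<open>y\<close> than \<open>q\<close>. Its least element \<open>z\<close>
          differs from \<open>x\<close>, because \<open>q\<close> and \<open>v\<close> have equally
          many \<open>x\<close> and \<open>z\<close> is not in \<open>q\<close>. Counting
          \<open>z\<close> against \<open>{x..<z}\<close> from the right then gives 0 for
          \<open>u\<close> and a positive number for \<open>v\<close>.\<close>
        define Z where "Z = {z \<in> set v. x \<le> z \<and> z < y}"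
        have cq: "cnt {y} {x..<y} (rev (s @ u)) = count_list q y"
          using q u xy by (simp add: cnt_append cnt_Cons cnt_avoid)
        have "Z \<noteq> {}"
        proof
          assume "Z = {}"
          then have "set v \<inter> {x..<y} = {}" by (auto simp: Z_def)
          then have "cnt {y} {x..<y} (rev (s @ x # v)) = count_list v y"
            using xy by (simp add: cnt_append cnt_Cons cnt_avoid)
          then have "count_list q y = count_list v y" using right[OF xu yu] cq by simp
          then show False using count[of y] u p xy by (simp split: if_splits)
        qed
        moreover have "finite Z" by (simp add: Z_def)
        ultimately have Min: "Min Z \<in> Z" "\<And>z. z \<in> Z \<Longrightarrow> Min Z \<le> z" by auto
        define z where "z = Min Z"
        have z: "z \<in> set v" "x \<le> z" "z < y" using Min(1) by (auto simp: Z_def z_def)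
        have zq: "z \<notin> set q" using q z by auto
        have "z \<noteq> x"
        proof
          assume "z = x"
          then have "count_list v x \<noteq> 0" using z(1) by (simp add: count_list_0_iff)
          then show False using xqv zq \<open>z = x\<close> by (simp add: count_list_0_iff)
        qed
        then have "x < z" using z by simp
        have "z \<in> set u" using count[of z] z(1) by (metis count_list_0_iff list.set_intros(2))
        have "set q \<inter> {x..<z} = {}" using q z by auto
        then have "cnt {z} {x..<z} (rev (s @ u)) = 0"
          using u \<open>x < z\<close> zq by (simp add: cnt_append cnt_Cons cnt_avoid count_list_0_iff)
        moreover have "set v \<inter> {x..<z} = {}"
        proof -
          have "w \<in> Z \<Longrightarrow> z \<le> w" for w using Min(2) by (simp add: z_def)
          then have "w \<notin> set v \<or> w < x \<or> z \<le> w" for w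
            using z(3) by (fastforce simp: Z_def)
          then show ?thesis by fastforce
        qed
        then have "cnt {z} {x..<z} (rev (s @ x # v)) = count_list v z"
          using \<open>x < z\<close> by (simp add: cnt_append cnt_Cons cnt_avoid)
        ultimately have "count_list v z = 0" using right[OF xu \<open>z \<in> set u\<close>] by simp
        then show False using z(1) by (simp add: count_list_0_iff)
      qed
      ultimately show ?thesis using xy by (auto simp: min_def max_def)
    qed
  qed (use Cons.prems(2) u in auto)
  then have *: "(s @ u, (s @ [x]) @ p @ q) \<in> baxt_cong n" by (simp add: u)
  moreover have "same_invariants n ((s @ [x]) @ p @ q) ((s @ [x]) @ v)"
    using baxt_cong_same_invariants[OF *] Cons.prems(1) by (simp add: same_invariants_def)
  then have "((s @ [x]) @ p @ q, (s @ [x]) @ v) \<in> baxt_cong n"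
    by (rule Cons.IH) (use Cons.prems u in auto)
  ultimately show ?case using baxt_cong.cong_trans by fastforce
qed

theorem baxt_cong_iff:
  assumes "x \<in> lists {1..n}" "y \<in> lists {1..n}"
  shows "(x, y) \<in> baxt_cong n \<longleftrightarrow> same_invariants n x y"
  using same_invariants_prefix_baxt_cong[of n "[]" x y] baxt_cong_same_invariants assms by auto

section \<open>Identities fail on substitutions of total length at most three\<close>

fun letter_var :: "'x letter \<Rightarrow> 'x" where
  "letter_var (Plain x) = x"
| "letter_var (Starred x) = x"

fun is_starred :: "'x letter \<Rightarrow> bool" where
  "is_starred (Plain x) = False"
| "is_starred (Starred x) = True"

definition subst_letter :: "nat \<Rightarrow> ('x \<Rightarrow> nat list) \<Rightarrow> 'x letter \<Rightarrow> nat list" where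
  "subst_letter n \<psi> l = (if is_starred l then word_sharp n (\<psi> (letter_var l)) else \<psi> (letter_var l))"

definition subst :: "nat \<Rightarrow> ('x \<Rightarrow> nat list) \<Rightarrow> 'x letter list \<Rightarrow> nat list" where
  "subst n \<psi> w = concat (map (subst_letter n \<psi>) w)"

lemma subst_lists:
  assumes "\<And>x. \<psi> x \<in> lists {1..n}"
  shows "subst n \<psi> w \<in> lists {1..n}"
proof -
  have "subst_letter n \<psi> l \<in> lists {1..n}" for l
    using assms word_sharp_lists unfolding subst_letter_def by metis
  then show ?thesis by (fastforce simp: subst_def)
qed

lemma eval_word_classes:
  assumes "\<And>x. \<psi> x \<in> lists {1..n}"
  shows "eval_word (baxt n) (baxt_sharp n) (\<lambda>x. baxt_cong n `` {\<psi> x}) w = baxt_cong n `` {subst n \<psi> w}"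
proof (induction w)
  case Nil
  then show ?case by (simp add: eval_word_def subst_def baxt_def)
next
  case (Cons l w)
  have "eval_letter (baxt_sharp n) (\<lambda>x. baxt_cong n `` {\<psi> x}) l = baxt_cong n `` {subst_letter n \<psi> l}"
    using assms by (cases l) (simp_all add: subst_letter_def baxt_sharp_class)
  moreover have "subst_letter n \<psi> l \<in> lists {1..n}" "subst n \<psi> w \<in> lists {1..n}"
    using assms subst_lists word_sharp_lists unfolding subst_letter_def by metis+
  ultimately show ?case
    using Cons mult_baxt_class[of "subst_letter n \<psi> l" n "subst n \<psi> w"]
    by (simp add: eval_word_def subst_def)
qed

text \<open>Every element of the monoid has a representative word, so assignments may be replaced by
  substitutions of words, and equality of classes by equality of invariants.\<close>

lemma satisfies_identity_iff_subst:
  "satisfies_identity (baxt n) (baxt_sharp n) u v \<longleftrightarrow>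
    (\<forall>\<psi>. (\<forall>x. \<psi> x \<in> lists {1..n}) \<longrightarrow> same_invariants n (subst n \<psi> u) (subst n \<psi> v))"
proof -
  have class_eq: "baxt_cong n `` {subst n \<psi> u} = baxt_cong n `` {subst n \<psi> v} \<longleftrightarrow>
      same_invariants n (subst n \<psi> u) (subst n \<psi> v)" if "\<forall>x. \<psi> x \<in> lists {1..n}" for \<psi>
  proof -
    have l: "subst n \<psi> u \<in> lists {1..n}" "subst n \<psi> v \<in> lists {1..n}"
      using that subst_lists by blast+
    show ?thesis
      using eq_equiv_class_iff[OF equiv_baxt_cong l] baxt_cong_iff[OF l] by simp
  qed
  show ?thesis
  proof
    assume sat: "satisfies_identity (baxt n) (baxt_sharp n) u v"
    show "\<forall>\<psi>. (\<forall>x. \<psi> x \<in> lists {1..n}) \<longrightarrow> same_invariants n (subst n \<psi> u) (subst n \<psi> v)"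
    proof (intro allI impI)
      fix \<psi> :: "'a \<Rightarrow> nat list" assume \<psi>: "\<forall>x. \<psi> x \<in> lists {1..n}"
      let ?\<phi> = "\<lambda>x. baxt_cong n `` {\<psi> x}"
      have "range ?\<phi> \<subseteq> carrier (baxt n)" using \<psi> by (auto simp: baxt_def quotientI simp del: in_lists_conv_set)
      then have "eval_word (baxt n) (baxt_sharp n) ?\<phi> u = eval_word (baxt n) (baxt_sharp n) ?\<phi> v"
        using sat unfolding satisfies_identity_def by blast
      then show "same_invariants n (subst n \<psi> u) (subst n \<psi> v)"
        using class_eq[OF \<psi>] eval_word_classes[of \<psi> n] \<psi> by metis
    qed
  next
    assume inv: "\<forall>\<psi>. (\<forall>x. \<psi> x \<in> lists {1..n}) \<longrightarrow> same_invariants n (subst n \<psi> u) (subst n \<psi> v)"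
    show "satisfies_identity (baxt n) (baxt_sharp n) u v"
      unfolding satisfies_identity_def
    proof (intro allI impI)
      fix \<phi> :: "'a \<Rightarrow> nat list set" assume "range \<phi> \<subseteq> carrier (baxt n)"
      then have "\<forall>x. \<exists>w. w \<in> lists {1..n} \<and> \<phi> x = baxt_cong n `` {w}"
        unfolding baxt_def quotient_def by (simp del: in_lists_conv_set) blast
      then obtain \<psi> where \<psi>: "\<forall>x. \<psi> x \<in> lists {1..n} \<and> \<phi> x = baxt_cong n `` {\<psi> x}" by metis
      then have "\<phi> = (\<lambda>x. baxt_cong n `` {\<psi> x})" by auto
      then show "eval_word (baxt n) (baxt_sharp n) \<phi> u = eval_word (baxt n) (baxt_sharp n) \<phi> v"
        using eval_word_classes[of \<psi> n] class_eq[of \<psi>] inv \<psi> by metis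
    qed
  qed
qed

text \<open>The label of the element that stops the counting, as a set because it is absent when
  counting runs to the end.\<close>

definition first_in :: "('b \<Rightarrow> 'c) \<Rightarrow> 'b set \<Rightarrow> 'b list \<Rightarrow> 'c set" where
  "first_in f B l = f ` set (take 1 (dropWhile (\<lambda>x. x \<notin> B) l))"

lemma first_in_card: "finite (first_in f B l) \<and> card (first_in f B l) \<le> 1"
proof -
  have "card (first_in f B l) \<le> length (take 1 (dropWhile (\<lambda>x. x \<notin> B) l))"
    unfolding first_in_def by (meson card_image_le card_length finite_set order_trans)
  then show ?thesis by (simp add: first_in_def)
qed

text \<open>Nothing before the stopping element lies in \<open>B\<close>, and that element is kept;
  so counting stops at the same place in the filtered list.\<close>

lemma cnt_filter:
  assumes "first_in f B l \<subseteq> S"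
  shows "cnt A B (filter (\<lambda>x. f x \<in> S) l)
    = length (filter (\<lambda>x. f x \<in> S) (filter (\<lambda>x. x \<in> A) (takeWhile (\<lambda>x. x \<notin> B) l)))"
  using assms by (induction l) (auto simp: first_in_def cnt_Cons)

lemma length_filter_eq_sum:
  assumes "finite S"
  shows "length (filter (\<lambda>x. f x \<in> S) l) = (\<Sum>c\<in>S. count_list (map f l) c)"
proof (induction l)
  case (Cons x l)
  have "(\<Sum>c\<in>S. count_list (map f (x # l)) c) = (\<Sum>c\<in>S. count_list (map f l) c + (if c = f x then 1 else 0))"
    by (intro sum.cong) auto
  also have "\<dots> = (\<Sum>c\<in>S. count_list (map f l) c) + (if f x \<in> S then 1 else 0)"
    using assms by (simp add: sum.distrib)
  finally show ?case using Cons by simp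
qed simp

text \<open>Keeping the two elements that end the counting and one more element, whose contributions
  differ, suffices.\<close>

lemma cnt_neq_restrict:
  assumes "cnt A B l1 \<noteq> cnt A B l2"
  obtains S where "finite S" "card S \<le> 3" "S \<subseteq> f ` (set l1 \<union> set l2)"
    "cnt A B (filter (\<lambda>x. f x \<in> S) l1) \<noteq> cnt A B (filter (\<lambda>x. f x \<in> S) l2)"
proof -
  define t where "t l = filter (\<lambda>x. x \<in> A) (takeWhile (\<lambda>x. x \<notin> B) l)" for l
  define c where "c l = count_list (map f (t l))" for l
  define S0 where "S0 = first_in f B l1 \<union> first_in f B l2"
  define G where "G = f ` (set l1 \<union> set l2)"
  have fin: "finite S0" "finite G" using first_in_card[of f B] by (simp_all add: S0_def G_def)
  have "S0 \<subseteq> G"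
    unfolding S0_def G_def first_in_def
    by (auto dest!: in_set_takeD set_dropWhileD)
  have card: "card S0 \<le> 2"
    using card_Un_le[of "first_in f B l1" "first_in f B l2"] first_in_card[of f B l1] first_in_card[of f B l2]
    unfolding S0_def by linarith
  have cnt: "cnt A B (filter (\<lambda>x. f x \<in> S) l1) = sum (c l1) S"
    "cnt A B (filter (\<lambda>x. f x \<in> S) l2) = sum (c l2) S" if "S0 \<subseteq> S" "finite S" for S
    using that unfolding S0_def c_def t_def
    by (simp_all only: cnt_filter le_sup_iff flip: length_filter_eq_sum)
  show ?thesis
  proof (cases "sum (c l1) S0 = sum (c l2) S0")
    case False
    then show ?thesis
      using that[of S0] cnt[of S0] fin card \<open>S0 \<subseteq> G\<close> unfolding G_def by simp
  next
    case True
    \<comment> \<open>Over all labels nothing is deleted, so the sums over \<open>G\<close> are the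
      original counts. Removing the equal sums over \<open>S0\<close> leaves some label
      \<open>g\<close> outside \<open>S0\<close> whose contributions differ.\<close>
    have "filter (\<lambda>x. f x \<in> G) l1 = l1" "filter (\<lambda>x. f x \<in> G) l2 = l2"
      by (auto simp: G_def intro!: filter_True)
    then have "sum (c l1) G \<noteq> sum (c l2) G"
      using assms cnt[OF \<open>S0 \<subseteq> G\<close> fin(2)] by simp
    then have "sum (c l1) (G - S0) \<noteq> sum (c l2) (G - S0)"
      using sum.subset_diff[OF \<open>S0 \<subseteq> G\<close> fin(2)] True by metis
    then obtain g where g: "g \<in> G - S0" "c l1 g \<noteq> c l2 g" by (meson sum.cong)
    then have "sum (c l1) (insert g S0) \<noteq> sum (c l2) (insert g S0)"
      using True fin by simp
    moreover have "card (insert g S0) \<le> 3" using card fin g by simp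
    ultimately show ?thesis
      using that[of "insert g S0"] cnt[of "insert g S0"] fin g \<open>S0 \<subseteq> G\<close> unfolding G_def
      by (simp add: subset_insertI)
  qed
qed

text \<open>A substitution listed letter by letter: the length of the table is the total length of
  the images, and variables outside the table are erased.\<close>

definition table_subst :: "('x \<times> nat) list \<Rightarrow> 'x \<Rightarrow> nat list" where
  "table_subst T x = map snd (filter (\<lambda>p. fst p = x) T)"

lemma table_subst_lists: "snd ` set T \<subseteq> {1..n} \<Longrightarrow> table_subst T x \<in> lists {1..n}"
  by (fastforce simp: table_subst_def)

text \<open>Traces each letter of a value to its origin: a variable with a position in its image,
  and whether the letter comes from a starred copy. A deletion selects by the first component only
  and thus acts alike on plain and starred copies.\<close>

definition labels :: "('x \<Rightarrow> nat list) \<Rightarrow> 'x letter \<Rightarrow> (('x \<times> nat) \<times> bool) list" where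
  "labels \<psi> l = map (\<lambda>i. ((letter_var l, i), is_starred l))
    ((if is_starred l then rev else id) [0..<length (\<psi> (letter_var l))])"

definition label_val :: "nat \<Rightarrow> ('x \<Rightarrow> nat list) \<Rightarrow> (('x \<times> nat) \<times> bool) \<Rightarrow> nat" where
  "label_val n \<psi> = (\<lambda>((x, i), b). if b then n + 1 - \<psi> x ! i else \<psi> x ! i)"

lemma subst_labels: "subst n \<psi> w = map (label_val n \<psi>) (concat (map (labels \<psi>) w))"
proof -
  have "subst_letter n \<psi> l = map (label_val n \<psi>) (labels \<psi> l)" for l
  proof -
    have "map ((!) (\<psi> (letter_var l))) [0..<length (\<psi> (letter_var l))] = \<psi> (letter_var l)"
      by (rule map_nth)
    then have "map (\<lambda>i. n + 1 - \<psi> (letter_var l) ! i) [0..<length (\<psi> (letter_var l))]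
        = map (\<lambda>i. n + 1 - i) (\<psi> (letter_var l))"
      by (metis (mono_tags, lifting) list.map_comp comp_apply map_eq_conv)
    then show ?thesis
      by (simp add: subst_letter_def word_sharp_def labels_def label_val_def comp_def map_nth flip: rev_map)
  qed
  then have "subst_letter n \<psi> = (\<lambda>l. map (label_val n \<psi>) (labels \<psi> l))"
    by (rule ext)
  then show ?thesis by (simp add: subst_def map_concat comp_def)
qed

text \<open>Deleting positions of images commutes with substitution, because starring reverses and
  complements an image but keeps the origin of each letter.\<close>

lemma restrict_to_table:
  fixes \<psi> :: "'x \<Rightarrow> nat list"
  assumes "finite S" "S \<subseteq> (SIGMA x:UNIV. {..<length (\<psi> x)})" "\<And>x. \<psi> x \<in> lists {1..n}"
  obtains T where "length T = card S" "fst ` set T \<subseteq> fst ` S" "snd ` set T \<subseteq> {1..n}"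
    "\<And>w. subst n (table_subst T) w
      = map (label_val n \<psi>) (filter (\<lambda>z. fst z \<in> S) (concat (map (labels \<psi>) w)))"
proof -
  define idx where "idx x = filter (\<lambda>i. (x, i) \<in> S) [0..<length (\<psi> x)]" for x
  obtain xs where xs: "set xs = fst ` S" "distinct xs"
    using finite_distinct_list[of "fst ` S"] assms(1) by auto
  \<comment> \<open>Grouping by distinct variables lists each element of \<open>S\<close> once and
    keeps the positions of one image in order.\<close>
  define L where "L = concat (map (\<lambda>x. map (Pair x) (idx x)) xs)"
  define T where "T = map (\<lambda>(x, i). (x, \<psi> x ! i)) L"
  have setL: "set L = S"
    using assms(2) xs(1) by (force simp: L_def idx_def)
  have "distinct (concat (map (\<lambda>x. map (Pair x) (idx x)) ys))" if "distinct ys" for ys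
    using that by (induction ys) (auto simp: distinct_map inj_on_def idx_def)
  then have "length L = card S" using distinct_card[of L] setL xs(2) by (simp add: L_def)
  have "filter (\<lambda>p. fst p = x) (concat (map (\<lambda>x. map (Pair x) (idx x)) ys))
      = (if x \<in> set ys then map (Pair x) (idx x) else [])" if "distinct ys" for ys x
    using that
  proof (induction ys)
    case (Cons y ys)
    have "filter (\<lambda>p. fst p = x) (map (Pair y) (idx y)) = (if x = y then map (Pair y) (idx y) else [])"
      by (auto simp: filter_map comp_def)
    then show ?case using Cons by auto
  qed simp
  then have fL: "filter (\<lambda>p. fst p = x) L = (if x \<in> fst ` S then map (Pair x) (idx x) else [])" for x
    using xs unfolding L_def by simp
  have "idx x = []" if "x \<notin> fst ` S" for x
    using that unfolding idx_def by (force simp: filter_empty_conv)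
  then have fL': "filter (\<lambda>p. fst p = x) L = map (Pair x) (idx x)" for x
    using fL by simp
  have ts: "table_subst T x = map ((!) (\<psi> x)) (idx x)" for x
  proof -
    have "filter (\<lambda>p. fst p = x) T = map (\<lambda>(x, i). (x, \<psi> x ! i)) (filter (\<lambda>p. fst p = x) L)"
      unfolding T_def filter_map by (rule arg_cong[where f = "map _"]) (auto intro: filter_cong)
    then show ?thesis by (simp add: table_subst_def fL')
  qed
  have "subst_letter n (table_subst T)
      = (\<lambda>l. map (label_val n \<psi>) (filter (\<lambda>z. fst z \<in> S) (labels \<psi> l)))"
    by (rule ext) (auto simp: subst_letter_def ts labels_def label_val_def word_sharp_def idx_def
        filter_map comp_def rev_map simp flip: rev_filter)
  then have "subst n (table_subst T) w
      = map (label_val n \<psi>) (filter (\<lambda>z. fst z \<in> S) (concat (map (labels \<psi>) w)))" for w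
    by (simp add: subst_def map_concat filter_concat comp_def)
  moreover have "snd ` set T \<subseteq> {1..n}"
  proof -
    have "\<psi> x ! i \<in> {1..n}" if "(x, i) \<in> S" for x i
      using that assms(2) assms(3)[of x] nth_mem[of i "\<psi> x"] by blast
    then show ?thesis using setL by (auto simp: T_def)
  qed
  moreover have "fst ` set T \<subseteq> fst ` S" using setL by (force simp: T_def)
  moreover have "length T = card S" using \<open>length L = card S\<close> by (simp add: T_def)
  ultimately show ?thesis using that by blast
qed

theorem satisfies_identity_iff_tables:
  "satisfies_identity (baxt n) (baxt_sharp n) u v \<longleftrightarrow>
    (\<forall>T. length T \<le> 3 \<and> fst ` set T \<subseteq> letter_var ` (set u \<union> set v) \<and> snd ` set T \<subseteq> {1..n} \<longrightarrow>
      same_invariants n (subst n (table_subst T) u) (subst n (table_subst T) v))"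
  (is "?L \<longleftrightarrow> ?R")
proof
  assume L: ?L
  show ?R
  proof (intro allI impI, elim conjE)
    fix T :: "('a \<times> nat) list" assume "snd ` set T \<subseteq> {1..n}"
    then have "table_subst T x \<in> lists {1..n}" for x by (rule table_subst_lists)
    with L show "same_invariants n (subst n (table_subst T) u) (subst n (table_subst T) v)"
      by (simp only: satisfies_identity_iff_subst simp_thms)
  qed
next
  assume R: ?R
  show ?L
  proof (rule ccontr)
    assume "\<not> ?L"
    then obtain \<psi> where \<psi>: "\<And>x. \<psi> x \<in> lists {1..n}"
      and ne: "\<not> same_invariants n (subst n \<psi> u) (subst n \<psi> v)"
      unfolding satisfies_identity_iff_subst by blast
    define lab where "lab w = concat (map (labels \<psi>) w)" for w
    have fst_lab: "fst ` set (lab w) \<subseteq> (SIGMA x:letter_var ` set w. {..<length (\<psi> x)})" for w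
      by (auto simp: lab_def labels_def split: if_splits)
    have small: same if "finite S" "card S \<le> 3" "S \<subseteq> fst ` (set (lab u) \<union> set (lab v))"
      and "same = same_invariants n (map (label_val n \<psi>) (filter (\<lambda>z. fst z \<in> S) (lab u)))
        (map (label_val n \<psi>) (filter (\<lambda>z. fst z \<in> S) (lab v)))" for S same
    proof -
      have "S \<subseteq> (SIGMA x:letter_var ` (set u \<union> set v). {..<length (\<psi> x)})"
      proof -
        have "S \<subseteq> fst ` set (lab u) \<union> fst ` set (lab v)" using that(3) by (simp only: image_Un)
        also have "\<dots> \<subseteq> (SIGMA x:letter_var ` set u. {..<length (\<psi> x)})
            \<union> (SIGMA x:letter_var ` set v. {..<length (\<psi> x)})"
          by (rule Un_mono[OF fst_lab fst_lab])
        finally show ?thesis by auto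
      qed
      then have "S \<subseteq> (SIGMA x:UNIV. {..<length (\<psi> x)})" "fst ` S \<subseteq> letter_var ` (set u \<union> set v)"
        by auto
      from restrict_to_table[OF that(1) this(1) \<psi>] obtain T where T:
        "length T = card S" "fst ` set T \<subseteq> fst ` S" "snd ` set T \<subseteq> {1..n}"
        "\<And>w. subst n (table_subst T) w
          = map (label_val n \<psi>) (filter (\<lambda>z. fst z \<in> S) (lab w))"
        unfolding lab_def by blast
      have "fst ` set T \<subseteq> letter_var ` (set u \<union> set v)"
        using T(2) \<open>fst ` S \<subseteq> letter_var ` (set u \<union> set v)\<close> by (rule order_trans)
      then show ?thesis
        using R T that(2) unfolding that(4) T(4)[symmetric] by simp
    qed
    have su: "subst n \<psi> w = map (label_val n \<psi>) (lab w)" for w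
      unfolding lab_def by (rule subst_labels)
    from ne obtain a c where ac: "a \<in> {1..n}" "c \<in> {1..n}" and
      "cnt {a} {a<..c} (subst n \<psi> u) \<noteq> cnt {a} {a<..c} (subst n \<psi> v) \<or>
       cnt {c} {a..<c} (rev (subst n \<psi> u)) \<noteq> cnt {c} {a..<c} (rev (subst n \<psi> v))"
      unfolding same_invariants_def by blast
    then show False
    proof (elim disjE)
      assume "cnt {a} {a<..c} (subst n \<psi> u) \<noteq> cnt {a} {a<..c} (subst n \<psi> v)"
      \<comment> \<open>Counting is pulled back to the traced letters; with \<open>fst\<close> as
        labelling, a deletion acts on positions of images.\<close>
      from cnt_neq_restrict[OF this[unfolded su cnt_map], of fst] obtain S where
        S: "finite S" "card S \<le> 3" "S \<subseteq> fst ` (set (lab u) \<union> set (lab v))"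
        "cnt {a} {a<..c} (map (label_val n \<psi>) (filter (\<lambda>z. fst z \<in> S) (lab u)))
          \<noteq> cnt {a} {a<..c} (map (label_val n \<psi>) (filter (\<lambda>z. fst z \<in> S) (lab v)))"
        unfolding cnt_map by blast
      then show False
        using small[OF S(1-3) HOL.refl] ac unfolding same_invariants_def by blast
    next
      assume "cnt {c} {a..<c} (rev (subst n \<psi> u)) \<noteq> cnt {c} {a..<c} (rev (subst n \<psi> v))"
      from cnt_neq_restrict[OF this[unfolded su rev_map cnt_map], of fst] obtain S where
        S: "finite S" "card S \<le> 3" "S \<subseteq> fst ` (set (rev (lab u)) \<union> set (rev (lab v)))"
        "cnt {c} {a..<c} (map (label_val n \<psi>) (filter (\<lambda>z. fst z \<in> S) (rev (lab u))))
          \<noteq> cnt {c} {a..<c} (map (label_val n \<psi>) (filter (\<lambda>z. fst z \<in> S) (rev (lab v))))"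
        unfolding cnt_map by blast
      then show False
        using small[OF S(1-2) _ HOL.refl] ac unfolding same_invariants_def
        by (simp flip: rev_filter rev_map)
    qed
  qed
qed

section \<open>Counting in a substituted word by positions\<close>

text \<open>The same tracing as in \<open>labels\<close>, but with indices into the table instead of
  the image. Such an index is bounded by the length of the table, so a formula can treat it as a
  constant and only the place as a variable.\<close>

definition place_seq :: "('p \<Rightarrow> 'x) \<Rightarrow> ('p \<Rightarrow> bool) \<Rightarrow> ('x \<times> nat) list \<Rightarrow> 'p list \<Rightarrow> ('p \<times> nat) list" where
  "place_seq vr st T ps = concat (map (\<lambda>p. map (Pair p)
     (filter (\<lambda>i. fst (T ! i) = vr p) ((if st p then rev else id) [0..<length T]))) ps)"

definition place_val :: "nat \<Rightarrow> ('p \<Rightarrow> bool) \<Rightarrow> ('x \<times> nat) list \<Rightarrow> 'p \<times> nat \<Rightarrow> nat" where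
  "place_val n st T = (\<lambda>(p, i). if st p then n + 1 - snd (T ! i) else snd (T ! i))"

definition before :: "('p::linorder \<Rightarrow> bool) \<Rightarrow> 'p \<times> nat \<Rightarrow> 'p \<times> nat \<Rightarrow> bool" where
  "before st = (\<lambda>(p, i) (q, j). p < q \<or> p = q \<and> (if st p then j < i else i < j))"

lemma subst_place_seq:
  "subst n (table_subst T) (map lett ps)
    = map (place_val n (is_starred \<circ> lett) T) (place_seq (letter_var \<circ> lett) (is_starred \<circ> lett) T ps)"
proof -
  have ts: "table_subst T x = map (\<lambda>i. snd (T ! i)) (filter (\<lambda>i. fst (T ! i) = x) [0..<length T])" for x
  proof -
    have "table_subst T x = map snd (filter (\<lambda>p. fst p = x) (map ((!) T) [0..<length T]))"
      by (simp add: table_subst_def map_nth)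
    then show ?thesis by (simp add: filter_map comp_def)
  qed
  have "subst_letter n (table_subst T) (lett p) = map (place_val n (is_starred \<circ> lett) T) (map (Pair p)
     (filter (\<lambda>i. fst (T ! i) = letter_var (lett p))
       ((if is_starred (lett p) then rev else id) [0..<length T])))" for p
    by (auto simp: subst_letter_def ts word_sharp_def place_val_def comp_def simp flip: rev_map rev_filter)
  then show ?thesis
    by (simp add: subst_def place_seq_def map_concat comp_def)
qed

lemma set_place_seq:
  "set (place_seq vr st T ps) = {(p, i). p \<in> set ps \<and> i < length T \<and> fst (T ! i) = vr p}"
  by (auto simp: place_seq_def split: if_splits)

lemma sorted_place_seq:
  assumes "sorted_wrt (<) ps"
  shows "sorted_wrt (before st) (place_seq vr st T ps)"
  using assms
proof (induction ps)
  case Nil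
  then show ?case by (simp add: place_seq_def)
next
  case (Cons p ps)
  let ?l = "filter (\<lambda>i. fst (T ! i) = vr p) ((if st p then rev else id) [0..<length T])"
  have "sorted_wrt (before st) (map (Pair p) ?l)"
    by (auto simp: sorted_wrt_map before_def sorted_wrt_rev intro!: sorted_wrt_filter)
  moreover have "place_seq vr st T (p # ps) = map (Pair p) ?l @ place_seq vr st T ps"
    by (simp add: place_seq_def)
  ultimately show ?case
    using Cons by (auto simp: sorted_wrt_append set_place_seq before_def)
qed

text \<open>Replaces sequential reading by a first-order condition: what is met before counting
  stops is what precedes every element of \<open>B\<close>.\<close>

lemma cnt_sorted:
  assumes "sorted_wrt R L" "\<And>x y. R x y \<Longrightarrow> \<not> R y x"
  shows "cnt A B L = card {z \<in> set L. z \<in> A \<and> (\<forall>z'\<in>set L. z' \<in> B \<longrightarrow> R z z')}"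
  using assms(1)
proof (induction L)
  case (Cons x L)
  have irr: "\<not> R y y" for y using assms(2)[of y y] by blast
  then have "x \<notin> set L" using Cons.prems by auto
  show ?case
  proof (cases "x \<in> B")
    case True
    then have "{z \<in> set (x # L). z \<in> A \<and> (\<forall>z'\<in>set (x # L). z' \<in> B \<longrightarrow> R z z')} = {}"
      using Cons.prems irr assms(2) by auto
    then show ?thesis using True by (simp add: cnt_Cons)
  next
    case False
    let ?S = "{z \<in> set L. z \<in> A \<and> (\<forall>z'\<in>set L. z' \<in> B \<longrightarrow> R z z')}"
    have "{z \<in> set (x # L). z \<in> A \<and> (\<forall>z'\<in>set (x # L). z' \<in> B \<longrightarrow> R z z')}
        = (if x \<in> A then insert x ?S else ?S)"
      using False Cons.prems by auto
    then show ?thesis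
      using False Cons \<open>x \<notin> set L\<close> by (simp add: cnt_Cons)
  qed
qed simp

text \<open>The quantifier \<open>Hart\<close> counts single positions, so pairs of a place and an
  index are counted separately for each index.\<close>

lemma card_pairs:
  fixes Z :: "('p \<times> nat) set"
  assumes "finite Z" "snd ` Z \<subseteq> {..<k}"
  shows "card Z = (\<Sum>i<k. card {p. (p, i) \<in> Z})"
proof -
  have Z: "Z = (\<Union>i<k. (\<lambda>p. (p, i)) ` {p. (p, i) \<in> Z})" using assms(2) by force
  have fin: "finite {p. (p, i) \<in> Z}" for i
    by (rule finite_subset[of _ "fst ` Z"]) (use assms(1) in force)+
  have "card Z = (\<Sum>i<k. card ((\<lambda>p. (p, i)) ` {p. (p, i) \<in> Z}))"
    by (subst Z, rule card_UN_disjoint) (use fin in auto)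
  then show ?thesis by (simp add: card_image inj_on_def)
qed

lemma cnt_positions:
  fixes ps :: "'p::linorder list" and lett :: "'p \<Rightarrow> 'x letter"
  assumes "sorted_wrt (<) ps"
  defines "st \<equiv> is_starred \<circ> lett" and "vr \<equiv> letter_var \<circ> lett"
  shows "cnt A B ((if d then rev else id) (subst n (table_subst T) (map lett ps))) =
    (\<Sum>i<length T. card {p \<in> set ps. vr p = fst (T ! i) \<and> place_val n st T (p, i) \<in> A \<and>
      (\<forall>q\<in>set ps. \<forall>j<length T. vr q = fst (T ! j) \<and> place_val n st T (q, j) \<in> B \<longrightarrow>
        (if d then before st (q, j) (p, i) else before st (p, i) (q, j)))})"
proof -
  define L where "L = place_seq vr st T ps"
  define R where "R z z' = (if d then before st z' z else before st z z')" for z z'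
  let ?val = "place_val n st T"
  let ?Z = "{z \<in> set L. ?val z \<in> A \<and> (\<forall>z'\<in>set L. ?val z' \<in> B \<longrightarrow> R z z')}"
  have "(if d then rev else id) (subst n (table_subst T) (map lett ps))
      = map ?val ((if d then rev else id) L)"
    by (simp add: subst_place_seq L_def st_def vr_def rev_map)
  then have "cnt A B ((if d then rev else id) (subst n (table_subst T) (map lett ps)))
      = cnt (?val -` A) (?val -` B) ((if d then rev else id) L)"
    by (simp only: cnt_map)
  also have "\<dots> = card {z \<in> set ((if d then rev else id) L). z \<in> ?val -` A \<and>
      (\<forall>z'\<in>set ((if d then rev else id) L). z' \<in> ?val -` B \<longrightarrow> R z z')}"
  proof (rule cnt_sorted)
    show "sorted_wrt R ((if d then rev else id) L)"
      using sorted_place_seq[OF assms(1), of st vr T] unfolding L_def R_def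
      by (cases d) (simp_all add: sorted_wrt_rev)
    show "\<not> R y x" if "R x y" for x y
      using that by (auto simp: R_def before_def split: if_splits)
  qed
  also have "\<dots> = card ?Z" by (rule arg_cong[where f = card]) auto
  also have "\<dots> = (\<Sum>i<length T. card {p. (p, i) \<in> ?Z})"
    by (rule card_pairs, simp, auto simp: L_def set_place_seq)
  also have "\<dots> = (\<Sum>i<length T. card {p \<in> set ps. vr p = fst (T ! i) \<and> ?val (p, i) \<in> A \<and>
      (\<forall>q\<in>set ps. \<forall>j<length T. vr q = fst (T ! j) \<and> ?val (q, j) \<in> B \<longrightarrow> R (p, i) (q, j))})"
    by (intro sum.cong arg_cong[where f = card] HOL.refl) (auto simp: L_def set_place_seq)
  finally show ?thesis by (simp only: R_def)
qed

section \<open>Syntax of encoded identities\<close>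

text \<open>Bits come least significant first and without leading zeros, so a name ends with the bit
  1 and a bit 0 is followed by another bit. The number zero has no bits, hence an asterisk or a
  separator may come directly after a separator.\<close>

fun follow :: "code_symbol \<Rightarrow> code_symbol set" where
  "follow (Bit b) = (if b then {Asterisk, Separator} \<union> range Bit else range Bit)"
| "follow Asterisk = {Separator}"
| "follow Separator = UNIV"
| "follow Approx = - {Approx}"

text \<open>The condition on the first symbol makes the left word nonempty, the one on the last
  symbol makes the right word nonempty and complete.\<close>

definition well_formed :: "code_symbol list \<Rightarrow> bool" where
  "well_formed w \<longleftrightarrow> w \<noteq> [] \<and> hd w \<noteq> Approx \<and> last w = Separator \<and>
    successively (\<lambda>x y. y \<in> follow x) w \<and> count_list w Approx = 1"

lemma binary_last: "binary i = [] \<or> last (binary i)"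
proof (induction i rule: binary.induct)
  case (1 i)
  then show ?case by (cases "i div 2 = 0") (auto simp: binary.simps[of i] binary.simps[of "i div 2"] binary.simps[of 0])
qed

lemma binary_surj: "bs = [] \<or> last bs \<Longrightarrow> \<exists>i. binary i = bs"
proof (induction bs)
  case Nil
  then show ?case by (intro exI[of _ 0]) (simp add: binary.simps)
next
  case (Cons b bs)
  then obtain i where i: "binary i = bs" by (cases bs) auto
  have "b \<or> i \<noteq> 0"
  proof (cases "bs = []")
    case False
    then show ?thesis using i by (auto simp: binary.simps[of 0])
  qed (use Cons.prems in auto)
  then have "binary (2 * i + of_bool b) = b # bs"
    using i by (subst binary.simps) auto
  then show ?case by blast
qed

text \<open>The induction removes one symbol at a time, so a suffix may begin inside a letter. What
  remains of that letter, bits and perhaps an asterisk, is therefore split off.\<close>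

lemma parse_word:
  assumes "successively (\<lambda>x y. y \<in> follow x) w" "w \<noteq> []" "last w = Separator" "Approx \<notin> set w"
  shows "\<exists>bs st u. w = map Bit bs @ (if st then [Asterisk] else []) @ [Separator] @ encode_word u \<and>
    (bs = [] \<or> last bs)"
  using assms
proof (induction w)
  case (Cons c w)
  show ?case
  proof (cases "w = []")
    case True
    then show ?thesis using Cons.prems
      by (intro exI[of _ "[]"] exI[of _ False] exI[of _ "[]"]) (simp add: encode_word_def)
  next
    case False
    then have c: "hd w \<in> follow c" "c \<noteq> Approx" using Cons.prems by (auto simp: successively_Cons)
    obtain bs st u where
      w: "w = map Bit bs @ (if st then [Asterisk] else []) @ [Separator] @ encode_word u"
      and bs: "bs = [] \<or> last bs"
      using Cons False by (auto simp: successively_Cons)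
    show ?thesis
    proof (cases c)
      case (Bit b)
      have "b \<or> bs \<noteq> []" using c(1) Bit w by (auto split: if_splits)
      then show ?thesis
        using w bs Bit by (intro exI[of _ "b # bs"] exI[of _ st] exI[of _ u]) auto
    next
      case Asterisk
      then have "bs = []" "\<not> st" using c(1) w by (cases bs; auto split: if_splits)+
      then show ?thesis
        using w Asterisk by (intro exI[of _ "[]"] exI[of _ True] exI[of _ u]) auto
    next
      case Separator
      obtain i where i: "binary i = bs" using bs binary_surj by blast
      let ?l = "if st then Starred i else Plain i"
      have "c # w = [Separator] @ encode_word (?l # u)"
        using w i Separator by (simp add: encode_word_def)
      then show ?thesis
        by (intro exI[of _ "[]"] exI[of _ False] exI[of _ "?l # u"]) simp
    qed (use c in simp)
  qed
qed simp

lemma parse_nonempty_word: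
  assumes "successively (\<lambda>x y. y \<in> follow x) w" "w \<noteq> []" "last w = Separator" "Approx \<notin> set w"
  shows "\<exists>u. u \<noteq> [] \<and> w = encode_word u"
proof -
  obtain bs st u where
    w: "w = map Bit bs @ (if st then [Asterisk] else []) @ [Separator] @ encode_word u"
    and bs: "bs = [] \<or> last bs"
    using parse_word[OF assms] by blast
  obtain i where "binary i = bs" using bs binary_surj by blast
  then have "w = encode_word ((if st then Starred i else Plain i) # u)"
    using w by (simp add: encode_word_def)
  then show ?thesis by blast
qed

lemma encode_word_Cons: "encode_word (l # u) = encode_letter l @ encode_word u"
  by (simp add: encode_word_def)

lemma encode_letter_form:
  "encode_letter l = map Bit (binary (letter_var l)) @ (if is_starred l then [Asterisk] else []) @ [Separator]"
  by (cases l) simp_all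

lemma encode_word_well_formed:
  "successively (\<lambda>x y. y \<in> follow x) (encode_word u) \<and> Approx \<notin> set (encode_word u) \<and>
   (u \<noteq> [] \<longrightarrow> encode_word u \<noteq> [] \<and> last (encode_word u) = Separator)"
proof (induction u)
  case Nil
  then show ?case by (simp add: encode_word_def)
next
  case (Cons l u)
  have bits: "successively (\<lambda>x y. y \<in> follow x) (map Bit bs)" for bs
    by (induction bs) (auto simp: successively_Cons hd_map)
  have "successively (\<lambda>x y. y \<in> follow x) (encode_letter l)"
    using bits binary_last[of "letter_var l"]
    by (cases "binary (letter_var l) = []")
      (auto simp: encode_letter_form successively_append_iff last_map)
  moreover have "Approx \<notin> set (encode_letter l)" by (auto simp: encode_letter_form)
  moreover have "encode_letter l \<noteq> []" "last (encode_letter l) = Separator"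
    by (simp_all add: encode_letter_form)
  ultimately show ?case
    using Cons by (cases "u = []")
      (auto simp: encode_word_Cons successively_append_iff encode_word_def[of "[]"])
qed

lemma well_formed_iff: "well_formed w \<longleftrightarrow> (\<exists>u v. u \<noteq> [] \<and> v \<noteq> [] \<and> w = encode_identity u v)"
proof
  assume wf: "well_formed w"
  then have "Approx \<in> set w" by (metis count_list_0_iff well_formed_def zero_neq_one)
  then obtain w1 w2 where w: "w = w1 @ Approx # w2" using split_list by metis
  have 1: "Approx \<notin> set w1" "Approx \<notin> set w2" "w1 \<noteq> []" "w2 \<noteq> []"
    using wf by (auto simp: well_formed_def w count_list_0_iff)
  moreover have "last w2 = Separator" using wf 1 by (simp add: well_formed_def w)
  moreover have suc: "successively (\<lambda>x y. y \<in> follow x) w1" "successively (\<lambda>x y. y \<in> follow x) w2"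
    "Approx \<in> follow (last w1)"
    using wf 1 by (auto simp: well_formed_def w successively_append_iff successively_Cons)
  moreover have "last w1 = Separator"
    using suc(3) 1 last_in_set[of w1] by (cases "last w1") (auto split: if_splits)
  ultimately obtain u v where "u \<noteq> []" "w1 = encode_word u" "v \<noteq> []" "w2 = encode_word v"
    using parse_nonempty_word by metis
  then show "\<exists>u v. u \<noteq> [] \<and> v \<noteq> [] \<and> w = encode_identity u v"
    using w by (auto simp: encode_identity_def)
next
  assume "\<exists>u v. u \<noteq> [] \<and> v \<noteq> [] \<and> w = encode_identity u v"
  then obtain u v where uv: "u \<noteq> []" "v \<noteq> []" "w = encode_word u @ Approx # encode_word v"
    by (auto simp: encode_identity_def)
  note wfu = encode_word_well_formed[of u] and wfv = encode_word_well_formed[of v]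
  have "hd (encode_word u) \<in> set (encode_word u)" "hd (encode_word v) \<in> set (encode_word v)"
    using wfu wfv uv by auto
  then have hd: "hd (encode_word u) \<noteq> Approx" "hd (encode_word v) \<noteq> Approx" using wfu wfv by auto
  have "count_list (encode_word u) Approx = 0" "count_list (encode_word v) Approx = 0"
    using wfu wfv by (simp_all add: count_list_0_iff)
  then show "well_formed w"
    using wfu wfv uv hd by (auto simp: well_formed_def successively_append_iff successively_Cons)
qed

section \<open>Occurrences of letters in an encoded word\<close>

text \<open>Positions are counted from \<open>1\<close>, and a letter is represented by the position of its separator.\<close>

definition block_positions :: "code_symbol list \<Rightarrow> nat \<Rightarrow> nat list" where
  "block_positions w p = takeWhile (\<lambda>z. w ! (z - 1) \<notin> {Separator, Approx}) (rev [1..<p])"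

definition name_positions :: "code_symbol list \<Rightarrow> nat \<Rightarrow> nat list" where
  "name_positions w p = filter (\<lambda>z. w ! (z - 1) \<in> range Bit) (block_positions w p)"

text \<open>Read backwards from the separator, hence reversed; this is harmless because names are
  only compared for equality.\<close>

definition name :: "code_symbol list \<Rightarrow> nat \<Rightarrow> code_symbol list" where
  "name w p = map (\<lambda>z. w ! (z - 1)) (name_positions w p)"

definition starred_at :: "code_symbol list \<Rightarrow> nat \<Rightarrow> bool" where
  "starred_at w p \<longleftrightarrow> Asterisk \<in> (\<lambda>z. w ! (z - 1)) ` set (block_positions w p)"

definition separators :: "code_symbol list \<Rightarrow> nat \<Rightarrow> nat \<Rightarrow> nat list" where
  "separators w a b = filter (\<lambda>p. w ! (p - 1) = Separator) [Suc a..<Suc b]"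

lemma map_block_positions:
  assumes "p \<le> Suc (length w)"
  shows "map (\<lambda>z. w ! (z - 1)) (block_positions w p)
    = takeWhile (\<lambda>c. c \<notin> {Separator, Approx}) (rev (take (p - 1) w))"
proof -
  have "map (\<lambda>z. w ! (z - 1)) [1..<p] = take (p - 1) w"
    using assms by (intro nth_equalityI) (auto simp: nth_append)
  then have "rev (take (p - 1) w) = map (\<lambda>z. w ! (z - 1)) (rev [1..<p])"
    by (simp only: rev_map[symmetric])
  then show ?thesis
    by (simp only: block_positions_def takeWhile_map comp_def)
qed

lemma name_eq:
  assumes "p \<le> Suc (length w)"
  shows "name w p = filter (\<lambda>c. c \<in> range Bit)
    (takeWhile (\<lambda>c. c \<notin> {Separator, Approx}) (rev (take (p - 1) w)))"
  unfolding map_block_positions[OF assms, symmetric] by (simp add: name_def name_positions_def filter_map comp_def)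

lemma starred_at_eq:
  assumes "p \<le> Suc (length w)"
  shows "starred_at w p \<longleftrightarrow>
    Asterisk \<in> set (takeWhile (\<lambda>c. c \<notin> {Separator, Approx}) (rev (take (p - 1) w)))"
  unfolding map_block_positions[OF assms, symmetric] by (simp add: starred_at_def)

text \<open>The condition on \<open>z\<close> makes the backward scan from the separator stop
  exactly where the letter begins.\<close>

lemma letter_at_separator:
  assumes "z = [] \<or> last z \<in> {Separator, Approx}" "w = z @ encode_letter l @ r"
    and "p = length z + length (encode_letter l)"
  shows "name w p = rev (map Bit (binary (letter_var l)))" "starred_at w p \<longleftrightarrow> is_starred l"
proof -
  let ?b = "map Bit (binary (letter_var l)) @ (if is_starred l then [Asterisk] else [])"
  have p: "p \<le> Suc (length w)" using assms(2,3) by simp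
  have "take (p - 1) w = z @ ?b"
    using assms(2,3) by (simp add: encode_letter_form)
  moreover have "takeWhile (\<lambda>c. c \<notin> {Separator, Approx}) (rev z) = []"
    using assms(1) by (cases z rule: rev_cases) auto
  ultimately have tw: "takeWhile (\<lambda>c. c \<notin> {Separator, Approx}) (rev (take (p - 1) w)) = rev ?b"
    by (auto simp: takeWhile_append)
  show "name w p = rev (map Bit (binary (letter_var l)))"
    unfolding name_eq[OF p] tw by (auto simp: filter_map comp_def simp flip: rev_filter)
  show "starred_at w p \<longleftrightarrow> is_starred l"
    unfolding starred_at_eq[OF p] tw by auto
qed

lemma separators_letter:
  assumes "w = z @ encode_letter l @ r"
  shows "separators w (length z) (length z + length (encode_letter l)) = [length z + length (encode_letter l)]"
proof -
  obtain k where k: "length (encode_letter l) = Suc k" by (simp add: encode_letter_form)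
  have nth: "w ! (length z + i) = encode_letter l ! i" if "i \<le> k" for i
    using that assms k by (auto simp: nth_append)
  have inner: "encode_letter l ! i \<noteq> Separator" if "i < k" for i
    using that k by (auto simp: encode_letter_form nth_append)
  have "w ! (p - 1) \<noteq> Separator" if "p \<in> set [Suc (length z)..<length z + Suc k]" for p
  proof -
    have "p = Suc (length z + (p - Suc (length z)))" using that by auto
    then obtain i where p: "p = Suc (length z + i)" by blast
    then have "i < k" using that k by auto
    then show ?thesis using nth[of i] inner[of i] p by simp
  qed
  moreover have "encode_letter l ! k = Separator"
    using k by (auto simp: encode_letter_form nth_append)
  then have "w ! (length z + Suc k - 1) = Separator" using nth[of k] by simp
  moreover have "[Suc (length z)..<Suc (length z + Suc k)]
      = [Suc (length z)..<length z + Suc k] @ [length z + Suc k]" by simp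
  ultimately show ?thesis
    unfolding separators_def k by (simp del: upt_Suc)
qed

lemma separators_append:
  assumes "a \<le> b" "b \<le> c"
  shows "separators w a c = separators w a b @ separators w b c"
proof -
  have "[Suc a..<Suc b + (c - b)] = [Suc a..<Suc b] @ [Suc b..<Suc b + (c - b)]"
    by (rule upt_add_eq_append) (use assms in simp)
  moreover have "Suc b + (c - b) = Suc c" using assms by simp
  ultimately show ?thesis by (simp only: separators_def filter_append)
qed

lemma letters_at_separators:
  assumes "z = [] \<or> last z \<in> {Separator, Approx}" "w = z @ encode_word u @ r"
  shows "map (\<lambda>p. (name w p, starred_at w p)) (separators w (length z) (length z + length (encode_word u)))
    = map (\<lambda>l. (rev (map Bit (binary (letter_var l))), is_starred l)) u"
  using assms
proof (induction u arbitrary: z)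
  case Nil
  then show ?case by (simp add: encode_word_def separators_def)
next
  case (Cons l u)
  let ?z = "z @ encode_letter l" and ?p = "length z + length (encode_letter l)"
  have w: "w = z @ encode_letter l @ encode_word u @ r"
    using Cons.prems(2) by (simp add: encode_word_Cons)
  have "map (\<lambda>p. (name w p, starred_at w p)) (separators w (length ?z) (length ?z + length (encode_word u)))
      = map (\<lambda>l. (rev (map Bit (binary (letter_var l))), is_starred l)) u"
    by (rule Cons.IH) (use w in \<open>simp_all add: encode_letter_form\<close>)
  moreover have "separators w (length z) (length z + length (encode_word (l # u)))
      = ?p # separators w (length ?z) (length ?z + length (encode_word u))"
    using separators_append[of "length z" ?p "length z + length (encode_word (l # u))" w]
      separators_letter[OF w] by (simp add: encode_word_Cons add.assoc)
  ultimately show ?case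
    using letter_at_separator[OF Cons.prems(1) w HOL.refl] by simp
qed

text \<open>A total function, so that a word becomes the image of a list of positions as in
  \<open>cnt_positions\<close>. The choice is unique at the separator of an encoded letter.\<close>

definition letter_at :: "code_symbol list \<Rightarrow> nat \<Rightarrow> nat letter" where
  "letter_at w p = (let i = (SOME i. name w p = rev (map Bit (binary i))) in
     if starred_at w p then Starred i else Plain i)"

lemma letter_at_eq:
  assumes "name w p = rev (map Bit (binary (letter_var l)))" "starred_at w p \<longleftrightarrow> is_starred l"
  shows "letter_at w p = l"
proof -
  have "i = letter_var l" if "name w p = rev (map Bit (binary i))" for i
  proof -
    have "map Bit (binary i) = map Bit (binary (letter_var l))" using that assms(1) by simp
    then have "binary i = binary (letter_var l)" by (simp add: inj_map_eq_map inj_def)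
    then show ?thesis by (rule binary_inj)
  qed
  then have "(SOME i. name w p = rev (map Bit (binary i))) = letter_var l"
    using assms(1) by (metis (mono_tags, lifting) some_equality)
  then show ?thesis using assms(2) by (cases l) (simp_all add: letter_at_def)
qed

lemma letter_at_separators:
  assumes "z = [] \<or> last z \<in> {Separator, Approx}" "w = z @ encode_word u @ r"
  defines "ps \<equiv> separators w (length z) (length z + length (encode_word u))"
  shows "map (letter_at w) ps = u"
    and "\<And>p. p \<in> set ps \<Longrightarrow> name w p = rev (map Bit (binary (letter_var (letter_at w p))))"
    and "\<And>p. p \<in> set ps \<Longrightarrow> starred_at w p \<longleftrightarrow> is_starred (letter_at w p)"
proof -
  note eq = letters_at_separators[OF assms(1,2), folded ps_def]
  then have len: "length ps = length u" by (metis length_map)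
  have nth: "name w (ps ! i) = rev (map Bit (binary (letter_var (u ! i)))) \<and>
      (starred_at w (ps ! i) \<longleftrightarrow> is_starred (u ! i))" if "i < length ps" for i
    using arg_cong[OF eq, of "\<lambda>xs. xs ! i"] that len by simp
  then have at: "letter_at w (ps ! i) = u ! i" if "i < length ps" for i
    using that letter_at_eq by blast
  then show "map (letter_at w) ps = u" using len by (intro nth_equalityI) auto
  show "name w p = rev (map Bit (binary (letter_var (letter_at w p))))" if "p \<in> set ps" for p
    using that nth at by (metis in_set_conv_nth)
  show "starred_at w p \<longleftrightarrow> is_starred (letter_at w p)" if "p \<in> set ps" for p
    using that nth at by (metis in_set_conv_nth)
qed

section \<open>The defining formula\<close>

definition fm_imp :: "'a fm \<Rightarrow> 'a fm \<Rightarrow> 'a fm" where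
  "fm_imp f g = Neg (Conj f (Neg g))"

text \<open>The number of counterexamples is compared with the empty sum 0.\<close>

definition fm_all :: "nat \<Rightarrow> 'a fm \<Rightarrow> 'a fm" where
  "fm_all x f = Hart x [Neg f] []"

definition fm_ex :: "nat \<Rightarrow> 'a fm \<Rightarrow> 'a fm" where
  "fm_ex x f = Neg (fm_all x (Neg f))"

definition fm_truth :: "bool \<Rightarrow> 'a fm" where
  "fm_truth b = (if b then Neg (Less 0 0) else Less 0 0)"

definition fm_conjs :: "'a fm list \<Rightarrow> 'a fm" where
  "fm_conjs fs = foldr Conj fs (fm_truth True)"

lemma sem_fm_imp [simp]: "sem w e (fm_imp f g) \<longleftrightarrow> (sem w e f \<longrightarrow> sem w e g)"
  by (simp add: fm_imp_def)

lemma sem_fm_all [simp]: "sem w e (fm_all x f) \<longleftrightarrow> (\<forall>v\<in>{1..length w}. sem w (e(x := v)) f)"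
proof -
  have "finite {v \<in> {1..length w}. \<not> sem w (e(x := v)) f}" by simp
  then show ?thesis unfolding fm_all_def by (simp del: atLeastAtMost_iff) blast
qed

lemma sem_fm_ex [simp]: "sem w e (fm_ex x f) \<longleftrightarrow> (\<exists>v\<in>{1..length w}. sem w (e(x := v)) f)"
  by (simp add: fm_ex_def)

lemma sem_fm_truth [simp]: "sem w e (fm_truth b) \<longleftrightarrow> b"
  by (simp add: fm_truth_def)

lemma sem_fm_conjs [simp]: "sem w e (fm_conjs fs) \<longleftrightarrow> (\<forall>f\<in>set fs. sem w e f)"
  by (induction fs) (simp_all add: fm_conjs_def)

text \<open>The variables \<open>5\<close> to \<open>9\<close> are reserved for the quantifiers inside the following
  building blocks.\<close>

definition fm_block :: "nat \<Rightarrow> nat \<Rightarrow> code_symbol fm" where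
  "fm_block p z = Conj (Less z p)
     (Neg (fm_ex 9 (Conj (Neg (Less 9 z)) (Conj (Less 9 p) (Sym 9 {Separator, Approx})))))"

definition fm_name :: "nat \<Rightarrow> nat \<Rightarrow> code_symbol fm" where
  "fm_name p z = Conj (fm_block p z) (Sym z (range Bit))"

definition fm_star :: "nat \<Rightarrow> code_symbol fm" where
  "fm_star p = fm_ex 7 (Conj (fm_block p 7) (Sym 7 {Asterisk}))"

text \<open>Bits of two names correspond if equally many name positions lie at or above them; this
  rank comparison is again a \<open>Hart\<close> formula. Only \<open>Bit True\<close> is compared,
  the other name positions carrying \<open>Bit False\<close>.\<close>

definition fm_same :: "nat \<Rightarrow> nat \<Rightarrow> code_symbol fm" where
  "fm_same p q = Conj (Hart 7 [fm_name p 7] [fm_name q 7])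
     (fm_all 5 (fm_all 6 (fm_imp
       (fm_conjs [fm_name p 5, fm_name q 6,
         Hart 7 [Conj (fm_name p 7) (Neg (Less 7 5))] [Conj (fm_name q 7) (Neg (Less 7 6))]])
       (Conj (fm_imp (Sym 5 {Bit True}) (Sym 6 {Bit True})) (fm_imp (Sym 6 {Bit True}) (Sym 5 {Bit True}))))))"

definition fm_side :: "bool \<Rightarrow> nat \<Rightarrow> code_symbol fm" where
  "fm_side left p = Conj (Sym p {Separator})
     (fm_ex 8 (Conj (Sym 8 {Approx}) (if left then Less p 8 else Less 8 p)))"

definition fm_val :: "nat \<Rightarrow> nat \<Rightarrow> nat \<Rightarrow> nat set \<Rightarrow> code_symbol fm" where
  "fm_val n p l A = Conj (fm_imp (fm_star p) (fm_truth (n + 1 - l \<in> A))) (fm_imp (Neg (fm_star p)) (fm_truth (l \<in> A)))"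

definition fm_before :: "nat \<Rightarrow> nat \<Rightarrow> nat \<Rightarrow> nat \<Rightarrow> code_symbol fm" where
  "fm_before p i q j = fm_imp (Neg (Less p q)) (Conj (Neg (Less q p))
     (Conj (fm_imp (fm_star p) (fm_truth (j < i))) (fm_imp (Neg (fm_star p)) (fm_truth (i < j)))))"

text \<open>Variables \<open>0\<close>, \<open>1\<close>, \<open>2\<close> name the variables whose images contain the letters \<open>ls\<close>.\<close>

definition fm_count ::
    "nat \<Rightarrow> nat list \<Rightarrow> bool \<Rightarrow> nat set \<Rightarrow> nat set \<Rightarrow> bool \<Rightarrow> nat \<Rightarrow> code_symbol fm" where
  "fm_count n ls d A B left i = fm_conjs [fm_side left 3, fm_same 3 i, fm_val n 3 (ls ! i) A,
     fm_all 4 (fm_conjs (map (\<lambda>j. fm_imp (fm_conjs [fm_side left 4, fm_same 4 j, fm_val n 4 (ls ! j) B])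
       (if d then fm_before 4 j 3 i else fm_before 3 i 4 j)) [0..<length ls]))]"

text \<open>A separator stands for the variable of its letter. The prefix is the same for all lists
  \<open>ls\<close> of at most three letters, which are attached to the first
  \<open>length ls\<close> of the chosen variables. In \<open>fm_count\<close>, variable 3 is the
  counted place and variable 4 a place that may stop the counting.\<close>

definition fm_cond :: "nat \<Rightarrow> nat list \<Rightarrow> bool \<Rightarrow> nat set \<Rightarrow> nat set \<Rightarrow> code_symbol fm" where
  "fm_cond n ls d A B = fm_all 0 (fm_all 1 (fm_all 2 (fm_imp
     (fm_conjs [Sym 0 {Separator}, Sym 1 {Separator}, Sym 2 {Separator}])
     (Hart 3 (map (fm_count n ls d A B True) [0..<length ls])
       (map (fm_count n ls d A B False) [0..<length ls])))))"

definition fm_well_formed :: "code_symbol fm" where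
  "fm_well_formed = fm_conjs [
     fm_ex 0 (fm_truth True),
     fm_all 0 (fm_imp (Neg (fm_ex 1 (Less 1 0))) (Sym 0 (- {Approx}))),
     fm_all 0 (fm_imp (Neg (fm_ex 1 (Less 0 1))) (Sym 0 {Separator})),
     fm_all 0 (fm_all 1 (fm_imp (Conj (Less 0 1) (Neg (fm_ex 2 (Conj (Less 0 2) (Less 2 1)))))
       (fm_conjs (map (\<lambda>c. fm_imp (Sym 0 {c}) (Sym 1 (follow c)))
         [Bit True, Bit False, Asterisk, Separator, Approx])))),
     fm_ex 0 (Sym 0 {Approx}),
     fm_all 0 (fm_all 1 (fm_imp (Conj (Sym 0 {Approx}) (Sym 1 {Approx})) (Neg (Less 0 1))))]"

text \<open>For fixed \<open>n\<close> there are finitely many letter lists of length 0 to 3 and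
  finitely many pairs \<open>a\<close>, \<open>c\<close>, so all of them are expanded into one
  conjunction.\<close>

definition fm_check_id :: "nat \<Rightarrow> code_symbol fm" where
  "fm_check_id n = fm_conjs (fm_well_formed # concat (map (\<lambda>ls. concat (map (\<lambda>a. concat (map (\<lambda>c.
       [fm_cond n ls False {a} {a<..c}, fm_cond n ls True {c} {a..<c}])
     [1..<Suc n])) [1..<Suc n])) (concat (map (\<lambda>k. List.n_lists k [1..<Suc n]) [0..<4]))))"

section \<open>Meaning of the building blocks on an arbitrary input\<close>

lemma ball_concat_map: "(\<forall>f\<in>set (concat (map h xs)). P f) \<longleftrightarrow> (\<forall>x\<in>set xs. \<forall>f\<in>set (h x). P f)"
  by auto

lemma set_takeWhile_sorted:
  assumes "sorted_wrt R L" "\<And>x y. R x y \<Longrightarrow> \<not> R y x"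
  shows "set (takeWhile P L) = {z \<in> set L. P z \<and> (\<forall>y\<in>set L. R y z \<longrightarrow> P y)}"
  using assms(1)
proof (induction L)
  case (Cons x L)
  have "\<not> R x x" using assms(2)[of x x] by blast
  then show ?case using Cons assms(2) by auto
qed simp

lemma set_block_positions:
  "set (block_positions w p) = {z \<in> {1..<p}. \<forall>y\<in>{z..<p}. w ! (y - 1) \<notin> {Separator, Approx}}"
proof -
  have "sorted_wrt (\<lambda>x y. y < x) (rev [1..<p])" by (simp add: sorted_wrt_rev)
  from set_takeWhile_sorted[OF this] show ?thesis
    unfolding block_positions_def by (auto simp: le_less)
qed

text \<open>Variable 9 is bound inside \<open>fm_block\<close> and must not capture an
  argument.\<close>

lemma sem_fm_block:
  assumes "p \<noteq> 9" "z \<noteq> 9" "e p \<in> {1..length w}" "e z \<in> {1..length w}"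
  shows "sem w e (fm_block p z) \<longleftrightarrow> e z \<in> set (block_positions w (e p))"
  using assms unfolding fm_block_def set_block_positions
  by (fastforce simp: not_less)

lemma sem_fm_name:
  assumes "p \<noteq> 9" "z \<noteq> 9" "e p \<in> {1..length w}" "e z \<in> {1..length w}"
  shows "sem w e (fm_name p z) \<longleftrightarrow> e z \<in> set (name_positions w (e p))"
  using assms sem_fm_block[OF assms] by (simp add: fm_name_def name_positions_def)

lemma sem_fm_star:
  assumes "p < 5" "e p \<in> {1..length w}"
  shows "sem w e (fm_star p) \<longleftrightarrow> starred_at w (e p)"
proof -
  have "sem w (e(7 := v)) (fm_block p 7) \<longleftrightarrow> v \<in> set (block_positions w (e p))"
    if "v \<in> {1..length w}" for v
    using sem_fm_block[of p 7 "e(7 := v)" w] assms that by simp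
  moreover have "set (block_positions w (e p)) \<subseteq> {1..length w}"
    using assms(2) by (auto simp: set_block_positions)
  ultimately show ?thesis by (force simp: fm_star_def starred_at_def)
qed

text \<open>In a decreasing list the rank from above recovers the index; so equal cardinalities in
  \<open>fm_same\<close> pick out bits with equal index.\<close>

lemma card_above_nth:
  fixes L :: "nat list"
  assumes "sorted_wrt (\<lambda>x y. y < x) L" "i < length L"
  shows "card {z \<in> set L. \<not> z < L ! i} = Suc i"
proof -
  have less: "L ! k < L ! j" if "j < k" "k < length L" for j k
    using sorted_wrt_nth_less[OF assms(1) that] .
  have "{z \<in> set L. \<not> z < L ! i} = (!) L ` {..i}"
  proof (intro equalityI subsetI)
    fix z assume "z \<in> {z \<in> set L. \<not> z < L ! i}"
    then obtain k where k: "k < length L" "z = L ! k" "\<not> z < L ! i" by (auto simp: in_set_conv_nth)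
    then have "k \<le> i" using less[of i k] by (meson not_le)
    then show "z \<in> (!) L ` {..i}" using k by blast
  next
    fix z assume "z \<in> (!) L ` {..i}"
    then obtain k where k: "k \<le> i" "z = L ! k" by blast
    then have "\<not> z < L ! i" using less[of k i] assms(2) by (cases "k = i") auto
    then show "z \<in> {z \<in> set L. \<not> z < L ! i}" using k assms(2) by simp
  qed
  moreover have "inj_on ((!) L) {..i}"
    using less assms(2) by (intro linorder_inj_onI) (auto, fastforce)
  ultimately show ?thesis by (simp add: card_image)
qed

lemma name_positions_sorted: "sorted_wrt (\<lambda>x y. y < x) (name_positions w p)"
proof -
  have "sorted_wrt (\<lambda>x y. y < x) (rev [1..<p])" by (simp add: sorted_wrt_rev)
  then have "sorted_wrt (\<lambda>x y. y < x) (block_positions w p)"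
    unfolding block_positions_def
    by (metis sorted_wrt_append takeWhile_dropWhile_id)
  then show ?thesis unfolding name_positions_def by (rule sorted_wrt_filter)
qed

lemma sem_fm_same:
  assumes "p < 5" "q < 5" "e p \<in> {1..length w}" "e q \<in> {1..length w}"
  shows "sem w e (fm_same p q) \<longleftrightarrow> name w (e p) = name w (e q)"
proof -
  define L M where "L = name_positions w (e p)" and "M = name_positions w (e q)"
  have LM: "set L \<subseteq> {1..length w}" "set M \<subseteq> {1..length w}"
    using assms by (auto simp: L_def M_def name_positions_def set_block_positions)
  have sorted: "sorted_wrt (\<lambda>x y. y < x) L" "sorted_wrt (\<lambda>x y. y < x) M"
    unfolding L_def M_def by (rule name_positions_sorted)+
  then have "distinct L" "distinct M"
    by (metis (no_types, lifting) less_irrefl sorted_wrt_rev strict_sorted_iff distinct_rev sorted_wrt_mono_rel)+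
  then have card: "card (set L) = length L" "card (set M) = length M" by (simp_all add: distinct_card)
  have mem: "sem w e' (fm_name p z) \<longleftrightarrow> e' z \<in> set L" "sem w e' (fm_name q z) \<longleftrightarrow> e' z \<in> set M"
    if "e' p = e p" "e' q = e q" "z \<in> {5, 6, 7}" "e' z \<in> {1..length w}" for e' z
    using sem_fm_name[of p z e' w] sem_fm_name[of q z e' w] assms that by (auto simp: L_def M_def)
  have restr: "{v \<in> {1..length w}. v \<in> set L \<and> P v} = {v \<in> set L. P v}"
    "{v \<in> {1..length w}. v \<in> set M \<and> P v} = {v \<in> set M. P v}" for P
    using LM by auto
  have sets: "{v \<in> {1..length w}. v \<in> set L} = set L" "{v \<in> {1..length w}. v \<in> set M} = set M"
    using LM by auto
  have ne: "p \<noteq> 5" "p \<noteq> 6" "p \<noteq> 7" "q \<noteq> 5" "q \<noteq> 6" "q \<noteq> 7" using assms by auto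
  have c7: "{v \<in> {1..length w}. sem w (e(7 := v)) (fm_name p 7)} = set L"
      "{v \<in> {1..length w}. sem w (e(7 := v)) (fm_name q 7)} = set M"
    using mem[of "e(7 := _)" 7] ne LM by auto
  have c567: "{v \<in> {1..length w}. sem w (e(5 := r, 6 := s, 7 := v)) (Conj (fm_name p 7) (Neg (Less 7 5)))}
        = {v \<in> set L. \<not> v < r}"
      "{v \<in> {1..length w}. sem w (e(5 := r, 6 := s, 7 := v)) (Conj (fm_name q 7) (Neg (Less 7 6)))}
        = {v \<in> set M. \<not> v < s}" for r s
    using mem[of "e(5 := r, 6 := s, 7 := _)" 7] ne LM by auto
  have c56: "sem w (e(5 := r, 6 := s)) (fm_name p 5) \<longleftrightarrow> r \<in> set L"
    "sem w (e(5 := r, 6 := s)) (fm_name q 6) \<longleftrightarrow> s \<in> set M"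
    if "r \<in> {1..length w}" "s \<in> {1..length w}" for r s
    using mem(1)[of "e(5 := r, 6 := s)" 5] mem(2)[of "e(5 := r, 6 := s)" 6] ne that by simp_all
  have "sem w e (fm_same p q) \<longleftrightarrow> length L = length M \<and>
    (\<forall>r\<in>{1..length w}. \<forall>s\<in>{1..length w}. r \<in> set L \<and> s \<in> set M \<and>
      card {v \<in> set L. \<not> v < r} = card {v \<in> set M. \<not> v < s} \<longrightarrow>
      (w ! (r - 1) = Bit True \<longleftrightarrow> w ! (s - 1) = Bit True))"
    unfolding fm_same_def sem.simps(4,5) sem_fm_all
    by (intro arg_cong2[where f = "(\<and>)"] ball_cong HOL.refl)
      (simp_all only: list.map sum_list.Cons sum_list.Nil add_0_right c7 card sem_fm_imp sem_fm_conjs list.set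
        ball_simps insert_iff empty_iff sem.simps(5) c567 c56, auto)
  also have "\<dots> \<longleftrightarrow> length L = length M \<and> (\<forall>r\<in>set L. \<forall>s\<in>set M.
      card {v \<in> set L. \<not> v < r} = card {v \<in> set M. \<not> v < s} \<longrightarrow>
      (w ! (r - 1) = Bit True \<longleftrightarrow> w ! (s - 1) = Bit True))"
    using LM by blast
  also have "\<dots> \<longleftrightarrow> length L = length M \<and> (\<forall>i<length L. \<forall>j<length M. i = j \<longrightarrow>
      (w ! (L ! i - 1) = Bit True \<longleftrightarrow> w ! (M ! j - 1) = Bit True))"
    using card_above_nth[OF sorted(1)] card_above_nth[OF sorted(2)] by (simp add: all_set_conv_all_nth)
  \<comment> \<open>Name positions carry bits only, so agreement on \<open>Bit True\<close> is
    equality.\<close>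
  also have "\<dots> \<longleftrightarrow> length L = length M \<and> (\<forall>i<length L. w ! (L ! i - 1) = w ! (M ! i - 1))"
  proof -
    have "w ! (x - 1) \<in> range Bit" if "x \<in> set L \<or> x \<in> set M" for x
      using that by (auto simp: L_def M_def name_positions_def)
    then have bit: "i < length L \<Longrightarrow> w ! (L ! i - 1) \<in> range Bit" "i < length M \<Longrightarrow> w ! (M ! i - 1) \<in> range Bit" for i
      by simp_all
    have "(w ! (L ! i - 1) = Bit True \<longleftrightarrow> w ! (M ! i - 1) = Bit True) \<longleftrightarrow> w ! (L ! i - 1) = w ! (M ! i - 1)"
      if "i < length L" "i < length M" for i
      using bit(1)[OF that(1)] bit(2)[OF that(2)] by auto
    then show ?thesis by auto
  qed
  also have "\<dots> \<longleftrightarrow> name w (e p) = name w (e q)"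
    unfolding name_def L_def[symmetric] M_def[symmetric] by (auto simp: list_eq_iff_nth_eq)
  finally show ?thesis .
qed

lemma sem_fm_val:
  assumes "p < 5" "e p \<in> {1..length w}"
  shows "sem w e (fm_val n p l A) \<longleftrightarrow> (if starred_at w (e p) then n + 1 - l else l) \<in> A"
  using sem_fm_star[of p e w] assms by (simp add: fm_val_def)

lemma sem_fm_before:
  assumes "p < 5" "e p \<in> {1..length w}"
  shows "sem w e (fm_before p i q j) \<longleftrightarrow> before (starred_at w) (e p, i) (e q, j)"
  using sem_fm_star[of p e w] assms by (auto simp: fm_before_def before_def)

lemma sem_fm_well_formed: "sem w e fm_well_formed \<longleftrightarrow> well_formed w"
proof -
  have suc: "successively R w \<longleftrightarrow> (\<forall>i. Suc i < length w \<longrightarrow> R (w ! i) (w ! Suc i))"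
    for R and w :: "code_symbol list"
  proof (induction w rule: induct_list012)
    case (3 x y zs)
    then show ?case by (auto simp: nth_Cons' less_Suc_eq_0_disj)
  qed simp_all
  \<comment> \<open>Adjacency is expressed through the absence of a position in between.\<close>
  have adj: "x < y \<and> \<not> (\<exists>z\<in>{1..length w}. x < z \<and> z < y) \<longleftrightarrow> y = Suc x"
    if "x \<in> {1..length w}" "y \<in> {1..length w}" for x y
  proof
    assume *: "x < y \<and> \<not> (\<exists>z\<in>{1..length w}. x < z \<and> z < y)"
    then have "\<not> Suc x < y" using that by (metis Suc_leI atLeastAtMost_iff le_SucI le_trans less_imp_le lessI)
    then show "y = Suc x" using * by simp
  qed auto
  let ?N = "{1..length w}"
  let ?follow = "fm_conjs (map (\<lambda>c. fm_imp (Sym 0 {c}) (Sym 1 (follow c)))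
         [Bit True, Bit False, Asterisk, Separator, Approx])"
  have follow: "sem w e' ?follow \<longleftrightarrow> w ! (e' 1 - 1) \<in> follow (w ! (e' 0 - 1))"
    if "e' 0 \<in> ?N" "e' 1 \<in> ?N" for e'
  proof (cases "w ! (e' 0 - 1)")
    case (Bit b)
    then show ?thesis using that by (cases b) simp_all
  qed (use that in simp_all)
  let ?f1 = "fm_ex 0 (fm_truth True) :: code_symbol fm"
  let ?f2 = "fm_all 0 (fm_imp (Neg (fm_ex 1 (Less 1 0))) (Sym 0 (- {Approx})))"
  let ?f3 = "fm_all 0 (fm_imp (Neg (fm_ex 1 (Less 0 1))) (Sym 0 {Separator}))"
  let ?f4 = "fm_all 0 (fm_all 1 (fm_imp (Conj (Less 0 1) (Neg (fm_ex 2 (Conj (Less 0 2) (Less 2 1))))) ?follow))"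
  let ?f5 = "fm_ex 0 (Sym 0 {Approx})"
  let ?f6 = "fm_all 0 (fm_all 1 (fm_imp (Conj (Sym 0 {Approx}) (Sym 1 {Approx})) (Neg (Less 0 1))))"
  have split: "sem w e fm_well_formed \<longleftrightarrow> sem w e ?f1 \<and> sem w e ?f2 \<and> sem w e ?f3 \<and> sem w e ?f4 \<and>
      sem w e ?f5 \<and> sem w e ?f6"
    unfolding fm_well_formed_def sem_fm_conjs[of w e "[_, _, _, _, _, _]"]
    by (simp only: list.set ball_simps simp_thms)
  have f1: "sem w e ?f1 \<longleftrightarrow> w \<noteq> []"
    by (cases w) auto
  have f2: "sem w e ?f2 \<longleftrightarrow> hd w \<noteq> Approx" if "w \<noteq> []"
  proof -
    have "\<not> (\<exists>y\<in>?N. y < x) \<longleftrightarrow> x = 1" if "x \<in> ?N" for x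
    proof (cases "x = 1")
      case False
      then have "1 \<in> ?N" "1 < x" using that by auto
      then show ?thesis by blast
    qed auto
    then have "sem w e ?f2 \<longleftrightarrow> (\<forall>x\<in>?N. x = 1 \<longrightarrow> w ! (x - 1) \<noteq> Approx)" by auto
    also have "\<dots> \<longleftrightarrow> w ! 0 \<noteq> Approx" using that by (cases w) auto
    finally show ?thesis using that by (simp add: hd_conv_nth)
  qed
  have f3: "sem w e ?f3 \<longleftrightarrow> last w = Separator" if "w \<noteq> []"
  proof -
    have "\<not> (\<exists>y\<in>?N. x < y) \<longleftrightarrow> x = length w" if "x \<in> ?N" for x
    proof (cases "x = length w")
      case False
      then have "length w \<in> ?N" "x < length w" using that by auto
      then show ?thesis by blast
    qed auto
    then have "sem w e ?f3 \<longleftrightarrow> (\<forall>x\<in>?N. x = length w \<longrightarrow> w ! (x - 1) = Separator)" by auto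
    also have "\<dots> \<longleftrightarrow> w ! (length w - 1) = Separator" using that by (cases w) auto
    finally show ?thesis using that by (simp add: last_conv_nth)
  qed
  have f4: "sem w e ?f4 \<longleftrightarrow> successively (\<lambda>x y. y \<in> follow x) w"
  proof -
    have "sem w e ?f4 \<longleftrightarrow> (\<forall>x\<in>?N. \<forall>y\<in>?N. x < y \<and> \<not> (\<exists>z\<in>?N. x < z \<and> z < y) \<longrightarrow>
        w ! (y - 1) \<in> follow (w ! (x - 1)))"
      unfolding sem_fm_all by (intro ball_cong HOL.refl) (subst sem_fm_imp, subst follow, auto)
    also have "\<dots> \<longleftrightarrow> (\<forall>x\<in>?N. \<forall>y\<in>?N. y = Suc x \<longrightarrow> w ! (y - 1) \<in> follow (w ! (x - 1)))"
      by (intro ball_cong HOL.refl) (simp only: adj)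
    also have "\<dots> \<longleftrightarrow> (\<forall>i. Suc i < length w \<longrightarrow> w ! Suc i \<in> follow (w ! i))"
    proof (intro iffI allI impI ballI)
      fix i assume *: "\<forall>x\<in>?N. \<forall>y\<in>?N. y = Suc x \<longrightarrow> w ! (y - 1) \<in> follow (w ! (x - 1))"
        and "Suc i < length w"
      then show "w ! Suc i \<in> follow (w ! i)"
        using *[rule_format, of "Suc i" "Suc (Suc i)"] by simp
    next
      fix x y assume *: "\<forall>i. Suc i < length w \<longrightarrow> w ! Suc i \<in> follow (w ! i)"
        and "x \<in> ?N" "y \<in> ?N" "y = Suc x"
      then show "w ! (y - 1) \<in> follow (w ! (x - 1))"
        using *[rule_format, of "x - 1"] by simp
    qed
    finally show ?thesis by (simp only: suc)
  qed
  have f56: "sem w e ?f5 \<and> sem w e ?f6 \<longleftrightarrow> count_list w Approx = 1"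
  proof -
    let ?S = "{x \<in> ?N. w ! (x - 1) = Approx}"
    have "sem w e ?f5 \<longleftrightarrow> (\<exists>x. x \<in> ?S)" by auto
    moreover have "sem w e ?f6 \<longleftrightarrow>
        (\<forall>x\<in>?N. \<forall>y\<in>?N. w ! (x - 1) = Approx \<and> w ! (y - 1) = Approx \<longrightarrow> \<not> x < y)"
      unfolding sem_fm_all by (intro ball_cong HOL.refl) auto
    ultimately have "sem w e ?f5 \<and> sem w e ?f6 \<longleftrightarrow>
        (\<exists>x. x \<in> ?S) \<and> (\<forall>x y. x \<in> ?S \<and> y \<in> ?S \<longrightarrow> \<not> x < y)"
      by blast
    also have "\<dots> \<longleftrightarrow> (\<exists>x. ?S = {x})"
    proof -
      have "(\<exists>x. x \<in> S) \<and> (\<forall>x y. x \<in> S \<and> y \<in> S \<longrightarrow> \<not> x < y) \<longleftrightarrow> (\<exists>x. S = {x})" for S :: "nat set"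
      proof
        assume *: "(\<exists>x. x \<in> S) \<and> (\<forall>x y. x \<in> S \<and> y \<in> S \<longrightarrow> \<not> x < y)"
        then obtain x where "x \<in> S" by blast
        moreover from this have "y = x" if "y \<in> S" for y
          using * that by (metis linorder_neqE_nat)
        ultimately have "S = {x}" by blast
        then show "\<exists>x. S = {x}" by blast
      qed auto
      then show ?thesis .
    qed
    also have "\<dots> \<longleftrightarrow> card ?S = 1" by (simp only: card_1_singleton_iff One_nat_def)
    also have "card ?S = card {i. i < length w \<and> w ! i = Approx}"
      by (rule bij_betw_same_card[of "\<lambda>x. x - 1"], rule bij_betw_byWitness[where f' = Suc]) auto
    also have "\<dots> = count_list w Approx"
      by (simp add: length_filter_conv_card count_list_eq_length_filter eq_commute)
    finally show ?thesis .
  qed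
  show ?thesis
    unfolding split well_formed_def using f1 f2 f3 f4 f56 by blast
qed

section \<open>Evaluation of the formula on an encoded identity\<close>

context
  fixes u v :: "nat letter list" and w :: "code_symbol list"
  assumes uv: "u \<noteq> []" "v \<noteq> []" and w: "w = encode_identity u v"
begin

text \<open>The symbol \<open>Approx\<close> has position
  \<open>Suc (length (encode_word u))\<close>, and the interval for the right word begins behind
  it.\<close>

definition places :: "bool \<Rightarrow> nat list" where
  "places left = (if left then separators w 0 (length (encode_word u))
     else separators w (Suc (length (encode_word u))) (length w))"

lemma w_eq: "w = encode_word u @ Approx # encode_word v"
  by (simp add: w encode_identity_def)

lemma length_w: "length w = Suc (length (encode_word u) + length (encode_word v))"
  by (simp add: w_eq)

lemma places_letters:
  "map (letter_at w) (places left) = (if left then u else v)"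
  "p \<in> set (places left) \<Longrightarrow> name w p = rev (map Bit (binary (letter_var (letter_at w p))))"
  "p \<in> set (places left) \<Longrightarrow> starred_at w p \<longleftrightarrow> is_starred (letter_at w p)"
proof -
  have L: "separators w (length []) (length [] + length (encode_word u)) = places True"
    by (simp add: places_def)
  have R: "separators w (length (encode_word u @ [Approx]))
      (length (encode_word u @ [Approx]) + length (encode_word v)) = places False"
    by (simp add: places_def length_w)
  note L' = letter_at_separators[of "[]" w u "Approx # encode_word v", unfolded L]
  note R' = letter_at_separators[of "encode_word u @ [Approx]" w v "[]", unfolded R]
  show "map (letter_at w) (places left) = (if left then u else v)"
    using L'(1) R'(1) by (simp add: w_eq)
  show "name w p = rev (map Bit (binary (letter_var (letter_at w p))))" if "p \<in> set (places left)"
    using that L'(2)[of p] R'(2)[of p] by (cases left) (simp_all add: w_eq)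
  show "starred_at w p \<longleftrightarrow> is_starred (letter_at w p)" if "p \<in> set (places left)"
    using that L'(3)[of p] R'(3)[of p] by (cases left) (simp_all add: w_eq)
qed

lemma places_sorted: "sorted_wrt (<) (places left)"
  by (auto simp: places_def separators_def intro!: sorted_wrt_filter simp del: upt_Suc)

lemma approx_position:
  assumes "p \<in> {1..length w}"
  shows "w ! (p - 1) = Approx \<longleftrightarrow> p = Suc (length (encode_word u))"
proof -
  have "Approx \<notin> set (encode_word u)" "Approx \<notin> set (encode_word v)"
    using encode_word_well_formed by blast+
  then have "encode_word u ! i \<noteq> Approx" if "i < length (encode_word u)" for i
    using that nth_mem by metis
  moreover have "encode_word v ! i \<noteq> Approx" if "i < length (encode_word v)" for i
    using that \<open>Approx \<notin> set (encode_word v)\<close> nth_mem by metis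
  ultimately show ?thesis
    using assms by (auto simp: w_eq nth_append nth_Cons' split: if_splits)
qed

lemma sem_fm_side:
  assumes "p < 5" "e p \<in> {1..length w}"
  shows "sem w e (fm_side left p) \<longleftrightarrow> e p \<in> set (places left)"
proof -
  have "Suc (length (encode_word u)) \<in> {1..length w}" by (simp add: w_eq)
  then have approx: "(\<exists>a\<in>{1..length w}. w ! (a - 1) = Approx \<and> P a) \<longleftrightarrow> P (Suc (length (encode_word u)))" for P
    using approx_position by blast
  have "sem w e (fm_side left p) \<longleftrightarrow> w ! (e p - 1) = Separator \<and>
      (\<exists>a\<in>{1..length w}. w ! (a - 1) = Approx \<and> (if left then e p < a else a < e p))"
    using assms by (cases left) (auto simp: fm_side_def)
  also have "\<dots> \<longleftrightarrow> w ! (e p - 1) = Separator \<and>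
      (if left then e p < Suc (length (encode_word u)) else Suc (length (encode_word u)) < e p)"
    by (simp only: approx)
  also have "\<dots> \<longleftrightarrow> e p \<in> set (places left)"
    using assms(2) by (cases left) (auto simp: places_def separators_def length_w simp del: upt_Suc)
  finally show ?thesis .
qed

lemma separator_places:
  assumes "p \<in> {1..length w}"
  shows "w ! (p - 1) = Separator \<longleftrightarrow> p \<in> set (places True) \<union> set (places False)"
proof -
  have "w ! (p - 1) = Separator \<Longrightarrow> p \<noteq> Suc (length (encode_word u))"
    using approx_position[OF assms] by auto
  then show ?thesis
    using assms by (auto simp: places_def separators_def length_w simp del: upt_Suc)
qed

lemma places_subset: "set (places left) \<subseteq> {1..length w}"
  by (auto simp: places_def separators_def length_w simp del: upt_Suc)

lemma same_name_iff:
  assumes "p \<in> set (places l)" "q \<in> set (places l')"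
  shows "name w p = name w q \<longleftrightarrow> letter_var (letter_at w p) = letter_var (letter_at w q)"
proof -
  have "name w p = name w q \<longleftrightarrow> binary (letter_var (letter_at w p)) = binary (letter_var (letter_at w q))"
    unfolding places_letters(2)[OF assms(1)] places_letters(2)[OF assms(2)]
    by (simp add: inj_map_eq_map inj_def)
  then show ?thesis using binary_inj by metis
qed

text \<open>The separators held by the variables 0, 1, 2 determine the table \<open>T\<close>, and
  the sum formed by \<open>Hart\<close> agrees with that of \<open>cnt_positions\<close> index by
  index.\<close>

lemma sum_fm_count:
  assumes e: "\<And>i. i < 3 \<Longrightarrow> e i \<in> set (places True) \<union> set (places False)"
    and ls: "length ls \<le> 3" "T = map (\<lambda>i. (letter_var (letter_at w (e i)), ls ! i)) [0..<length ls]"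
  shows "(\<Sum>f\<leftarrow>map (fm_count n ls d A B left) [0..<length ls].
      card {x \<in> {1..length w}. sem w (e(3 := x)) f})
    = cnt A B ((if d then rev else id) (subst n (table_subst T) (if left then u else v)))"
proof -
  let ?lv = "\<lambda>p. letter_var (letter_at w p)"
  let ?st = "is_starred \<circ> letter_at w"
  have len: "length T = length ls" and nth: "\<And>i. i < length ls \<Longrightarrow> T ! i = (?lv (e i), ls ! i)"
    using ls(2) by simp_all
  have e': "e i \<in> {1..length w}" if "i < 3" for i
    using e[OF that] places_subset by blast
  have same: "sem w e' (fm_same p i) \<longleftrightarrow> ?lv (e' p) = fst (T ! i)"
    if "e' p \<in> set (places left)" "p \<in> {3, 4}" "i < length ls" "\<And>i. i < 3 \<Longrightarrow> e' i = e i" for e' p i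
  proof -
    have i: "i < 3" using that(3) ls(1) by simp
    have "e' p \<in> {1..length w}" using that(1) places_subset by blast
    then have "sem w e' (fm_same p i) \<longleftrightarrow> name w (e' p) = name w (e' i)"
      using that i e'[OF i] by (intro sem_fm_same) auto
    also have "\<dots> \<longleftrightarrow> ?lv (e' p) = ?lv (e' i)"
      using same_name_iff[OF that(1)] e[OF i] that(4)[OF i] by auto
    finally show ?thesis using nth[OF that(3)] that(4)[OF i] by simp
  qed
  have val: "sem w e' (fm_val n p (ls ! i) X) \<longleftrightarrow> place_val n ?st T (e' p, i) \<in> X"
    if "e' p \<in> set (places left)" "p \<in> {3, 4}" "i < length ls" for e' p i X
  proof -
    have "e' p \<in> {1..length w}" using that(1) places_subset by blast
    then show ?thesis
      using sem_fm_val[of p e' w] that places_letters(3)[OF that(1)] nth[OF that(3)]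
      by (auto simp: place_val_def)
  qed
  have bef: "before (starred_at w) (p, i) z \<longleftrightarrow> before ?st (p, i) z"
    if "p \<in> set (places left)" for p i z
    using places_letters(3)[OF that] by (simp add: before_def split: prod.splits)
  have count: "sem w (e(3 := x)) (fm_count n ls d A B left i) \<longleftrightarrow> x \<in> set (places left) \<and>
      ?lv x = fst (T ! i) \<and> place_val n ?st T (x, i) \<in> A \<and>
      (\<forall>q\<in>set (places left). \<forall>j<length T. ?lv q = fst (T ! j) \<and> place_val n ?st T (q, j) \<in> B \<longrightarrow>
        (if d then before ?st (q, j) (x, i) else before ?st (x, i) (q, j)))"
    if i: "i < length ls" and x: "x \<in> {1..length w}" for i x
  proof (cases "x \<in> set (places left)")
    case False
    then show ?thesis
      using sem_fm_side[of 3 "e(3 := x)" left] x by (simp add: fm_count_def)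
  next
    case True
    have inner: "sem w (e(3 := x, 4 := q)) (fm_imp (fm_conjs [fm_side left 4, fm_same 4 j, fm_val n 4 (ls ! j) B])
        (if d then fm_before 4 j 3 i else fm_before 3 i 4 j)) \<longleftrightarrow>
      (q \<in> set (places left) \<longrightarrow> ?lv q = fst (T ! j) \<and> place_val n ?st T (q, j) \<in> B \<longrightarrow>
        (if d then before ?st (q, j) (x, i) else before ?st (x, i) (q, j)))"
      if j: "j < length ls" and q: "q \<in> {1..length w}" for j q
    proof (cases "q \<in> set (places left)")
      case False
      then show ?thesis
        using sem_fm_side[of 4 "e(3 := x, 4 := q)" left] q by simp
    next
      case q': True
      show ?thesis
        using sem_fm_side[of 4 "e(3 := x, 4 := q)" left] q q' x True
          same[of "e(3 := x, 4 := q)" 4 j] val[of "e(3 := x, 4 := q)" 4 j B] j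
          sem_fm_before[of 4 "e(3 := x, 4 := q)" w j 3 i] sem_fm_before[of 3 "e(3 := x, 4 := q)" w i 4 j]
          bef[OF True] bef[OF q']
        by simp
    qed
    have "(\<forall>q\<in>{1..length w}. \<forall>j\<in>{0..<length ls}. sem w (e(3 := x, 4 := q))
        (fm_imp (fm_conjs [fm_side left 4, fm_same 4 j, fm_val n 4 (ls ! j) B])
          (if d then fm_before 4 j 3 i else fm_before 3 i 4 j))) \<longleftrightarrow>
      (\<forall>q\<in>{1..length w}. \<forall>j\<in>{0..<length ls}. q \<in> set (places left) \<longrightarrow>
        ?lv q = fst (T ! j) \<and> place_val n ?st T (q, j) \<in> B \<longrightarrow>
        (if d then before ?st (q, j) (x, i) else before ?st (x, i) (q, j)))"
      by (intro ball_cong HOL.refl inner) auto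
    also have "\<dots> \<longleftrightarrow> (\<forall>q\<in>set (places left). \<forall>j<length T.
        ?lv q = fst (T ! j) \<and> place_val n ?st T (q, j) \<in> B \<longrightarrow>
        (if d then before ?st (q, j) (x, i) else before ?st (x, i) (q, j)))"
    proof -
      \<comment> \<open>Positions that are not places of the chosen word satisfy the implication
        vacuously.\<close>
      have "(\<forall>q\<in>{1..length w}. \<forall>j\<in>{0..<m}. q \<in> set (places left) \<longrightarrow> Q q j) \<longleftrightarrow>
          (\<forall>q\<in>set (places left). \<forall>j<m. Q q j)" for Q and m :: nat
        using places_subset[of left] by (simp only: Ball_def atLeastLessThan_iff le0 simp_thms) blast
      then show ?thesis by (simp only: len)
    qed
    finally have all: "(\<forall>q\<in>{1..length w}. \<forall>j\<in>{0..<length ls}. sem w (e(3 := x, 4 := q))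
        (fm_imp (fm_conjs [fm_side left 4, fm_same 4 j, fm_val n 4 (ls ! j) B])
          (if d then fm_before 4 j 3 i else fm_before 3 i 4 j))) \<longleftrightarrow> \<dots>" .
    have "sem w (e(3 := x)) (fm_side left 3)"
      using sem_fm_side[of 3 "e(3 := x)" left] x True by simp
    moreover have "sem w (e(3 := x)) (fm_same 3 i) \<longleftrightarrow> ?lv x = fst (T ! i)"
      using same[of "e(3 := x)" 3 i] True i by simp
    moreover have "sem w (e(3 := x)) (fm_val n 3 (ls ! i) A) \<longleftrightarrow> place_val n ?st T (x, i) \<in> A"
      using val[of "e(3 := x)" 3 i A] True i by simp
    ultimately show ?thesis
      unfolding fm_count_def sem_fm_conjs
      by (simp only: list.set ball_simps sem_fm_all sem_fm_conjs set_map set_upt simp_thms all True)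
  qed
  have "(\<Sum>f\<leftarrow>map (fm_count n ls d A B left) [0..<length ls].
      card {x \<in> {1..length w}. sem w (e(3 := x)) f})
    = (\<Sum>i<length ls. card {x \<in> {1..length w}. sem w (e(3 := x)) (fm_count n ls d A B left i)})"
    by (simp only: list.map_comp comp_def interv_sum_list_conv_sum_set_nat set_upt atLeast0LessThan)
  also have "\<dots> = (\<Sum>i<length T. card {p \<in> set (places left). ?lv p = fst (T ! i) \<and>
      place_val n ?st T (p, i) \<in> A \<and>
      (\<forall>q\<in>set (places left). \<forall>j<length T. ?lv q = fst (T ! j) \<and> place_val n ?st T (q, j) \<in> B \<longrightarrow>
        (if d then before ?st (q, j) (p, i) else before ?st (p, i) (q, j)))})"
    unfolding len
  proof (intro sum.cong HOL.refl arg_cong[where f = card])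
    fix i assume "i \<in> {..<length ls}"
    then show "{x \<in> {1..length w}. sem w (e(3 := x)) (fm_count n ls d A B left i)} =
      {p \<in> set (places left). ?lv p = fst (T ! i) \<and> place_val n ?st T (p, i) \<in> A \<and>
      (\<forall>q\<in>set (places left). \<forall>j<length ls. ?lv q = fst (T ! j) \<and> place_val n ?st T (q, j) \<in> B \<longrightarrow>
        (if d then before ?st (q, j) (p, i) else before ?st (p, i) (q, j)))}"
      using count[of i] places_subset[of left] len by auto
  qed
  also have "\<dots> = cnt A B ((if d then rev else id) (subst n (table_subst T) (map (letter_at w) (places left))))"
    using cnt_positions[OF places_sorted, of A B d n T "letter_at w" left] by (simp add: comp_def)
  finally show ?thesis unfolding places_letters(1) .
qed

text \<open>Every separator names a variable of the identity and every such variable is named by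
  some separator, so triples of separators produce exactly the tables with letters
  \<open>ls\<close>.\<close>

lemma sem_fm_cond:
  assumes "length ls \<le> 3"
  shows "sem w e (fm_cond n ls d A B) \<longleftrightarrow>
    (\<forall>T. map snd T = ls \<and> fst ` set T \<subseteq> letter_var ` (set u \<union> set v) \<longrightarrow>
      cnt A B ((if d then rev else id) (subst n (table_subst T) u)) =
      cnt A B ((if d then rev else id) (subst n (table_subst T) v)))"
proof -
  let ?P = "set (places True) \<union> set (places False)"
  let ?ok = "\<lambda>T. cnt A B ((if d then rev else id) (subst n (table_subst T) u)) =
      cnt A B ((if d then rev else id) (subst n (table_subst T) v))"
  let ?lv = "\<lambda>p. letter_var (letter_at w p)"
  define tab where "tab e = map (\<lambda>i. (?lv (e i), ls ! i)) [0..<length ls]" for e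
  have vars: "?lv ` ?P = letter_var ` (set u \<union> set v)"
  proof -
    have "letter_at w ` set (places True) = set u" "letter_at w ` set (places False) = set v"
      using places_letters(1)[of True] places_letters(1)[of False] by (metis list.set_map)+
    then show ?thesis by (metis image_Un image_image)
  qed
  have sep: "sem w e' (Sym i {Separator}) \<longleftrightarrow> e' i \<in> ?P" for e' i
  proof (cases "e' i \<in> {1..length w}")
    case True
    then show ?thesis using separator_places[OF True] by simp
  next
    case False
    then have "e' i \<notin> ?P" using places_subset by blast
    with False show ?thesis by auto
  qed
  have "sem w e (fm_cond n ls d A B) \<longleftrightarrow>
    (\<forall>a\<in>{1..length w}. \<forall>b\<in>{1..length w}. \<forall>c\<in>{1..length w}. a \<in> ?P \<and> b \<in> ?P \<and> c \<in> ?P \<longrightarrow>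
      ?ok (tab (e(0 := a, 1 := b, 2 := c))))"
  proof -
    have "sem w (e(0 := a, 1 := b, 2 := c)) (Hart 3 (map (fm_count n ls d A B True) [0..<length ls])
        (map (fm_count n ls d A B False) [0..<length ls])) \<longleftrightarrow> ?ok (tab (e(0 := a, 1 := b, 2 := c)))"
      if "a \<in> ?P" "b \<in> ?P" "c \<in> ?P" for a b c
    proof -
      have "(e(0 := a, 1 := b, 2 := c)) i \<in> ?P" if "i < 3" for i
        using that \<open>a \<in> ?P\<close> \<open>b \<in> ?P\<close> \<open>c \<in> ?P\<close> by (auto simp: less_Suc_eq numeral_3_eq_3)
      from sum_fm_count[OF this assms tab_def] show ?thesis
        by (simp only: sem.simps(5) if_True if_False)
    qed
    then show ?thesis
      unfolding fm_cond_def by (simp add: sep del: sem.simps(1,5))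
  qed
  also have "\<dots> \<longleftrightarrow> (\<forall>T. map snd T = ls \<and> fst ` set T \<subseteq> letter_var ` (set u \<union> set v) \<longrightarrow> ?ok T)"
  proof (intro iffI allI impI ballI)
    fix a b c
    assume R: "\<forall>T. map snd T = ls \<and> fst ` set T \<subseteq> letter_var ` (set u \<union> set v) \<longrightarrow> ?ok T"
      and P: "a \<in> ?P \<and> b \<in> ?P \<and> c \<in> ?P"
    have "map snd (tab (e(0 := a, 1 := b, 2 := c))) = ls"
      by (simp add: tab_def comp_def map_nth)
    moreover have "(e(0 := a, 1 := b, 2 := c)) i \<in> ?P" if "i < length ls" for i
      using that P assms by (auto simp: less_Suc_eq numeral_3_eq_3)
    then have "fst ` set (tab (e(0 := a, 1 := b, 2 := c))) \<subseteq> ?lv ` ?P"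
      unfolding tab_def by (auto simp del: fun_upd_apply)
    ultimately show "?ok (tab (e(0 := a, 1 := b, 2 := c)))" using R unfolding vars by blast
  next
    fix T
    assume L: "\<forall>a\<in>{1..length w}. \<forall>b\<in>{1..length w}. \<forall>c\<in>{1..length w}. a \<in> ?P \<and> b \<in> ?P \<and> c \<in> ?P \<longrightarrow>
      ?ok (tab (e(0 := a, 1 := b, 2 := c)))"
      and T: "map snd T = ls \<and> fst ` set T \<subseteq> letter_var ` (set u \<union> set v)"
    have "places True \<noteq> []" using places_letters(1)[of True] uv(1) by auto
    \<comment> \<open>A default for indices beyond the table; it exists because \<open>u\<close> is
      nonempty.\<close>
    then obtain p0 where p0: "p0 \<in> ?P" by (cases "places True") auto
    have len: "length T = length ls" using T by (metis length_map)
    have "\<exists>p\<in>?P. i < length ls \<longrightarrow> ?lv p = fst (T ! i)" for i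
    proof (cases "i < length ls")
      case True
      then have "fst (T ! i) \<in> fst ` set T" using len by simp
      then have "fst (T ! i) \<in> ?lv ` ?P" using T unfolding vars by blast
      then show ?thesis by auto
    qed (use p0 in blast)
    then obtain g where g: "\<And>i. g i \<in> ?P" "\<And>i. i < length ls \<Longrightarrow> ?lv (g i) = fst (T ! i)" by metis
    have "tab (e(0 := g 0, 1 := g 1, 2 := g 2)) = T"
    proof (rule nth_equalityI)
      fix i assume "i < length (tab (e(0 := g 0, 1 := g 1, 2 := g 2)))"
      then have i: "i < length ls" by (simp add: tab_def)
      have "i = 0 \<or> i = 1 \<or> i = 2" using i assms by linarith
      then have "(e(0 := g 0, 1 := g 1, 2 := g 2)) i = g i" by auto
      then have "tab (e(0 := g 0, 1 := g 1, 2 := g 2)) ! i = (fst (T ! i), ls ! i)"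
        using i g(2)[OF i] by (simp add: tab_def del: fun_upd_apply)
      also have "ls ! i = snd (T ! i)" using T i len by (metis nth_map)
      finally show "tab (e(0 := g 0, 1 := g 1, 2 := g 2)) ! i = T ! i" by (simp only: prod.collapse)
    qed (simp add: tab_def len)
    moreover have "g i \<in> {1..length w}" for i using g(1)[of i] places_subset by blast
    then have "?ok (tab (e(0 := g 0, 1 := g 1, 2 := g 2)))" using L g(1) by blast
    ultimately show "?ok T" by simp
  qed
  finally show ?thesis .
qed

lemma sem_fm_check_id:
  "sem w e (fm_check_id n) \<longleftrightarrow> satisfies_identity (baxt n) (baxt_sharp n) u v"
proof -
  let ?V = "letter_var ` (set u \<union> set v)"
  have wf: "sem w e fm_well_formed" using uv w sem_fm_well_formed well_formed_iff by metis
  define Ls where "Ls = concat (map (\<lambda>k. List.n_lists k [1..<Suc n]) [0..<4])"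
  have Ls: "set Ls = {ls. length ls \<le> 3 \<and> set ls \<subseteq> {1..n}}"
    by (auto simp: Ls_def set_n_lists simp del: upt_Suc) (auto simp: subset_iff)
  have letters: "set [1..<Suc n] = {1..n}" by (auto simp del: upt_Suc)
  have "sem w e (fm_check_id n) \<longleftrightarrow> (\<forall>ls\<in>set Ls. \<forall>a\<in>{1..n}. \<forall>c\<in>{1..n}.
      sem w e (fm_cond n ls False {a} {a<..c}) \<and> sem w e (fm_cond n ls True {c} {a..<c}))"
    unfolding fm_check_id_def Ls_def[symmetric] sem_fm_conjs
    by (simp only: list.set ball_simps ball_concat_map letters wf simp_thms)
  then have "sem w e (fm_check_id n) \<longleftrightarrow> (\<forall>ls. length ls \<le> 3 \<and> set ls \<subseteq> {1..n} \<longrightarrow>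
      (\<forall>a\<in>{1..n}. \<forall>c\<in>{1..n}. sem w e (fm_cond n ls False {a} {a<..c}) \<and>
        sem w e (fm_cond n ls True {c} {a..<c})))"
    unfolding Ls by blast
  also have "\<dots> \<longleftrightarrow> (\<forall>ls. length ls \<le> 3 \<and> set ls \<subseteq> {1..n} \<longrightarrow>
      (\<forall>T. map snd T = ls \<and> fst ` set T \<subseteq> ?V \<longrightarrow>
        same_invariants n (subst n (table_subst T) u) (subst n (table_subst T) v)))"
  proof -
    have "(\<forall>a\<in>{1..n}. \<forall>c\<in>{1..n}. sem w e (fm_cond n ls False {a} {a<..c}) \<and>
        sem w e (fm_cond n ls True {c} {a..<c})) \<longleftrightarrow>
      (\<forall>T. map snd T = ls \<and> fst ` set T \<subseteq> ?V \<longrightarrow>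
        same_invariants n (subst n (table_subst T) u) (subst n (table_subst T) v))"
      if "length ls \<le> 3" for ls
    proof -
      \<comment> \<open>The formula chooses \<open>a\<close> and \<open>c\<close> before the table,
        while the invariants are compared for one table at a time.\<close>
      have swap: "(\<forall>a\<in>X. \<forall>c\<in>X. (\<forall>T. P T \<longrightarrow> E a c T) \<and> (\<forall>T. P T \<longrightarrow> F a c T)) \<longleftrightarrow>
          (\<forall>T. P T \<longrightarrow> (\<forall>a\<in>X. \<forall>c\<in>X. E a c T \<and> F a c T))"
        for X :: "nat set" and P :: "(nat \<times> nat) list \<Rightarrow> bool" and E F
        by blast
      show ?thesis
        unfolding sem_fm_cond[OF that] same_invariants_def if_True if_False id_apply by (rule swap)
    qed
    then show ?thesis by (intro all_cong1 imp_cong HOL.refl) simp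
  qed
  also have "\<dots> \<longleftrightarrow> (\<forall>T. length T \<le> 3 \<and> fst ` set T \<subseteq> ?V \<and> snd ` set T \<subseteq> {1..n} \<longrightarrow>
      same_invariants n (subst n (table_subst T) u) (subst n (table_subst T) v))"
  proof (intro iffI allI impI)
    fix T assume A: "\<forall>ls. length ls \<le> 3 \<and> set ls \<subseteq> {1..n} \<longrightarrow>
      (\<forall>T. map snd T = ls \<and> fst ` set T \<subseteq> ?V \<longrightarrow>
        same_invariants n (subst n (table_subst T) u) (subst n (table_subst T) v))"
      and "length T \<le> 3 \<and> fst ` set T \<subseteq> ?V \<and> snd ` set T \<subseteq> {1..n}"
    then show "same_invariants n (subst n (table_subst T) u) (subst n (table_subst T) v)"
      using A[THEN spec, of "map snd T"] by simp
  next
    fix ls T assume A: "\<forall>T. length T \<le> 3 \<and> fst ` set T \<subseteq> ?V \<and> snd ` set T \<subseteq> {1..n} \<longrightarrow>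
      same_invariants n (subst n (table_subst T) u) (subst n (table_subst T) v)"
      and ls: "length ls \<le> 3 \<and> set ls \<subseteq> {1..n}" and T: "map snd T = ls \<and> fst ` set T \<subseteq> ?V"
    have "length T = length ls" "snd ` set T = set ls"
      using T by (metis length_map, metis list.set_map)
    then show "same_invariants n (subst n (table_subst T) u) (subst n (table_subst T) v)"
      using A[THEN spec, of T] ls T by simp
  qed
  finally show ?thesis unfolding satisfies_identity_iff_tables .
qed

end

theorem theorem6p1:
  fixes n :: nat
  assumes "n \<ge> 1"
  shows "Check_Id (baxt n) (baxt_sharp n) \<in> complexity_P"
proof -
  have "Check_Id (baxt n) (baxt_sharp n) = {w. sem w (\<lambda>_. 0) (fm_check_id n)}"
  proof (intro equalityI subsetI)
    fix w assume "w \<in> Check_Id (baxt n) (baxt_sharp n)"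
    then show "w \<in> {w. sem w (\<lambda>_. 0) (fm_check_id n)}"
      unfolding Check_Id_def using sem_fm_check_id by blast
  next
    fix w assume "w \<in> {w. sem w (\<lambda>_. 0) (fm_check_id n)}"
    then have sem: "sem w (\<lambda>_. 0) (fm_check_id n)" by simp
    \<comment> \<open>The first conjunct excludes strings that encode no identity.\<close>
    then have "well_formed w" by (simp add: fm_check_id_def sem_fm_well_formed)
    then obtain u v where "u \<noteq> []" "v \<noteq> []" "w = encode_identity u v"
      using well_formed_iff by blast
    then show "w \<in> Check_Id (baxt n) (baxt_sharp n)"
      using sem sem_fm_check_id unfolding Check_Id_def by blast
  qed
  then show ?thesis using definable_in_P by simp
qed

end
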